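(* Let $r>1$ be an integer, let $F_r$ be the free group on free generators $x_1,\dots,x_r$, and measure word length with respect to $\mathcal S=\{x_1,\dots,x_r,x_1^{-1},\dots,x_r^{-1}\}$. Let $k\ge 0$ be even. The number of distinct conjugacy classes of commutators in $F_r$ with length $k$ is given by $$\frac{(2r-2)^2(2r-1)^{\frac{k}{2}-1}}{96r}\left(k^2+O_r(k)\right),$$ where the implied constant depends only on $r$ and is effectively computable.
   Context: A commutator in a group $G$ is an element of the form $XYX^{-1}Y^{-1}$ with $X,Y\in G$; the set of commutators is closed under conjugation, so a conjugacy class either consists entirely of commutators or contains none. The length of an element $g$ with respect to a symmetric generating set $\mathcal S$ is the least $m$ such that $g$ is a product of $m$ elements of $\mathcal S$. The length of a conjugacy class is the minimum of the lengths of its elements. $O_r(k)$ is the usual big-O notation, with an implied constant depending only on $r$. *)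

theory Defs
  imports Complex_Main "HOL-Algebra.Generated_Groups"
begin

section \<open>The free group of rank r\<close>

text \<open>The letter \<open>(i, True)\<close> stands for the generator with index \<open>i < r\<close> (indices start at 0),
  \<open>(i, False)\<close> for its inverse. Group elements are reduced words.\<close>

type_synonym letter = "nat \<times> bool"

definition inv_letter :: "letter \<Rightarrow> letter" where
  "inv_letter a = (fst a, \<not> snd a)"

definition reduced :: "letter list \<Rightarrow> bool" where
  "reduced w \<longleftrightarrow> successively (\<lambda>a b. b \<noteq> inv_letter a) w"

fun cons_cancel :: "letter \<Rightarrow> letter list \<Rightarrow> letter list" where
  "cons_cancel a [] = [a]"
| "cons_cancel a (b # w) = (if b = inv_letter a then w else a # b # w)"

definition reduce :: "letter list \<Rightarrow> letter list" where
  "reduce w = foldr cons_cancel w []"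

definition free_group :: "nat \<Rightarrow> letter list monoid" where
  "free_group r = \<lparr>carrier = {w. reduced w \<and> fst ` set w \<subseteq> {..<r}},
                   mult = (\<lambda>u v. reduce (u @ v)), one = []\<rparr>"

definition free_gens :: "nat \<Rightarrow> letter list set" where
  "free_gens r = {[(i, True)] | i. i < r}"

definition free_sym_gens :: "nat \<Rightarrow> letter list set" where
  "free_sym_gens r = free_gens r \<union> m_inv (free_group r) ` free_gens r"

lemma inv_letter_invol [simp]: "inv_letter (inv_letter a) = a"
  by (simp add: inv_letter_def)

lemma fst_inv_letter [simp]: "fst (inv_letter a) = fst a"
  by (simp add: inv_letter_def)

lemma reduced_Nil [simp]: "reduced []"
  by (simp add: reduced_def)

lemma reduced_Cons: "reduced (a # w) \<longleftrightarrow> w = [] \<or> hd w \<noteq> inv_letter a \<and> reduced w"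
  by (auto simp: reduced_def successively_Cons)

lemma reduced_cons_cancel: "reduced w \<Longrightarrow> reduced (cons_cancel a w)"
  by (cases w) (auto simp: reduced_Cons)

lemma cons_cancel_inverse:
  assumes "reduced w" shows "cons_cancel a (cons_cancel (inv_letter a) w) = w"
proof (cases w)
  case (Cons b v)
  then show ?thesis using assms by (cases v) (auto simp: reduced_Cons)
qed simp

lemma reduced_foldr: "reduced w \<Longrightarrow> reduced (foldr cons_cancel u w)"
  by (induction u) (auto intro: reduced_cons_cancel)

lemma reduced_reduce: "reduced (reduce w)"
  by (simp add: reduce_def reduced_foldr)

lemma reduce_reduced: "reduced w \<Longrightarrow> reduce w = w"
proof (induction w)
  case (Cons a w)
  then show ?case by (cases w) (auto simp: reduce_def reduced_Cons)
qed (simp add: reduce_def)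

lemma reduce_append: "reduce (u @ v) = foldr cons_cancel u (reduce v)"
  by (simp add: reduce_def)

lemma foldr_cons_cancel:
  assumes "reduced w"
  shows "foldr cons_cancel (cons_cancel a u) w = cons_cancel a (foldr cons_cancel u w)"
proof (cases u)
  case (Cons b v)
  then show ?thesis
    using cons_cancel_inverse[OF reduced_foldr[OF assms, of v], of a] by auto
qed simp

lemma foldr_reduce:
  "reduced w \<Longrightarrow> foldr cons_cancel (reduce u) w = foldr cons_cancel u w"
  by (induction u) (simp_all add: reduce_def foldr_cons_cancel)

lemma reduce_reduce_append: "reduce (reduce u @ v) = reduce (u @ v)"
  by (simp add: reduce_append foldr_reduce reduced_reduce)

lemma reduce_append_reduce: "reduce (u @ reduce v) = reduce (u @ v)"
  by (simp add: reduce_append reduce_reduced reduced_reduce)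

lemma set_cons_cancel: "set (cons_cancel a w) \<subseteq> insert a (set w)"
  by (cases w) auto

lemma set_reduce: "set (reduce w) \<subseteq> set w"
proof (induction w)
  case (Cons a w)
  then show ?case
    using set_cons_cancel[of a "reduce w"] by (auto simp: reduce_def)
qed (simp add: reduce_def)

lemma reduce_inverse: "reduce (rev (map inv_letter w) @ w) = []"
proof (induction w)
  case (Cons a w)
  have "reduce (inv_letter a # a # w) = reduce w"
    using cons_cancel_inverse[OF reduced_reduce, of "inv_letter a" w]
    by (simp add: reduce_def)
  then have "reduce (rev (map inv_letter (a # w)) @ (a # w)) = reduce (rev (map inv_letter w) @ w)"
    using reduce_append[of "rev (map inv_letter w)"] by simp
  then show ?case using Cons by simp
qed (simp add: reduce_def)

theorem group_free_group: "group (free_group r)"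
proof (rule groupI)
  fix x y assume "x \<in> carrier (free_group r)" "y \<in> carrier (free_group r)"
  then show "x \<otimes>\<^bsub>free_group r\<^esub> y \<in> carrier (free_group r)"
    using set_reduce[of "x @ y"] by (fastforce simp: free_group_def reduced_reduce)
next
  fix x y z
  show "x \<otimes>\<^bsub>free_group r\<^esub> y \<otimes>\<^bsub>free_group r\<^esub> z
      = x \<otimes>\<^bsub>free_group r\<^esub> (y \<otimes>\<^bsub>free_group r\<^esub> z)"
    by (simp add: free_group_def reduce_reduce_append reduce_append_reduce)
next
  fix x assume x: "x \<in> carrier (free_group r)"
  let ?y = "reduce (rev (map inv_letter x))"
  have "?y \<in> carrier (free_group r)"
    using x set_reduce[of "rev (map inv_letter x)"]
    by (fastforce simp: free_group_def reduced_reduce)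
  moreover have "?y \<otimes>\<^bsub>free_group r\<^esub> x = \<one>\<^bsub>free_group r\<^esub>"
    by (simp add: free_group_def reduce_reduce_append reduce_inverse)
  ultimately show "\<exists>y\<in>carrier (free_group r). y \<otimes>\<^bsub>free_group r\<^esub> x = \<one>\<^bsub>free_group r\<^esub>"
    by blast
qed (auto simp: free_group_def reduce_reduced)

section \<open>Length and conjugacy classes\<close>

definition word_length :: "('a, 'b) monoid_scheme \<Rightarrow> 'a set \<Rightarrow> 'a \<Rightarrow> nat" where
  "word_length G S g =
     (LEAST m. \<exists>ws. set ws \<subseteq> S \<and> length ws = m \<and> foldr (mult G) ws \<one>\<^bsub>G\<^esub> = g)"

definition conj_class :: "('a, 'b) monoid_scheme \<Rightarrow> 'a \<Rightarrow> 'a set" where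
  "conj_class G g = {h \<otimes>\<^bsub>G\<^esub> g \<otimes>\<^bsub>G\<^esub> inv\<^bsub>G\<^esub> h | h. h \<in> carrier G}"

definition conj_classes :: "('a, 'b) monoid_scheme \<Rightarrow> 'a set set" where
  "conj_classes G = conj_class G ` carrier G"

definition class_length :: "('a, 'b) monoid_scheme \<Rightarrow> 'a set \<Rightarrow> 'a set \<Rightarrow> nat" where
  "class_length G S c = (LEAST m. \<exists>g\<in>c. word_length G S g = m)"

text \<open>\<open>derived_set G (carrier G)\<close> is the set of commutators of \<open>G\<close>
  (not the subgroup generated by them).\<close>

definition commutator_classes ::
    "('a, 'b) monoid_scheme \<Rightarrow> 'a set \<Rightarrow> nat \<Rightarrow> 'a set set" where
  "commutator_classes G S k =
     {c \<in> conj_classes G. c \<subseteq> derived_set G (carrier G) \<and> class_length G S c = k}"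

section \<open>Computable functions\<close>

text \<open>\<open>recursive_fn n f\<close>: \<open>f\<close> is a total recursive function of \<open>n\<close> arguments, passed as a list of
  length \<open>n\<close>; values on lists of other lengths are irrelevant. Minimisation is only applied
  to functions that have a zero for all arguments, so all functions are total.\<close>

inductive recursive_fn :: "nat \<Rightarrow> (nat list \<Rightarrow> nat) \<Rightarrow> bool" where
  zero: "recursive_fn n (\<lambda>xs. 0)"
| succ: "recursive_fn 1 (\<lambda>xs. Suc (hd xs))"
| proj: "i < n \<Longrightarrow> recursive_fn n (\<lambda>xs. xs ! i)"
| comp: "recursive_fn (length gs) f \<Longrightarrow> (\<forall>g\<in>set gs. recursive_fn n g) \<Longrightarrow>
    recursive_fn n (\<lambda>xs. f (map (\<lambda>g. g xs) gs))"
| prim_rec: "recursive_fn n f \<Longrightarrow> recursive_fn (Suc (Suc n)) g \<Longrightarrow>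
    recursive_fn (Suc n)
      (\<lambda>xs. rec_nat (f (tl xs)) (\<lambda>m v. g (m # v # tl xs)) (hd xs))"
| minim: "recursive_fn (Suc n) f \<Longrightarrow> (\<forall>xs. length xs = n \<longrightarrow> (\<exists>m. f (m # xs) = 0)) \<Longrightarrow>
    recursive_fn n (\<lambda>xs. LEAST m. f (m # xs) = 0)"

definition computable :: "(nat \<Rightarrow> nat) \<Rightarrow> bool" where
  "computable C \<longleftrightarrow> (\<exists>f. recursive_fn 1 f \<and> (\<forall>n. C n = f [n]))"

end

theory Submission
  imports Defs
begin

text \<open>By Wicks' theorem, the cyclically reduced commutators are, up to rotation, the cyclically
  reduced words \<open>A B C A\<^sup>-\<^sup>1 B\<^sup>-\<^sup>1 C\<^sup>-\<^sup>1\<close>. A cyclic word of length \<open>k = 2 n\<close> of this shape is described by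
  three cut points modulo \<open>n\<close>, so there are about \<open>n\<^sup>3 / 6\<close> positions. For fixed arc lengths the count
  of the words factors over the letters at the two triple junctions and is
  \<open>(2 r - 2)\<^sup>2 (2 r - 1)\<^sup>n\<^sup>-\<^sup>1 / (2 r)\<close> up to a relative error that is exponentially small in the shortest
  arc. Two different systems of cut points impose on a word two pairings that differ at \<open>d\<close>
  positions, which costs a factor exponential in \<open>d\<close>, while only \<open>n\<^sup>2\<close> times a polynomial in \<open>d\<close>
  pairs of systems are that close; hence all but a proportion \<open>O (1 / n)\<close> of the words have a unique
  system. Finally almost all words have \<open>2 n\<close> distinct rotations.\<close>

section \<open>Reduced words and conjugacy\<close>

text \<open>The constant: \<open>n^3 / 6\<close> positions divided by \<open>2 n\<close> rotations
  give \<open>n^2 / 12 = k^2 / 48\<close>, and \<open>wicks_density r / 48\<close> is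
  \<open>(2 r - 2)^2 / (96 r)\<close>. The error may be one power of \<open>n\<close> below the main
  term, so at the level of words, where the main term has order \<open>n^3\<close>, every
  exceptional family may have order \<open>n^2\<close>. Crude bounds achieve this for words with an
  empty arc and for periodic words. The delicate family is the overlaps, with a priori
  \<open>n^6\<close> pairs of systems. If two distinct systems disagree at \<open>d\<close>
  positions, one of them has an arc of length at most \<open>d\<close>: longer arcs keep their
  centres, and three centres determine the system. This leaves order \<open>d n^2\<close> choices
  for the first system and polynomially many in \<open>d\<close> for the second, against a weight of
  at most \<open>(1 / 3) ^ (d div 3)\<close>. The resulting series over \<open>d\<close> converges
  to a bound independent of \<open>n\<close> and \<open>r\<close>. Independence of \<open>r\<close>
  also settles effectivity: the implied constant is \<open>L * r ^ 4\<close> with an absolute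
  natural number \<open>L\<close>, which is a computable function of \<open>r\<close> whatever the
  value of \<open>L\<close> is.\<close>

definition winv :: "letter list \<Rightarrow> letter list" where
  "winv w = rev (map inv_letter w)"

definition cyc_reduced :: "letter list \<Rightarrow> bool" where
  "cyc_reduced w \<longleftrightarrow> reduced w \<and> (w \<noteq> [] \<longrightarrow> hd w \<noteq> inv_letter (last w))"

lemma inv_letter_inject [simp]: "inv_letter a = inv_letter b \<longleftrightarrow> a = b"
  by (metis inv_letter_invol)

lemma inv_letter_neq [simp]: "inv_letter a \<noteq> a" "a \<noteq> inv_letter a"
  by (auto simp: inv_letter_def prod_eq_iff)

lemma winv_simps [simp]:
  "winv [] = []" "winv (a # w) = winv w @ [inv_letter a]" "winv (u @ v) = winv v @ winv u"
  "winv (winv w) = w" "length (winv w) = length w" "winv w = [] \<longleftrightarrow> w = []"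
  by (auto simp: winv_def rev_map comp_def)

lemma hd_winv [simp]: "w \<noteq> [] \<Longrightarrow> hd (winv w) = inv_letter (last w)"
  by (simp add: winv_def hd_rev last_map)

lemma last_winv [simp]: "w \<noteq> [] \<Longrightarrow> last (winv w) = inv_letter (hd w)"
  by (simp add: winv_def last_rev hd_map)

lemma fst_set_winv [simp]: "fst ` set (winv w) = fst ` set w"
  by (simp add: winv_def image_image)

lemma reduce_Nil [simp]: "reduce [] = []"
  by (simp add: reduce_def)

lemma reduced_append:
  "reduced (u @ v) \<longleftrightarrow>
     reduced u \<and> reduced v \<and> (u \<noteq> [] \<longrightarrow> v \<noteq> [] \<longrightarrow> hd v \<noteq> inv_letter (last u))"
  by (auto simp: reduced_def successively_append_iff)

lemma reduced_winv [simp]: "reduced (winv w) \<longleftrightarrow> reduced w"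
proof -
  have *: "reduced w \<Longrightarrow> reduced (winv w)" for w
    by (induction w) (auto simp: reduced_append reduced_Cons)
  show ?thesis using *[of w] *[of "winv w"] by auto
qed

lemma cyc_reduced_append_commute: "cyc_reduced (u @ v) \<longleftrightarrow> cyc_reduced (v @ u)"
  by (cases "u = []"; cases "v = []") (auto simp: cyc_reduced_def reduced_append)

lemma rotate_append_ex: "\<exists>u v. w = u @ v \<and> rotate m w = v @ u"
  by (metis append_take_drop_id rotate_drop_take)

lemma cyc_reduced_rotate [simp]: "cyc_reduced (rotate m w) \<longleftrightarrow> cyc_reduced w"
  by (metis cyc_reduced_append_commute rotate_append_ex)

section \<open>Cancellation inside a word and under conjugation\<close>

lemma reduce_cancel [simp]:
  "reduce (u @ a # inv_letter a # v) = reduce (u @ v)"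
  "reduce (u @ inv_letter a # a # v) = reduce (u @ v)"
proof -
  have "reduce (a # inv_letter a # v) = reduce v" for a v
    using cons_cancel_inverse[OF reduced_reduce, of a v] by (simp add: reduce_def)
  from this[of a] this[of "inv_letter a"]
  show "reduce (u @ a # inv_letter a # v) = reduce (u @ v)"
    "reduce (u @ inv_letter a # a # v) = reduce (u @ v)"
    by (simp_all add: reduce_append[of u])
qed

lemma reduce_cong:
  "reduce u = reduce u' \<Longrightarrow> reduce (x @ u @ y) = reduce (x @ u' @ y)"
proof -
  assume "reduce u = reduce u'"
  then have "reduce (u @ y) = reduce (u' @ y)"
    using reduce_reduce_append[of u y] reduce_reduce_append[of u' y] by simp
  then show ?thesis by (simp add: reduce_append[of x])
qed

lemma reduce_winv_cancel [simp]:
  "reduce (u @ winv w @ w @ v) = reduce (u @ v)"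
  "reduce (u @ w @ winv w @ v) = reduce (u @ v)"
proof -
  have *: "reduce (u @ winv w @ w @ v) = reduce (u @ v)" for u w v
    using reduce_cong[of "winv w @ w" "[]" u v] reduce_inverse[of w]
    by (simp add: winv_def reduce_def)
  show "reduce (u @ winv w @ w @ v) = reduce (u @ v)" "reduce (u @ w @ winv w @ v) = reduce (u @ v)"
    using *[of u w v] *[of u "winv w" v] by auto
qed

lemmas reduce_winv_cancel' [simp] =
  reduce_winv_cancel[where v = "[]", simplified]
  reduce_winv_cancel[where u = "[]", simplified]
  reduce_winv_cancel[where u = "[]" and v = "[]", simplified]

text \<open>Induction over the conjugating letters. One more letter cancels against
  \<open>p\<close>, lengthens \<open>p\<close>, or, when \<open>p\<close> is empty, meets the
  rotated word itself. If that word is nonempty, the letter cannot cancel at both of its ends,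
  because it is cyclically reduced; cancellation at one end is a rotation by one letter.\<close>

lemma conj_cyc_reduced:
  assumes "cyc_reduced g"
  shows "\<exists>p m. reduce (h @ g @ winv h) = p @ rotate m g @ winv p"
proof (induction h)
  case Nil
  have "reduce ([] @ g @ winv []) = [] @ rotate 0 g @ winv []"
    using assms by (simp add: cyc_reduced_def reduce_reduced)
  then show ?case by blast
next
  case (Cons a h)
  then obtain p m where pm: "reduce (h @ g @ winv h) = p @ rotate m g @ winv p"
    by blast
  define f where "f = rotate m g"
  have cf: "cyc_reduced f" using assms by (simp add: f_def)
  have red: "reduced (p @ f @ winv p)"
    by (metis pm f_def reduced_reduce)
  have eq: "reduce ((a # h) @ g @ winv (a # h)) = reduce ([a] @ (p @ f @ winv p) @ [inv_letter a])"
    using reduce_cong[of "h @ g @ winv h" "p @ f @ winv p" "[a]" "[inv_letter a]"] pm red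
    by (simp add: f_def reduce_reduced)
  show ?case
  proof (cases p)
    case (Cons b p')
    show ?thesis
    proof (cases "b = inv_letter a")
      case True
      have "reduce ([a] @ (p @ f @ winv p) @ [inv_letter a]) = reduce (p' @ f @ winv p')"
        using reduce_cancel(1)[of "[]" a "p' @ f @ winv p' @ [a, inv_letter a]"]
          reduce_cancel(1)[of "p' @ f @ winv p'" a "[]"]
        by (simp add: Cons True)
      also have "\<dots> = p' @ f @ winv p'"
        using red by (intro reduce_reduced) (auto simp: Cons reduced_append reduced_Cons hd_append split: if_splits)
      finally show ?thesis unfolding eq f_def by blast
    next
      case False
      then have "reduced (([a] @ (p @ f @ winv p)) @ [inv_letter a])"
        using red Cons unfolding reduced_append[of "[a] @ _"] reduced_append[of "[a]"]
        by (simp add: reduced_Cons last_append)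
      then have "reduce ([a] @ (p @ f @ winv p) @ [inv_letter a]) = (a # p) @ f @ winv (a # p)"
        by (simp add: reduce_reduced del: winv_simps(3))
      then show ?thesis unfolding eq f_def by blast
    qed
  next
    case p: Nil
    show ?thesis
    proof (cases "f = []")
      case True
      then have "reduce ([a] @ (p @ f @ winv p) @ [inv_letter a]) = [] @ f @ winv []"
        using p reduce_cancel(1)[of "[]" a "[]"] by (simp add: reduce_def)
      then show ?thesis unfolding eq f_def by blast
    next
      case ne: False
      consider "hd f = inv_letter a" | "last f = a" "hd f \<noteq> inv_letter a"
        | "hd f \<noteq> inv_letter a" "last f \<noteq> a" by blast
      then show ?thesis
      proof cases
        case 1
        then obtain f' where f': "f = inv_letter a # f'" using ne by (cases f) auto
        have r: "rotate 1 f = f' @ [inv_letter a]" by (simp add: f')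
        have "reduced (rotate 1 f)" using cf cyc_reduced_def cyc_reduced_rotate by blast
        then have "reduce ([a] @ (p @ f @ winv p) @ [inv_letter a]) = rotate 1 f"
          using reduce_cancel(1)[of "[]" a "f' @ [inv_letter a]"]
          by (simp add: p f' reduce_reduced)
        then have "reduce ([a] @ (p @ f @ winv p) @ [inv_letter a]) = [] @ rotate (1 + m) g @ winv []"
          by (simp add: f_def rotate_rotate)
        then show ?thesis unfolding eq by blast
      next
        case 2
        then obtain f' where f': "f = f' @ [a]" using ne by (metis append_butlast_last_id)
        have r: "rotate (length f') f = a # f'" by (simp add: f' rotate_append)
        have "reduced (a # f')" using cf cyc_reduced_def cyc_reduced_rotate r by metis
        then have "reduce ([a] @ (p @ f @ winv p) @ [inv_letter a]) = rotate (length f') f"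
          using reduce_cancel(1)[of "a # f'" a "[]"]
          by (simp add: p f' reduce_reduced rotate_append)
        then have "reduce ([a] @ (p @ f @ winv p) @ [inv_letter a])
            = [] @ rotate (length f' + m) g @ winv []"
          by (simp add: f_def rotate_rotate)
        then show ?thesis unfolding eq by blast
      next
        case 3
        have "reduced f" using cf cyc_reduced_def by blast
        then have "reduced ([a] @ (p @ f @ winv p) @ [inv_letter a])"
          using 3 ne p by (auto simp: reduced_append reduced_Cons)
        then have "reduce ([a] @ (p @ f @ winv p) @ [inv_letter a]) = [a] @ f @ winv [a]"
          by (simp add: reduce_reduced p)
        then show ?thesis unfolding eq f_def by blast
      qed
    qed
  qed
qed

text \<open>A nonempty \<open>p\<close> would put a letter and its inverse at the two ends.\<close>

lemma cyc_reduced_conj_trivial: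
  assumes "cyc_reduced (p @ g @ winv p)" shows "p = []"
  using assms by (cases p) (auto simp: cyc_reduced_def)

lemma conj_rotate:
  assumes "cyc_reduced g" "cyc_reduced w" "w = reduce (h @ g @ winv h)"
  shows "\<exists>m. w = rotate m g"
proof -
  obtain p m where pm: "reduce (h @ g @ winv h) = p @ rotate m g @ winv p"
    using conj_cyc_reduced[OF assms(1)] by blast
  then have "p = []" using assms cyc_reduced_conj_trivial by metis
  then show ?thesis using pm assms(3) by auto
qed

lemma reduced_cyc_decomp:
  "reduced x \<Longrightarrow> \<exists>p g. x = p @ g @ winv p \<and> cyc_reduced g"
proof (induction "length x" arbitrary: x rule: less_induct)
  case less
  show ?case
  proof (cases "cyc_reduced x")
    case True
    then have "x = [] @ x @ winv [] \<and> cyc_reduced x" by simp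
    then show ?thesis by blast
  next
    case False
    then have ne: "x \<noteq> []" and h: "hd x = inv_letter (last x)"
      using less.prems by (auto simp: cyc_reduced_def)
    obtain a y where x: "x = a # y" using ne by (cases x) auto
    have "y \<noteq> []" using h x by auto
    then obtain z where y: "y = z @ [inv_letter a]"
      using h x by (metis append_butlast_last_id inv_letter_invol last_ConsR list.sel(1))
    have "reduced z" using less.prems by (auto simp: x y reduced_append reduced_Cons)
    then obtain p g where pg: "z = p @ g @ winv p" "cyc_reduced g"
      using less.hyps[of z] by (auto simp: x y)
    have "x = (a # p) @ g @ winv (a # p) \<and> cyc_reduced g" by (simp add: x y pg)
    then show ?thesis by blast
  qed
qed

section \<open>Conjugacy classes of the free group\<close>

lemma carrier_free_group: "carrier (free_group r) = {w. reduced w \<and> fst ` set w \<subseteq> {..<r}}"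
  by (simp add: free_group_def)

lemma mult_free_group [simp]: "u \<otimes>\<^bsub>free_group r\<^esub> v = reduce (u @ v)"
  by (simp add: free_group_def)

lemma one_free_group [simp]: "\<one>\<^bsub>free_group r\<^esub> = []"
  by (simp add: free_group_def)

lemma inv_free_group:
  assumes "w \<in> carrier (free_group r)" shows "inv\<^bsub>free_group r\<^esub> w = winv w"
proof -
  interpret group "free_group r" by (rule group_free_group)
  have "winv w \<in> carrier (free_group r)"
    using assms by (simp add: carrier_free_group)
  moreover have "winv w \<otimes>\<^bsub>free_group r\<^esub> w = \<one>\<^bsub>free_group r\<^esub>"
    by (simp add: winv_def reduce_inverse)
  ultimately show ?thesis using assms inv_equality by blast
qed

lemma reduce_carrier:
  "fst ` set w \<subseteq> {..<r} \<Longrightarrow> reduce w \<in> carrier (free_group r)"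
  using set_reduce[of w] by (fastforce simp: carrier_free_group reduced_reduce)

lemma conj_class_free_group:
  "conj_class (free_group r) g = {reduce (h @ g @ winv h) | h. h \<in> carrier (free_group r)}"
proof -
  have "h \<otimes>\<^bsub>free_group r\<^esub> g \<otimes>\<^bsub>free_group r\<^esub> inv\<^bsub>free_group r\<^esub> h = reduce (h @ g @ winv h)"
    if "h \<in> carrier (free_group r)" for h
    by (simp add: inv_free_group[OF that] reduce_reduce_append)
  then show ?thesis unfolding conj_class_def
    by (intro Collect_cong ex_cong1) (auto simp del: mult_free_group)
qed

lemma conj_class_eq:
  assumes "group G" "g \<in> carrier G" "x \<in> conj_class G g"
  shows "conj_class G x = conj_class G g"
proof -
  interpret group G by fact
  obtain h where h: "h \<in> carrier G" "x = h \<otimes>\<^bsub>G\<^esub> g \<otimes>\<^bsub>G\<^esub> inv\<^bsub>G\<^esub> h"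
    using assms(3) by (auto simp: conj_class_def)
  have canc: "inv\<^bsub>G\<^esub> h \<otimes>\<^bsub>G\<^esub> (h \<otimes>\<^bsub>G\<^esub> y) = y" if "y \<in> carrier G" for y
    using h that by (simp add: m_assoc[symmetric])
  have g: "g = inv\<^bsub>G\<^esub> h \<otimes>\<^bsub>G\<^esub> x \<otimes>\<^bsub>G\<^esub> inv\<^bsub>G\<^esub> (inv\<^bsub>G\<^esub> h)"
    using h(1) assms(2) by (simp add: h(2) m_assoc canc)
  have xc: "x \<in> carrier G" using h assms(2) by simp
  have sub: "conj_class G (a \<otimes>\<^bsub>G\<^esub> b \<otimes>\<^bsub>G\<^esub> inv\<^bsub>G\<^esub> a) \<subseteq> conj_class G b"
    if "a \<in> carrier G" "b \<in> carrier G" for a b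
  proof
    fix y assume "y \<in> conj_class G (a \<otimes>\<^bsub>G\<^esub> b \<otimes>\<^bsub>G\<^esub> inv\<^bsub>G\<^esub> a)"
    then obtain c where c: "c \<in> carrier G"
      "y = c \<otimes>\<^bsub>G\<^esub> (a \<otimes>\<^bsub>G\<^esub> b \<otimes>\<^bsub>G\<^esub> inv\<^bsub>G\<^esub> a) \<otimes>\<^bsub>G\<^esub> inv\<^bsub>G\<^esub> c"
      by (auto simp: conj_class_def)
    have "y = (c \<otimes>\<^bsub>G\<^esub> a) \<otimes>\<^bsub>G\<^esub> b \<otimes>\<^bsub>G\<^esub> inv\<^bsub>G\<^esub> (c \<otimes>\<^bsub>G\<^esub> a)"
      using c that by (simp add: m_assoc inv_mult_group)
    then show "y \<in> conj_class G b" using c that unfolding conj_class_def by blast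
  qed
  have "conj_class G x \<subseteq> conj_class G g" using sub[OF h(1) assms(2)] h by simp
  moreover have "conj_class G g \<subseteq> conj_class G x" using sub[OF inv_closed[OF h(1)] xc, folded g] .
  ultimately show ?thesis by simp
qed

lemma conj_class_subset_derived_set:
  assumes "group G" "g \<in> derived_set G (carrier G)"
  shows "conj_class G g \<subseteq> derived_set G (carrier G)"
proof
  interpret group G by fact
  obtain a b where ab: "a \<in> carrier G" "b \<in> carrier G"
    "g = a \<otimes>\<^bsub>G\<^esub> b \<otimes>\<^bsub>G\<^esub> inv\<^bsub>G\<^esub> a \<otimes>\<^bsub>G\<^esub> inv\<^bsub>G\<^esub> b"
    using assms(2) by auto
  fix x assume "x \<in> conj_class G g"
  then obtain h where h: "h \<in> carrier G" "x = h \<otimes>\<^bsub>G\<^esub> g \<otimes>\<^bsub>G\<^esub> inv\<^bsub>G\<^esub> h"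
    by (auto simp: conj_class_def)
  let ?a = "h \<otimes>\<^bsub>G\<^esub> a \<otimes>\<^bsub>G\<^esub> inv\<^bsub>G\<^esub> h" and ?b = "h \<otimes>\<^bsub>G\<^esub> b \<otimes>\<^bsub>G\<^esub> inv\<^bsub>G\<^esub> h"
  have canc: "inv\<^bsub>G\<^esub> h \<otimes>\<^bsub>G\<^esub> (h \<otimes>\<^bsub>G\<^esub> y) = y" if "y \<in> carrier G" for y
    using h that by (simp add: m_assoc[symmetric])
  have "x = ?a \<otimes>\<^bsub>G\<^esub> ?b \<otimes>\<^bsub>G\<^esub> inv\<^bsub>G\<^esub> ?a \<otimes>\<^bsub>G\<^esub> inv\<^bsub>G\<^esub> ?b"
    using h ab by (simp add: m_assoc inv_mult_group canc)
  moreover have "?a \<in> carrier G" "?b \<in> carrier G" using h ab by auto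
  ultimately show "x \<in> derived_set G (carrier G)" by blast
qed

section \<open>Word length and class length in the free group\<close>

lemma free_sym_gens_eq: "free_sym_gens r = {[(i, b)] | i b. i < r}"
proof -
  have "inv\<^bsub>free_group r\<^esub> [(i, True)] = [(i, False)]" if "i < r" for i
    using that by (subst inv_free_group) (auto simp: carrier_free_group inv_letter_def reduced_Cons)
  then have "m_inv (free_group r) ` free_gens r = {[(i, False)] | i. i < r}"
    by (force simp: free_gens_def)
  moreover have "{[(i, True)] | i. i < r} \<union> {[(i, False)] | i. i < r} = {[(i, b)] | i b. i < r}"
    by (auto simp: ex_bool_eq)
  ultimately show ?thesis unfolding free_sym_gens_def by (simp add: free_gens_def)
qed

lemma word_length_free_group:
  assumes "w \<in> carrier (free_group r)"
  shows "word_length (free_group r) (free_sym_gens r) w = length w"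
  unfolding word_length_def
proof (rule Least_equality)
  have *: "foldr (mult (free_group r)) (map (\<lambda>a. [a]) w) [] = reduce w" for w
  proof (induction w)
    case (Cons a w)
    then show ?case using reduce_append_reduce[of "[a]" w] by simp
  qed (simp add: reduce_def)
  show "\<exists>ws. set ws \<subseteq> free_sym_gens r \<and> length ws = length w
      \<and> foldr (mult (free_group r)) ws \<one>\<^bsub>free_group r\<^esub> = w"
  proof (intro exI conjI)
    show "set (map (\<lambda>a. [a]) w) \<subseteq> free_sym_gens r"
      using assms by (auto simp: carrier_free_group free_sym_gens_eq)
    show "foldr (mult (free_group r)) (map (\<lambda>a. [a]) w) \<one>\<^bsub>free_group r\<^esub> = w"
      using assms by (simp add: * carrier_free_group reduce_reduced)
  qed simp
next
  fix m
  assume "\<exists>ws. set ws \<subseteq> free_sym_gens r \<and> length ws = m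
      \<and> foldr (mult (free_group r)) ws \<one>\<^bsub>free_group r\<^esub> = w"
  then obtain ws where ws: "set ws \<subseteq> free_sym_gens r" "length ws = m"
    "foldr (mult (free_group r)) ws [] = w" by auto
  have cc: "length (cons_cancel a u) \<le> Suc (length u)" for a u
    by (cases u) auto
  have len: "length (reduce u) \<le> length u" for u
  proof (induction u)
    case (Cons a u)
    then show ?case using cc[of a "reduce u"] by (simp add: reduce_def)
  qed (simp add: reduce_def)
  have "set ws \<subseteq> free_sym_gens r \<Longrightarrow>
      length (foldr (mult (free_group r)) ws []) \<le> length ws" for ws
  proof (induction ws)
    case (Cons a ws)
    then have "length a = 1" by (auto simp: free_sym_gens_eq)
    then show ?case
      using Cons(1,2) len[of "a @ foldr (mult (free_group r)) ws []"]
      by (simp add: free_group_def)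
  qed simp
  then show "length w \<le> m" using ws by auto
qed

text \<open>Canonical representatives: every class in \<open>commutator_classes\<close> of length
  \<open>k\<close> meets this set, and by \<open>conj_class_eq_iff_rotate\<close> it does so in a
  single orbit under rotation.\<close>

definition comm_words :: "nat \<Rightarrow> nat \<Rightarrow> letter list set" where
  "comm_words r k = {w \<in> derived_set (free_group r) (carrier (free_group r)).
     cyc_reduced w \<and> fst ` set w \<subseteq> {..<r} \<and> length w = k}"

lemma conj_class_self: "g \<in> carrier (free_group r) \<Longrightarrow> g \<in> conj_class (free_group r) g"
  by (auto simp: conj_class_free_group carrier_free_group reduce_reduced intro!: exI[of _ "[]"])

text \<open>By \<open>conj_cyc_reduced\<close> every conjugate is a rotation of \<open>g\<close>
  enclosed between some \<open>p\<close> and its inverse, hence no shorter than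
  \<open>g\<close>.\<close>

lemma class_length_free_group:
  assumes "cyc_reduced g" "g \<in> carrier (free_group r)"
  shows "class_length (free_group r) (free_sym_gens r) (conj_class (free_group r) g) = length g"
  unfolding class_length_def
proof (rule Least_equality)
  show "\<exists>x\<in>conj_class (free_group r) g.
      word_length (free_group r) (free_sym_gens r) x = length g"
    using conj_class_self[OF assms(2)] word_length_free_group[OF assms(2)] by blast
next
  fix m assume "\<exists>x\<in>conj_class (free_group r) g.
      word_length (free_group r) (free_sym_gens r) x = m"
  then obtain h where h: "h \<in> carrier (free_group r)"
    "word_length (free_group r) (free_sym_gens r) (reduce (h @ g @ winv h)) = m"
    by (auto simp: conj_class_free_group)
  have "reduce (h @ g @ winv h) \<in> carrier (free_group r)"
    using h assms(2) by (intro reduce_carrier) (auto simp: carrier_free_group image_Un)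
  then have "m = length (reduce (h @ g @ winv h))" using h word_length_free_group by metis
  moreover obtain p i where "reduce (h @ g @ winv h) = p @ rotate i g @ winv p"
    using conj_cyc_reduced[OF assms(1)] by blast
  ultimately show "length g \<le> m" by simp
qed

lemma commutator_classes_eq:
  "commutator_classes (free_group r) (free_sym_gens r) k
     = conj_class (free_group r) ` comm_words r k"
proof (intro equalityI subsetI)
  let ?G = "free_group r"
  fix c assume "c \<in> commutator_classes ?G (free_sym_gens r) k"
  then obtain x where x: "x \<in> carrier ?G" "c = conj_class ?G x"
    and c: "c \<subseteq> derived_set ?G (carrier ?G)" "class_length ?G (free_sym_gens r) c = k"
    by (auto simp: commutator_classes_def conj_classes_def)
  obtain p g where pg: "x = p @ g @ winv p" "cyc_reduced g"
    using reduced_cyc_decomp[of x] x(1) by (auto simp: carrier_free_group)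
  have car: "g \<in> carrier ?G" "p \<in> carrier ?G"
    using x(1) by (auto simp: pg carrier_free_group reduced_append image_Un)
  have "x \<in> conj_class ?G g"
    using car(2) x(1) by (auto simp: conj_class_free_group pg(1) carrier_free_group reduce_reduced
        intro!: exI[of _ p])
  then have ceq: "c = conj_class ?G g"
    using conj_class_eq[OF group_free_group car(1)] x(2) by simp
  have "g \<in> derived_set ?G (carrier ?G)"
    using c(1) ceq conj_class_self[OF car(1)] by blast
  then have "g \<in> comm_words r k"
    using c(2) ceq car pg(2) class_length_free_group[OF pg(2) car(1)]
    unfolding comm_words_def by (simp add: carrier_free_group)
  then show "c \<in> conj_class ?G ` comm_words r k" using ceq by blast
next
  let ?G = "free_group r"
  fix c assume "c \<in> conj_class ?G ` comm_words r k"
  then obtain g where g: "c = conj_class ?G g" "g \<in> derived_set ?G (carrier ?G)"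
    "cyc_reduced g" "fst ` set g \<subseteq> {..<r}" "length g = k" by (auto simp: comm_words_def)
  have car: "g \<in> carrier ?G" using g by (auto simp: carrier_free_group cyc_reduced_def)
  then show "c \<in> commutator_classes ?G (free_sym_gens r) k"
    using g conj_class_subset_derived_set[OF group_free_group g(2)]
      class_length_free_group[OF g(3) car]
    by (auto simp: commutator_classes_def conj_classes_def)
qed

lemma conj_class_eq_iff_rotate:
  assumes "g \<in> carrier (free_group r)" "w \<in> carrier (free_group r)" "cyc_reduced g" "cyc_reduced w"
  shows "conj_class (free_group r) w = conj_class (free_group r) g \<longleftrightarrow> (\<exists>m. w = rotate m g)"
proof
  assume "conj_class (free_group r) w = conj_class (free_group r) g"
  then have "w \<in> conj_class (free_group r) g" using conj_class_self assms by blast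
  then show "\<exists>m. w = rotate m g"
    using conj_rotate[OF assms(3,4)] by (auto simp: conj_class_free_group)
next
  assume "\<exists>m. w = rotate m g"
  then obtain u v where uv: "g = u @ v" "w = v @ u" using rotate_append_ex by metis
  have "w = reduce (winv u @ g @ winv (winv u))"
    using reduce_winv_cancel(1)[of "[]" u "v @ u"] assms(2)
    by (simp add: uv carrier_free_group reduce_reduced)
  moreover have "winv u \<in> carrier (free_group r)"
    using assms(1) by (auto simp: uv carrier_free_group reduced_append image_Un)
  ultimately have "w \<in> conj_class (free_group r) g" unfolding conj_class_free_group by blast
  then show "conj_class (free_group r) w = conj_class (free_group r) g"
    using conj_class_eq[OF group_free_group assms(1)] by simp
qed

section \<open>Wicks forms\<close>

definition wicks :: "letter list \<Rightarrow> letter list \<Rightarrow> letter list \<Rightarrow> letter list" where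
  "wicks A B C = A @ B @ C @ winv A @ winv B @ winv C"

text \<open>The conjugator is any list of letters, neither reduced nor restricted to the first
  \<open>r\<close> generators, so transitivity is mere concatenation.\<close>

definition conj_words :: "letter list \<Rightarrow> letter list \<Rightarrow> bool" where
  "conj_words u v \<longleftrightarrow> (\<exists>h. reduce u = reduce (h @ v @ winv h))"

lemma conj_words_refl: "reduce u = reduce v \<Longrightarrow> conj_words u v"
  unfolding conj_words_def by (intro exI[of _ "[]"]) simp

lemma conj_words_trans:
  assumes "conj_words u v" "conj_words v w" shows "conj_words u w"
proof -
  obtain h where "reduce u = reduce (h @ v @ winv h)" using assms(1) conj_words_def by blast
  moreover obtain h' where "reduce v = reduce (h' @ w @ winv h')"
    using assms(2) conj_words_def by blast
  ultimately have "reduce u = reduce ((h @ h') @ w @ winv (h @ h'))"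
    using reduce_cong[of v "h' @ w @ winv h'" h "winv h"] by simp
  then show ?thesis unfolding conj_words_def by blast
qed

lemma conj_words_append_commute: "conj_words (u @ v) (v @ u)"
  unfolding conj_words_def using reduce_winv_cancel(2)[of "u @ v" u "[]"]
  by (intro exI[of _ u]) simp

lemma wicks_length [simp]: "length (wicks A B C) = 2 * (length A + length B + length C)"
  by (simp add: wicks_def)

text \<open>This symmetry of the triples \<open>(A, B, C)\<close> has order six and permutes the six
  junctions cyclically, so a statement about junctions needs a proof only at the junction of
  \<open>A\<close> and \<open>B\<close>.\<close>

lemma wicks_rotate: "rotate (length A) (wicks A B C) = wicks B C (winv A)"
  by (simp add: wicks_def rotate_append)

lemma wicks_conj_rotate: "conj_words (wicks A B C) (wicks B C (winv A))"
  using conj_words_append_commute[of A "B @ C @ winv A @ winv B @ winv C"]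
  by (simp add: wicks_def)

lemma wicks_empty: "wicks [] A B = wicks A B []" "wicks A [] B = wicks A B []"
  by (simp_all add: wicks_def)

text \<open>Cancelling the letters at the junction of \<open>A\<close> and \<open>B\<close> turns the third arc \<open>C\<close>
  into \<open>C x\<^sup>-\<^sup>1\<close>, so two letters are lost and only one is gained.\<close>

lemma wicks_junction:
  assumes "A \<noteq> []" "B \<noteq> []" "hd B = inv_letter (last A)"
  shows "\<exists>A' B' C'. conj_words (wicks A B C) (wicks A' B' C')
    \<and> length A' + length B' + length C' < length A + length B + length C"
proof -
  obtain A' x where A: "A = A' @ [x]" using assms(1) by (metis append_butlast_last_id)
  obtain B' where B: "B = inv_letter x # B'" using assms(2,3) A by (cases B) auto
  have "reduce (wicks A B C) = reduce (wicks A' B' (C @ [inv_letter x]))"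
    using reduce_cancel(1)[of A' x "B' @ C @ winv A @ winv B @ winv C"]
    by (simp add: A B wicks_def)
  then have "conj_words (wicks A B C) (wicks A' B' (C @ [inv_letter x]))"
    by (rule conj_words_refl)
  then show ?thesis by (intro exI conjI) (assumption, simp add: A B)
qed

text \<open>The inverse is carried along because a Wicks form contains every arc a second time,
  inverted, and both copies have to be replaced by shorter words of the same value.\<close>

lemma not_reduced_shorten:
  assumes "\<not> reduced A"
  shows "\<exists>A'. length A' < length A \<and> reduce A' = reduce A \<and> reduce (winv A') = reduce (winv A)"
  using assms
proof (induction A)
  case (Cons a A)
  show ?case
  proof (cases "reduced A")
    case True
    then obtain B where B: "A = inv_letter a # B"
      using Cons.prems by (cases A) (auto simp: reduced_Cons)
    show ?thesis
      using reduce_cancel(1)[of "[]" a B] reduce_cancel(1)[of "winv B" a "[]"]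
      by (intro exI[of _ B]) (simp add: B)
  next
    case False
    then obtain A' where A': "length A' < length A" "reduce A' = reduce A"
      "reduce (winv A') = reduce (winv A)" using Cons.IH by blast
    show ?thesis
      using A' reduce_cong[OF A'(2), of "[a]" "[]"] reduce_cong[OF A'(3), of "[]" "[inv_letter a]"]
      by (intro exI[of _ "a # A'"]) simp
  qed
qed simp

section \<open>Descent to a cyclically reduced Wicks form\<close>

lemma wicks_cong:
  assumes "reduce A = reduce A'" "reduce (winv A) = reduce (winv A')"
  shows "reduce (wicks A B C) = reduce (wicks A' B C)"
  using reduce_cong[OF assms(1), of "[]" "B @ C @ winv A @ winv B @ winv C"]
    reduce_cong[OF assms(2), of "A' @ B @ C" "winv B @ winv C"]
  by (simp add: wicks_def)

definition shortens :: "letter list \<Rightarrow> letter list \<Rightarrow> letter list \<Rightarrow> bool" where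
  "shortens A B C \<longleftrightarrow> (\<exists>A' B' C'. conj_words (wicks A B C) (wicks A' B' C')
    \<and> length A' + length B' + length C' < length A + length B + length C)"

lemma shortens_rotate: "shortens B C (winv A) \<Longrightarrow> shortens A B C"
  unfolding shortens_def using conj_words_trans[OF wicks_conj_rotate[of A B C]]
  by (fastforce simp: add_ac)

lemma shortens_not_reduced: "\<not> reduced A \<Longrightarrow> shortens A B C"
  unfolding shortens_def
  using not_reduced_shorten[of A] wicks_cong[of A _ B C] conj_words_refl
  by (metis add_less_mono1)

lemma shortens_junction: "A \<noteq> [] \<Longrightarrow> B \<noteq> [] \<Longrightarrow> hd B = inv_letter (last A) \<Longrightarrow> shortens A B C"
  unfolding shortens_def by (rule wicks_junction)

lemma cyc_reduced_wicks:
  assumes "A \<noteq> []" "B \<noteq> []" "C \<noteq> []"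
  shows "cyc_reduced (wicks A B C) \<longleftrightarrow> reduced A \<and> reduced B \<and> reduced C
    \<and> hd B \<noteq> inv_letter (last A) \<and> hd C \<noteq> inv_letter (last B) \<and> last A \<noteq> last C
    \<and> hd A \<noteq> inv_letter (last B) \<and> hd B \<noteq> inv_letter (last C) \<and> hd A \<noteq> hd C"
  using assms by (auto simp: cyc_reduced_def wicks_def reduced_append)

lemma cyc_reduced_wicks2:
  assumes "A \<noteq> []" "B \<noteq> []"
  shows "cyc_reduced (wicks A B []) \<longleftrightarrow> reduced A \<and> reduced B
    \<and> hd B \<noteq> inv_letter (last A) \<and> last A \<noteq> last B
    \<and> hd A \<noteq> inv_letter (last B) \<and> hd A \<noteq> hd B"
  using assms by (auto simp: cyc_reduced_def wicks_def reduced_append)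

text \<open>Cyclic reduction fails either inside an arc or at a junction, and
  \<open>shortens_rotate\<close> moves the defect to the first arc or the first junction. With
  exactly one empty arc the symmetry becomes \<open>(A, B)\<close> to \<open>(B, winv A)\<close>, of
  order four, with four junctions. With a single nonempty arc the word is trivial in the
  group.\<close>

lemma shortens_if_not_cyc_reduced:
  assumes "\<not> cyc_reduced (wicks A B C)" shows "shortens A B C"
proof (cases "reduced A \<and> reduced B \<and> reduced C")
  case False
  then consider "\<not> reduced A" | "\<not> reduced B" | "\<not> reduced C" by blast
  then show ?thesis
  proof cases
    case 2 then show ?thesis by (intro shortens_rotate[of B] shortens_not_reduced)
  next
    case 3 then show ?thesis
      by (intro shortens_rotate[of B] shortens_rotate[of C] shortens_not_reduced)
  qed (rule shortens_not_reduced)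
next
  case red: True
  have one: "shortens A [] []" if "A \<noteq> []" for A
  proof -
    have "conj_words (wicks A [] []) (wicks [] [] [])"
      by (intro conj_words_refl) (simp add: wicks_def)
    then show ?thesis using that unfolding shortens_def
      by (metis add_is_0 gr0I length_greater_0_conv list.size(3))
  qed
  have two: "shortens A B []" if nc: "\<not> cyc_reduced (wicks A B [])" "reduced A" "reduced B" for A B
  proof (cases "A = [] \<or> B = []")
    case True
    have "A \<noteq> [] \<or> B \<noteq> []" using nc by (auto simp: wicks_def cyc_reduced_def)
    then show ?thesis using True one[of A] one[of B] shortens_rotate[of B "[]" A] by auto
  next
    case False
    have empty: "shortens A [] B = shortens A B []" for A B
      by (simp add: shortens_def wicks_empty)
    have step: "shortens A B []" if "shortens B (winv A) []" for A B
      using that shortens_rotate[of B "[]" A] by (simp add: empty)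
    consider "hd B = inv_letter (last A)" | "last A = last B"
      | "hd A = inv_letter (last B)" | "hd A = hd B"
      using nc False cyc_reduced_wicks2[of A B] by blast
    then show ?thesis
    proof cases
      case 1 then show ?thesis using False by (intro shortens_junction) auto
    next
      case 2 then show ?thesis using False step[OF shortens_junction[of B "winv A" "[]"]] by auto
    next
      case 3 then show ?thesis
        using False step[OF step[OF shortens_junction[of "winv A" "winv B" "[]"]]] by auto
    next
      case 4 then show ?thesis
        using False step[OF step[OF step[OF shortens_junction[of "winv B" "winv (winv A)" "[]"]]]]
        by auto
    qed
  qed
  have empties: "shortens [] A B = shortens A B []" "shortens A [] B = shortens A B []" for A B
    by (simp_all add: shortens_def wicks_empty)
  consider "A = []" | "B = []" | "C = []" | "A \<noteq> []" "B \<noteq> []" "C \<noteq> []" by blast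
  then show ?thesis
  proof cases
    case 1 then show ?thesis using assms red two[of B C] by (simp add: wicks_empty empties)
  next
    case 2 then show ?thesis using assms red two[of A C] by (simp add: wicks_empty empties)
  next
    case 3 then show ?thesis using assms red two[of A B] by simp
  next
    case 4
    consider "hd B = inv_letter (last A)" | "hd C = inv_letter (last B)" | "last A = last C"
      | "hd A = inv_letter (last B)" | "hd B = inv_letter (last C)" | "hd A = hd C"
      using assms red cyc_reduced_wicks[OF 4] by blast
    then show ?thesis
    proof cases
      case 1 then show ?thesis
        using 4 shortens_junction[of "A" "B" "C"] by auto
    next
      case 2 then show ?thesis
        using 4 shortens_rotate[OF shortens_junction[of "B" "C" "winv A"]] by auto
    next
      case 3 then show ?thesis
        using 4 shortens_rotate[OF shortens_rotate[OF shortens_junction[of "C" "winv A" "winv B"]]] by auto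
    next
      case d: 4 then show ?thesis
        using 4 shortens_rotate[OF shortens_rotate[OF shortens_rotate[OF shortens_junction[of "winv A" "winv B" "winv C"]]]] by auto
    next
      case 5 then show ?thesis
        using 4 shortens_rotate[OF shortens_rotate[OF shortens_rotate[OF shortens_rotate[OF shortens_junction[of "winv B" "winv C" "winv (winv A)"]]]]] by auto
    next
      case 6 then show ?thesis
        using 4 shortens_rotate[OF shortens_rotate[OF shortens_rotate[OF shortens_rotate[OF shortens_rotate[OF shortens_junction[of "winv C" "winv (winv A)" "winv (winv B)"]]]]]] by auto
    qed
  qed
qed

lemma wicks_cyc_reduced_ex:
  "\<exists>A' B' C'. conj_words (wicks A B C) (wicks A' B' C') \<and> cyc_reduced (wicks A' B' C')"
proof (induction "length A + length B + length C" arbitrary: A B C rule: less_induct)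
  case less
  show ?case
  proof (cases "cyc_reduced (wicks A B C)")
    case True
    then show ?thesis using conj_words_refl by blast
  next
    case False
    then show ?thesis using shortens_if_not_cyc_reduced[OF False] less conj_words_trans
      unfolding shortens_def by meson
  qed
qed

text \<open>The commutator of \<open>a\<close> and \<open>b\<close> is the Wicks form with third arc
  empty. The descent turns it into a cyclically reduced Wicks form conjugate to \<open>w\<close>,
  and conjugate cyclically reduced words are rotations of each other.\<close>

theorem comm_words_wicks:
  assumes "w \<in> comm_words r k"
  shows "\<exists>s A B C. rotate s w = wicks A B C"
proof -
  obtain a b where ab: "a \<in> carrier (free_group r)" "b \<in> carrier (free_group r)"
    "w = reduce (reduce (reduce (a @ b) @ winv a) @ winv b)" and cr: "cyc_reduced w"
    using assms by (auto simp: comm_words_def inv_free_group)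
  have "w = reduce (wicks a b [])"
    using reduce_reduce_append[of "reduce (a @ b) @ winv a" "winv b"]
      reduce_reduce_append[of "a @ b" "winv a @ winv b"]
    by (simp add: ab(3) wicks_def)
  moreover obtain A B C where ABC: "conj_words (wicks a b []) (wicks A B C)"
    "cyc_reduced (wicks A B C)" using wicks_cyc_reduced_ex by blast
  ultimately obtain h where "w = reduce (h @ wicks A B C @ winv h)"
    unfolding conj_words_def by auto
  then obtain m where "w = rotate m (wicks A B C)"
    using conj_rotate[OF ABC(2) cr] by blast
  then obtain u v where "w = v @ u" "wicks A B C = u @ v" using rotate_append_ex by metis
  then have "rotate (length v) w = wicks A B C" by (simp add: rotate_append)
  then show ?thesis by blast
qed

text \<open>\<open>wicks A B C\<close> is the commutator of \<open>A @ B\<close> and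
  \<open>C @ winv A\<close>: in the expanded commutator the factors \<open>winv A\<close> and
  \<open>A\<close> in front of \<open>winv C\<close> cancel.\<close>

lemma wicks_comm_words:
  assumes "rotate s w = wicks A B C" "cyc_reduced w" "fst ` set w \<subseteq> {..<r}" "length w = k"
  shows "w \<in> comm_words r k"
proof -
  let ?G = "free_group r"
  have red: "reduced (wicks A B C)"
    using assms(1,2) by (metis cyc_reduced_def cyc_reduced_rotate)
  have "set (wicks A B C) = set w" using assms(1) by (metis set_rotate)
  then have sub: "fst ` set (wicks A B C) \<subseteq> {..<r}" using assms(3) by simp
  have car: "A @ B \<in> carrier ?G" "C @ winv A \<in> carrier ?G"
    using sub red by (auto simp: carrier_free_group wicks_def image_Un reduced_append)
  have "reduce (reduce (reduce ((A @ B) @ C @ winv A) @ winv (A @ B)) @ winv (C @ winv A))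
      = reduce (wicks A B C)"
    using reduce_reduce_append[of "reduce ((A @ B) @ C @ winv A) @ winv (A @ B)" "winv (C @ winv A)"]
      reduce_reduce_append[of "(A @ B) @ C @ winv A" "winv (A @ B) @ winv (C @ winv A)"]
      reduce_winv_cancel(1)[of "A @ B @ C @ winv A @ winv B" A "winv C"]
    by (simp add: wicks_def)
  then have der: "wicks A B C \<in> derived_set ?G (carrier ?G)"
    using car inv_free_group[OF car(1)] inv_free_group[OF car(2)] red
    by (intro UN_I[OF car(1)] UN_I[OF car(2)]) (simp add: reduce_reduced)
  have wcar: "w \<in> carrier ?G" "wicks A B C \<in> carrier ?G"
    using assms(2,3) red sub by (auto simp: carrier_free_group cyc_reduced_def)
  have "conj_class ?G (wicks A B C) = conj_class ?G w"
  proof -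
    have "cyc_reduced (wicks A B C)" using assms(1,2) by (metis cyc_reduced_rotate)
    then show ?thesis
      using conj_class_eq_iff_rotate[OF wcar assms(2)] assms(1)[symmetric] by blast
  qed
  then have "w \<in> derived_set ?G (carrier ?G)"
    using subsetD[OF conj_class_subset_derived_set[OF group_free_group der], of w]
      conj_class_self[OF wcar(1)] by simp
  then show ?thesis using assms by (simp add: comm_words_def)
qed

section \<open>Counting reduced words\<close>

definition letters :: "nat \<Rightarrow> letter set" where
  "letters r = {..<r} \<times> UNIV"

lemma in_letters_iff: "a \<in> letters r \<longleftrightarrow> fst a < r"
  by (cases a) (simp add: letters_def)

lemma finite_letters [simp]: "finite (letters r)"
  by (simp add: letters_def)

lemma card_letters [simp]: "card (letters r) = 2 * r"
  by (simp add: letters_def card_cartesian_product)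

lemma inv_letter_in_letters [simp]: "inv_letter a \<in> letters r \<longleftrightarrow> a \<in> letters r"
  by (simp add: in_letters_iff)

lemma set_subset_letters_iff: "set w \<subseteq> letters r \<longleftrightarrow> fst ` set w \<subseteq> {..<r}"
  by (auto simp: in_letters_iff)

lemma set_winv_letters [simp]: "set (winv w) \<subseteq> letters r \<longleftrightarrow> set w \<subseteq> letters r"
  by (simp add: set_subset_letters_iff)

lemma inv_letter_eq_iff: "inv_letter a = b \<longleftrightarrow> a = inv_letter b"
  by auto

lemma finite_words: "finite {w. length w = n \<and> set w \<subseteq> letters r}"
  using finite_lists_length_eq[OF finite_letters, of r n] by (simp add: conj_commute)

text \<open>\<open>U\<close> is the set of free positions. A letter at a free position only has to
  avoid the inverse of its predecessor; at any other position the prefix fixes it.\<close>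

lemma card_reduced_extend:
  assumes S: "\<And>w. w \<in> S \<Longrightarrow> reduced w \<and> length w = L \<and> set w \<subseteq> letters r"
    and det: "\<And>v w i. v \<in> S \<Longrightarrow> w \<in> S \<Longrightarrow> i < L \<Longrightarrow> i \<notin> U \<Longrightarrow> take i v = take i w \<Longrightarrow> v ! i = w ! i"
    and l: "0 < l" "l < L" and u: "u \<in> take l ` S"
  shows "card {v ! l | v. v \<in> S \<and> take l v = u} \<le> (if l \<in> U then 2 * r - 1 else 1)"
proof (cases "l \<in> U")
  case True
  obtain l' where l': "l = Suc l'" using l by (cases l) auto
  have "v ! l \<noteq> inv_letter (u ! l')" if "v \<in> S" "take l v = u" for v
    using S[OF that(1)] that(2) l unfolding reduced_def l'
    by (auto simp: successively_conv_nth)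
  moreover have "v ! l \<in> letters r" if "v \<in> S" for v
    using S[OF that] l nth_mem by blast
  ultimately have sub: "{v ! l | v. v \<in> S \<and> take l v = u} \<subseteq> letters r - {inv_letter (u ! l')}"
    by (intro subsetI; elim CollectE exE conjE; simp)
  obtain x where x: "x \<in> S" "u = take l x" using u by blast
  have "x ! l' \<in> letters r" using S[OF x(1)] l nth_mem[of l' x] unfolding l' by auto
  then have "u ! l' \<in> letters r" by (simp add: x(2) l')
  then have "card (letters r - {inv_letter (u ! l')}) = 2 * r - 1" by simp
  then show ?thesis using card_mono[OF _ sub] True by simp
next
  case False
  obtain v0 where v0: "v0 \<in> S" "take l v0 = u" using u by blast
  have "{v ! l | v. v \<in> S \<and> take l v = u} \<subseteq> {v0 ! l}"
    using det[OF _ v0(1) l(2) False] v0(2) by auto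
  then have "card {v ! l | v. v \<in> S \<and> take l v = u} \<le> card {v0 ! l}"
    by (intro card_mono) auto
  then show ?thesis using False by simp
qed

text \<open>Position 0 has no predecessor and is always granted \<open>2 * r\<close> choices, in
  \<open>U\<close> or not; hence the exponent counts \<open>U\<close> from position 1 on.\<close>

lemma card_reduced_determined_prefix:
  assumes S: "\<And>w. w \<in> S \<Longrightarrow> reduced w \<and> length w = L \<and> set w \<subseteq> letters r"
    and det: "\<And>v w i. v \<in> S \<Longrightarrow> w \<in> S \<Longrightarrow> i < L \<Longrightarrow> i \<notin> U \<Longrightarrow> take i v = take i w \<Longrightarrow> v ! i = w ! i"
    and l: "Suc l \<le> L"
  shows "card (take (Suc l) ` S) \<le> 2 * r * (2 * r - 1) ^ card (U \<inter> {1..l})"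
  using l
proof (induction l)
  case 0
  have "take 1 ` S \<subseteq> (\<lambda>a. [a]) ` letters r"
  proof
    fix x assume "x \<in> take 1 ` S"
    then obtain w where w: "w \<in> S" "x = take 1 w" by blast
    then obtain a v where "w = a # v" using S[of w] 0 by (cases w) auto
    then show "x \<in> (\<lambda>a. [a]) ` letters r" using w S[of w] by auto
  qed
  then have "card (take 1 ` S) \<le> card ((\<lambda>a. [a]) ` letters r)" by (intro card_mono) auto
  also have "\<dots> \<le> 2 * r" using card_image_le[of "letters r"] by simp
  finally show ?case by simp
next
  case (Suc l)
  let ?F = "\<lambda>u. {v ! Suc l | v. v \<in> S \<and> take (Suc l) v = u}"
  have finS: "finite S" using finite_subset[OF _ finite_words[of L r]] S by blast
  have finF: "finite (?F u)" for u using finS by simp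
  have "take (Suc (Suc l)) ` S \<subseteq> (\<lambda>(u, a). u @ [a]) ` Sigma (take (Suc l) ` S) ?F"
  proof
    fix x assume "x \<in> take (Suc (Suc l)) ` S"
    then obtain w where w: "w \<in> S" "x = take (Suc (Suc l)) w" by blast
    then have "x = take (Suc l) w @ [w ! Suc l]"
      using S[of w] Suc.prems by (simp add: take_Suc_conv_app_nth)
    then show "x \<in> (\<lambda>(u, a). u @ [a]) ` Sigma (take (Suc l) ` S) ?F"
      using w by (intro image_eqI[of _ _ "(take (Suc l) w, w ! Suc l)"]) auto
  qed
  then have "card (take (Suc (Suc l)) ` S) \<le> card ((\<lambda>(u, a). u @ [a]) ` Sigma (take (Suc l) ` S) ?F)"
    using finS finF by (intro card_mono finite_imageI finite_SigmaI) auto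
  also have "\<dots> \<le> card (Sigma (take (Suc l) ` S) ?F)"
    using finS finF by (intro card_image_le finite_SigmaI) auto
  also have "\<dots> = (\<Sum>u\<in>take (Suc l) ` S. card (?F u))"
    using finS finF by (intro card_SigmaI) auto
  also have "\<dots> \<le> (\<Sum>u\<in>take (Suc l) ` S. if Suc l \<in> U then 2 * r - 1 else 1)"
    using Suc.prems by (intro sum_mono card_reduced_extend[OF S det]) auto
  also have "\<dots> = card (take (Suc l) ` S) * (if Suc l \<in> U then 2 * r - 1 else 1)" by simp
  also have "\<dots> \<le> (2 * r * (2 * r - 1) ^ card (U \<inter> {1..l})) * (if Suc l \<in> U then 2 * r - 1 else 1)"
    using Suc by (intro mult_right_mono) auto
  also have "\<dots> = 2 * r * (2 * r - 1) ^ card (U \<inter> {1..Suc l})"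
  proof -
    have "U \<inter> {1..Suc l} = (if Suc l \<in> U then insert (Suc l) (U \<inter> {1..l}) else U \<inter> {1..l})"
      by (auto simp: le_Suc_eq)
    then show ?thesis by simp
  qed
  finally show ?case .
qed

text \<open>Revealing the letters of a word from left to right, only those at the positions in \<open>U\<close>
  can be chosen, with \<open>2 r - 1\<close> possibilities each except at the first position.\<close>

lemma card_reduced_determined:
  assumes S: "\<And>w. w \<in> S \<Longrightarrow> reduced w \<and> length w = L \<and> set w \<subseteq> letters r"
    and det: "\<And>v w i. v \<in> S \<Longrightarrow> w \<in> S \<Longrightarrow> i < L \<Longrightarrow> i \<notin> U \<Longrightarrow> take i v = take i w \<Longrightarrow> v ! i = w ! i"
    and "finite U" "0 < r" "0 < L"
  shows "card S \<le> 2 * r * (2 * r - 1) ^ card U"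
proof -
  obtain l where l: "L = Suc l" using \<open>0 < L\<close> by (cases L) auto
  have "take (Suc l) ` S = S"
    using image_cong[OF refl, of S "take (Suc l)" "\<lambda>w. w"] S by (simp add: l)
  moreover have "card (take (Suc l) ` S) \<le> 2 * r * (2 * r - 1) ^ card (U \<inter> {1..l})"
    by (rule card_reduced_determined_prefix[OF S det]) (simp_all add: l)
  ultimately have "card S \<le> 2 * r * (2 * r - 1) ^ card (U \<inter> {1..l})" by simp
  also have "\<dots> \<le> 2 * r * (2 * r - 1) ^ card U"
    using \<open>0 < r\<close> \<open>finite U\<close> by (intro mult_left_mono power_increasing card_mono) auto
  finally show ?thesis .
qed

section \<open>Reduced words with prescribed first and last letter\<close>

definition arcs :: "nat \<Rightarrow> nat \<Rightarrow> letter \<Rightarrow> letter \<Rightarrow> letter list set" where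
  "arcs r l x y =
     {w. w \<noteq> [] \<and> length w = l \<and> reduced w \<and> set w \<subseteq> letters r \<and> hd w = x \<and> last w = y}"

lemma finite_arcs [simp]: "finite (arcs r l x y)"
  by (rule finite_subset[OF _ finite_words[of l r]]) (auto simp: arcs_def)

lemma arcs_1: "arcs r (Suc 0) x y = (if x = y \<and> x \<in> letters r then {[x]} else {})"
  by (auto simp: arcs_def length_Suc_conv reduced_Cons)

lemma arcs_Suc:
  assumes "0 < l" "x \<in> letters r"
  shows "arcs r (Suc l) x y = (#) x ` (\<Union>z\<in>letters r - {inv_letter x}. arcs r l z y)"
proof (intro equalityI subsetI)
  fix w assume "w \<in> arcs r (Suc l) x y"
  then have w: "length w = Suc l" "reduced w" "set w \<subseteq> letters r" "hd w = x" "last w = y"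
    by (auto simp: arcs_def)
  then obtain v where v: "w = x # v" by (cases w) auto
  have ne: "v \<noteq> []" using w v assms by auto
  then have "v \<in> arcs r l (hd v) y" using w v by (auto simp: arcs_def reduced_Cons)
  moreover have "hd v \<in> letters r - {inv_letter x}"
    using w v ne hd_in_set[of v] by (auto simp: reduced_Cons)
  ultimately show "w \<in> (#) x ` (\<Union>z\<in>letters r - {inv_letter x}. arcs r l z y)" using v by blast
qed (use assms in \<open>auto simp: arcs_def reduced_Cons\<close>)

text \<open>Adding the one forbidden continuation, the inverse of \<open>x\<close>, makes the
  right-hand side independent of \<open>x\<close>.\<close>

lemma card_arcs_Suc:
  assumes "0 < l" "x \<in> letters r"
  shows "card (arcs r (Suc l) x y) + card (arcs r l (inv_letter x) y)
    = (\<Sum>z\<in>letters r. card (arcs r l z y))"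
proof -
  have "card (arcs r (Suc l) x y) = card (\<Union>z\<in>letters r - {inv_letter x}. arcs r l z y)"
    unfolding arcs_Suc[OF assms] by (rule card_image) simp
  also have "\<dots> = (\<Sum>z\<in>letters r - {inv_letter x}. card (arcs r l z y))"
    by (rule card_UN_disjoint) (simp, simp, auto simp: arcs_def)
  finally show ?thesis
    using assms by (simp add: sum.remove[of "letters r" "inv_letter x"])
qed

text \<open>Summed over \<open>x\<close>, the recurrence \<open>card_arcs_Suc\<close> says that each
  total is \<open>2 * r\<close> times the previous total minus that total, as inversion permutes the
  letters.\<close>

lemma sum_card_arcs:
  assumes "y \<in> letters r" "0 < r"
  shows "(\<Sum>x\<in>letters r. real (card (arcs r (Suc l) x y))) = (2 * real r - 1) ^ l"
proof (induction l)
  case 0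
  have "(\<Sum>x\<in>letters r. real (card (arcs r (Suc 0) x y))) = (\<Sum>x\<in>letters r. if x = y then 1 else 0)"
    by (intro sum.cong) (auto simp: arcs_1)
  then show ?case using assms by simp
next
  case (Suc l)
  have "(\<Sum>x\<in>letters r. real (card (arcs r (Suc (Suc l)) x y)))
      = (\<Sum>x\<in>letters r. (2 * real r - 1) ^ l - real (card (arcs r (Suc l) (inv_letter x) y)))"
  proof (intro sum.cong refl)
    fix x assume "x \<in> letters r"
    then have "real (card (arcs r (Suc (Suc l)) x y)) + real (card (arcs r (Suc l) (inv_letter x) y))
        = (\<Sum>z\<in>letters r. real (card (arcs r (Suc l) z y)))"
      using card_arcs_Suc[of "Suc l" x r y] by (simp flip: of_nat_sum of_nat_add)
    then show "real (card (arcs r (Suc (Suc l)) x y))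
        = (2 * real r - 1) ^ l - real (card (arcs r (Suc l) (inv_letter x) y))"
      using Suc by simp
  qed
  also have "\<dots> = 2 * real r * (2 * real r - 1) ^ l
      - (\<Sum>x\<in>letters r. real (card (arcs r (Suc l) (inv_letter x) y)))"
    by (simp add: sum_subtractf)
  also have "(\<Sum>x\<in>letters r. real (card (arcs r (Suc l) (inv_letter x) y)))
      = (\<Sum>x\<in>letters r. real (card (arcs r (Suc l) x y)))"
    by (rule sum.reindex_bij_witness[of _ inv_letter inv_letter]) auto
  finally show ?case using Suc by (simp add: algebra_simps)
qed

text \<open>Once the totals are known, the scaled deviation for \<open>x\<close> at one length is
  minus the deviation for the inverse of \<open>x\<close> at the preceding length. It therefore
  never grows, and the bound is the one at length 1.\<close>

lemma card_arcs_approx: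
  assumes "x \<in> letters r" "y \<in> letters r" "0 < r"
  shows "\<bar>2 * real r * real (card (arcs r (Suc l) x y)) - (2 * real r - 1) ^ l\<bar> \<le> 2 * real r - 1"
  using assms(1)
proof (induction l arbitrary: x)
  case 0
  then show ?case using assms by (auto simp: arcs_1)
next
  case (Suc l)
  have "real (card (arcs r (Suc (Suc l)) x y)) + real (card (arcs r (Suc l) (inv_letter x) y))
      = (\<Sum>z\<in>letters r. real (card (arcs r (Suc l) z y)))"
    using card_arcs_Suc[of "Suc l" x r y] Suc.prems by (simp flip: of_nat_sum of_nat_add)
  then have "real (card (arcs r (Suc (Suc l)) x y))
      = (2 * real r - 1) ^ l - real (card (arcs r (Suc l) (inv_letter x) y))"
    using sum_card_arcs[of y r l] assms by simp
  then have "2 * real r * real (card (arcs r (Suc (Suc l)) x y)) - (2 * real r - 1) ^ Suc l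
      = - (2 * real r * real (card (arcs r (Suc l) (inv_letter x) y)) - (2 * real r - 1) ^ l)"
    by (simp only:) (simp add: algebra_simps)
  then show ?case using Suc.IH[of "inv_letter x"] Suc.prems by simp
qed

section \<open>Counting Wicks forms with given arc lengths\<close>

definition wicks_triples ::
    "nat \<Rightarrow> nat \<Rightarrow> nat \<Rightarrow> nat \<Rightarrow> (letter list \<times> letter list \<times> letter list) set" where
  "wicks_triples r a b c = {(A, B, C). length A = a \<and> length B = b \<and> length C = c \<and>
     set A \<subseteq> letters r \<and> set B \<subseteq> letters r \<and> set C \<subseteq> letters r \<and> cyc_reduced (wicks A B C)}"

text \<open>The six junction conditions of \<open>cyc_reduced_wicks\<close> split into two
  independent groups of three: \<open>hd A\<close>, \<open>inv_letter (last B)\<close>,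
  \<open>hd C\<close> are distinct, and so are \<open>last A\<close>,
  \<open>inv_letter (hd B)\<close>, \<open>last C\<close>. These are the letters leaving one triple
  junction and entering the other.\<close>

definition distinct_triples :: "nat \<Rightarrow> (letter \<times> letter \<times> letter) set" where
  "distinct_triples r = {(x, y, z). x \<in> letters r \<and> y \<in> letters r \<and> z \<in> letters r \<and>
     x \<noteq> y \<and> x \<noteq> z \<and> y \<noteq> z}"

lemma distinct_triples_Sigma:
  "distinct_triples r = Sigma (letters r) (\<lambda>x. Sigma (letters r - {x}) (\<lambda>y. letters r - {x, y}))"
  by (auto simp: distinct_triples_def)

lemma finite_distinct_triples [simp]: "finite (distinct_triples r)"
  by (simp add: distinct_triples_Sigma)

lemma card_distinct_triples:
  assumes "0 < r"
  shows "real (card (distinct_triples r)) = 2 * real r * (2 * real r - 1) * (2 * real r - 2)"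
proof -
  have "card (distinct_triples r)
      = (\<Sum>x\<in>letters r. \<Sum>y\<in>letters r - {x}. card (letters r - {x, y}))"
    by (simp add: distinct_triples_Sigma card_SigmaI)
  also have "\<dots> = (\<Sum>x\<in>letters r. \<Sum>y\<in>letters r - {x}. 2 * r - 2)"
  proof (intro sum.cong refl)
    fix x y assume "x \<in> letters r" "y \<in> letters r - {x}"
    then show "card (letters r - {x, y}) = 2 * r - 2" by (auto simp: card_Diff_subset card_insert_if)
  qed
  also have "\<dots> = 2 * r * ((2 * r - 1) * (2 * r - 2))" by (simp add: card_Diff_subset)
  finally have "card (distinct_triples r) = 2 * r * ((2 * r - 1) * (2 * r - 2))" .
  moreover have "real (2 * r - 1) = 2 * real r - 1" "real (2 * r - 2) = 2 * real r - 2"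
    using assms by linarith+
  ultimately show ?thesis by (simp only: of_nat_mult of_nat_numeral mult.assoc)
qed

text \<open>\<open>B\<close> runs between the two triple junctions in the direction opposite to
  \<open>A\<close> and \<open>C\<close>, hence its inverted and exchanged end letters.\<close>

definition triples_at ::
    "nat \<Rightarrow> nat \<Rightarrow> nat \<Rightarrow> nat \<Rightarrow> (letter \<times> letter \<times> letter) \<times> (letter \<times> letter \<times> letter)
      \<Rightarrow> (letter list \<times> letter list \<times> letter list) set" where
  "triples_at r a b c = (\<lambda>((x, y, z), (x', y', z')).
     arcs r a x x' \<times> arcs r b (inv_letter y') (inv_letter y) \<times> arcs r c z z')"

lemma finite_triples_at [simp]: "finite (triples_at r a b c d)"
  by (simp add: triples_at_def split: prod.split)

lemma wicks_triples_eq: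
  assumes "0 < a" "0 < b" "0 < c"
  shows "wicks_triples r a b c
    = (\<Union>d \<in> distinct_triples r \<times> distinct_triples r. triples_at r a b c d)"
proof (intro equalityI subsetI)
  fix t assume t: "t \<in> wicks_triples r a b c"
  obtain A B C where tt: "t = (A, B, C)" by (cases t)
  have ABC: "length A = a" "length B = b" "length C = c"
    "set A \<subseteq> letters r" "set B \<subseteq> letters r" "set C \<subseteq> letters r" "cyc_reduced (wicks A B C)"
    using t by (auto simp: tt wicks_triples_def)
  have ne: "A \<noteq> []" "B \<noteq> []" "C \<noteq> []" using ABC assms by auto
  have mem: "hd A \<in> letters r" "hd B \<in> letters r" "hd C \<in> letters r"
    "last A \<in> letters r" "last B \<in> letters r" "last C \<in> letters r"
    using ABC ne by (meson hd_in_set last_in_set subsetD)+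
  note cr = ABC(7)[unfolded cyc_reduced_wicks[OF ne]]
  let ?d = "((hd A, inv_letter (last B), hd C), (last A, inv_letter (hd B), last C))"
  have "?d \<in> distinct_triples r \<times> distinct_triples r"
    using mem cr by (simp add: distinct_triples_def inv_letter_eq_iff) (metis inv_letter_invol)
  moreover have "t \<in> triples_at r a b c ?d"
    using ABC ne cr by (simp add: tt triples_at_def arcs_def)
  ultimately show "t \<in> (\<Union>d \<in> distinct_triples r \<times> distinct_triples r. triples_at r a b c d)"
    by blast
next
  fix t assume "t \<in> (\<Union>d \<in> distinct_triples r \<times> distinct_triples r. triples_at r a b c d)"
  then obtain x y z x' y' z' where d: "(x, y, z) \<in> distinct_triples r"
    "(x', y', z') \<in> distinct_triples r" "t \<in> triples_at r a b c ((x, y, z), (x', y', z'))"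
    by auto
  obtain A B C where tt: "t = (A, B, C)" by (cases t)
  have arc: "A \<in> arcs r a x x'" "B \<in> arcs r b (inv_letter y') (inv_letter y)" "C \<in> arcs r c z z'"
    using d(3) by (auto simp: tt triples_at_def)
  have ne: "A \<noteq> []" "B \<noteq> []" "C \<noteq> []" using arc by (auto simp: arcs_def)
  have "cyc_reduced (wicks A B C)"
    unfolding cyc_reduced_wicks[OF ne] using arc d(1,2) by (auto simp: arcs_def distinct_triples_def)
  then show "t \<in> wicks_triples r a b c"
    using arc by (auto simp: tt wicks_triples_def arcs_def)
qed

lemma card_wicks_triples:
  assumes "0 < a" "0 < b" "0 < c"
  shows "card (wicks_triples r a b c)
    = (\<Sum>((x, y, z), (x', y', z'))\<in>distinct_triples r \<times> distinct_triples r.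
        card (arcs r a x x') * (card (arcs r b (inv_letter y') (inv_letter y)) * card (arcs r c z z')))"
proof -
  have "card (wicks_triples r a b c)
      = (\<Sum>d\<in>distinct_triples r \<times> distinct_triples r. card (triples_at r a b c d))"
    unfolding wicks_triples_eq[OF assms]
    by (rule card_UN_disjoint) (simp, simp, auto simp: triples_at_def arcs_def)
  also have "\<dots> = (\<Sum>((x, y, z), (x', y', z'))\<in>distinct_triples r \<times> distinct_triples r.
        card (arcs r a x x') * (card (arcs r b (inv_letter y') (inv_letter y)) * card (arcs r c z z')))"
    by (intro sum.cong refl) (auto simp: triples_at_def card_cartesian_product)
  finally show ?thesis .
qed

text \<open>With relative errors \<open>e\<close>, \<open>f\<close>, \<open>g\<close> the product is
  off by the factor \<open>(1 + e) (1 + f) (1 + g)\<close>. Since the main terms are at least 1,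
  \<open>f\<close> and \<open>g\<close> are at most \<open>q\<close> in absolute value, while one
  factor \<open>1 / \<alpha>\<close>, \<open>1 / \<beta>\<close> or \<open>1 / \<gamma>\<close>
  survives in each summand.\<close>

lemma product_approx:
  fixes \<alpha> \<beta> \<gamma> q u v w :: real
  assumes "1 \<le> \<alpha>" "1 \<le> \<beta>" "1 \<le> \<gamma>" "\<bar>u - \<alpha>\<bar> \<le> q" "\<bar>v - \<beta>\<bar> \<le> q" "\<bar>w - \<gamma>\<bar> \<le> q"
  shows "\<bar>u * (v * w) - \<alpha> * \<beta> * \<gamma>\<bar> \<le> \<alpha> * \<beta> * \<gamma> * (1 + q)\<^sup>2 * q * (1 / \<alpha> + 1 / \<beta> + 1 / \<gamma>)"
proof -
  define e f g where "e = (u - \<alpha>) / \<alpha>" and "f = (v - \<beta>) / \<beta>" and "g = (w - \<gamma>) / \<gamma>"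
  have uvw: "u = \<alpha> * (1 + e)" "v = \<beta> * (1 + f)" "w = \<gamma> * (1 + g)"
    using assms(1-3) by (simp_all add: e_def f_def g_def field_simps)
  have q: "0 \<le> q" using assms(4) by linarith
  have b: "\<bar>e\<bar> \<le> q / \<alpha>" "\<bar>f\<bar> \<le> q / \<beta>" "\<bar>g\<bar> \<le> q / \<gamma>"
    using assms by (simp_all add: e_def f_def g_def divide_right_mono)
  have "q / \<beta> \<le> q" "q / \<gamma> \<le> q" using assms q by (simp_all add: divide_le_eq mult_le_cancel_left1)
  then have fg: "\<bar>1 + f\<bar> \<le> 1 + q" "\<bar>1 + g\<bar> \<le> 1 + q" using b by linarith+
  have "\<bar>e * ((1 + f) * (1 + g)) + f * (1 + g) + g\<bar>
      \<le> \<bar>e\<bar> * (\<bar>1 + f\<bar> * \<bar>1 + g\<bar>) + \<bar>f\<bar> * \<bar>1 + g\<bar> + \<bar>g\<bar>"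
    using abs_triangle_ineq[of "e * ((1 + f) * (1 + g)) + f * (1 + g)" g]
      abs_triangle_ineq[of "e * ((1 + f) * (1 + g))" "f * (1 + g)"] by (simp add: abs_mult)
  also have "\<dots> \<le> \<bar>e\<bar> * ((1 + q) * (1 + q)) + \<bar>f\<bar> * ((1 + q) * (1 + q)) + \<bar>g\<bar> * ((1 + q) * (1 + q))"
  proof (intro add_mono mult_left_mono mult_mono)
    have "1 * 1 \<le> (1 + q) * (1 + q)" using q by (intro mult_mono) auto
    then show "\<bar>g\<bar> \<le> \<bar>g\<bar> * ((1 + q) * (1 + q))" by (simp add: mult_le_cancel_left1)
    have "\<bar>1 + g\<bar> * 1 \<le> (1 + q) * (1 + q)" using q fg by (intro mult_mono) auto
    then show "\<bar>1 + g\<bar> \<le> (1 + q) * (1 + q)" by simp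
  qed (use fg q in auto)
  also have "\<dots> = (1 + q)\<^sup>2 * (\<bar>e\<bar> + \<bar>f\<bar> + \<bar>g\<bar>)" by (simp add: power2_eq_square algebra_simps)
  also have "\<dots> \<le> (1 + q)\<^sup>2 * (q / \<alpha> + q / \<beta> + q / \<gamma>)" using b by (intro mult_left_mono) auto
  finally have *: "\<bar>e * ((1 + f) * (1 + g)) + f * (1 + g) + g\<bar> \<le> (1 + q)\<^sup>2 * (q / \<alpha> + q / \<beta> + q / \<gamma>)" .
  have "u * (v * w) - \<alpha> * \<beta> * \<gamma> = \<alpha> * \<beta> * \<gamma> * (e * ((1 + f) * (1 + g)) + f * (1 + g) + g)"
    by (simp add: uvw algebra_simps)
  then have "\<bar>u * (v * w) - \<alpha> * \<beta> * \<gamma>\<bar> = \<alpha> * \<beta> * \<gamma> * \<bar>e * ((1 + f) * (1 + g)) + f * (1 + g) + g\<bar>"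
    using assms(1-3) by (simp add: abs_mult)
  also have "\<dots> \<le> \<alpha> * \<beta> * \<gamma> * ((1 + q)\<^sup>2 * (q / \<alpha> + q / \<beta> + q / \<gamma>))"
    using * assms(1-3) by (intro mult_left_mono) auto
  also have "\<dots> = \<alpha> * \<beta> * \<gamma> * (1 + q)\<^sup>2 * q * (1 / \<alpha> + 1 / \<beta> + 1 / \<gamma>)"
    by (simp add: algebra_simps)
  finally show ?thesis .
qed

text \<open>This is the squared number of distinct triples, one for each triple junction, divided by
  \<open>(2 r)^3\<close>, one factor per arc, after removal of \<open>(2 r - 1)^2\<close>.\<close>

definition wicks_density :: "nat \<Rightarrow> real" where
  "wicks_density r = (2 * real r - 2)\<^sup>2 / (2 * real r)"

text \<open>An arc of length \<open>l\<close> with given end letters has about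
  \<open>q ^ (l - 1) / (2 * r)\<close> words, with a relative error that is a constant multiple of
  \<open>(1 / q) ^ l\<close>.\<close>

lemma card_wicks_triples_approx:
  assumes "0 < a" "0 < b" "0 < c" "0 < r"
  defines "q \<equiv> 2 * real r - 1"
  shows "\<bar>real (card (wicks_triples r a b c)) - wicks_density r * q ^ (a + b + c - 1)\<bar>
    \<le> wicks_density r * q ^ (a + b + c - 1) * ((2 * real r)\<^sup>2 * q\<^sup>2) * ((1 / q) ^ a + (1 / q) ^ b + (1 / q) ^ c)"
proof -
  obtain a' b' c' where abc: "a = Suc a'" "b = Suc b'" "c = Suc c'"
    using assms(1-3) by (metis gr0_implies_Suc)
  have q1: "1 \<le> q" using assms(4) by (simp add: q_def)
  let ?R = "2 * real r"
  have R: "?R = 1 + q" "0 < ?R" using assms(4) by (simp_all add: q_def)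
  let ?D = "distinct_triples r \<times> distinct_triples r"
  let ?M = "q ^ a' * q ^ b' * q ^ c'"
  let ?E = "?M * (1 + q)\<^sup>2 * q * (1 / q ^ a' + 1 / q ^ b' + 1 / q ^ c')"
  define f where "f = (\<lambda>((x, y, z), (x', y', z')).
      (?R * real (card (arcs r a x x')))
      * ((?R * real (card (arcs r b (inv_letter y') (inv_letter y)))) * (?R * real (card (arcs r c z z')))))"
  have f: "\<bar>f d - ?M\<bar> \<le> ?E" if "d \<in> ?D" for d
  proof -
    obtain x y z x' y' z' where d: "d = ((x, y, z), (x', y', z'))" by (metis prod.exhaust)
    show ?thesis unfolding d f_def prod.case
      using that q1 card_arcs_approx[of _ r _ a'] card_arcs_approx[of _ r _ b'] card_arcs_approx[of _ r _ c']
      by (intro product_approx) (auto simp: d distinct_triples_def abc q_def assms(4) one_le_power)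
  qed
  have card_D: "real (card ?D) = (?R * q * (2 * real r - 2))\<^sup>2"
    using card_distinct_triples[OF assms(4)]
    by (simp add: card_cartesian_product power2_eq_square q_def)
  have "?R ^ 3 * real (card (wicks_triples r a b c)) = (\<Sum>d\<in>?D. f d)"
    unfolding card_wicks_triples[OF assms(1-3)] f_def of_nat_sum sum_distrib_left
    by (intro sum.cong refl) (auto simp: power3_eq_cube)
  then have "?R ^ 3 * real (card (wicks_triples r a b c)) - real (card ?D) * ?M = (\<Sum>d\<in>?D. f d - ?M)"
    by (simp add: sum_subtractf)
  then have "\<bar>?R ^ 3 * real (card (wicks_triples r a b c)) - real (card ?D) * ?M\<bar> \<le> (\<Sum>d\<in>?D. \<bar>f d - ?M\<bar>)"
    by (simp add: sum_abs)
  also have "\<dots> \<le> real (card ?D) * ?E" using sum_mono[OF f, of ?D "\<lambda>d. d"] by simp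
  finally have main: "\<bar>?R ^ 3 * real (card (wicks_triples r a b c)) - real (card ?D) * ?M\<bar>
      \<le> real (card ?D) * ?E" .
  \<comment> \<open>The \<open>q\<^sup>2\<close> comes from the two triple junctions; together with
    the three exponents \<open>l - 1\<close> it makes \<open>a + b + c - 1\<close>.\<close>
  have qq: "q ^ (a + b + c - 1) = q\<^sup>2 * ?M"
    by (simp add: abc power_add power2_eq_square)
  have DM: "real (card ?D) * ?M = ?R ^ 3 * (wicks_density r * q ^ (a + b + c - 1))"
    unfolding card_D qq wicks_density_def using R(2)
    by (simp add: field_simps power2_eq_square power3_eq_cube)
  have inv: "1 / q ^ a' = q * (1 / q) ^ a" "1 / q ^ b' = q * (1 / q) ^ b" "1 / q ^ c' = q * (1 / q) ^ c"
    using q1 by (simp_all add: abc field_simps)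
  have "real (card ?D) * ?E = (real (card ?D) * ?M) * ((1 + q)\<^sup>2 * q * (1 / q ^ a' + 1 / q ^ b' + 1 / q ^ c'))"
    by (simp add: mult_ac)
  also have "\<dots> = ?R ^ 3 * (wicks_density r * q ^ (a + b + c - 1) * (?R\<^sup>2 * q\<^sup>2)
      * ((1 / q) ^ a + (1 / q) ^ b + (1 / q) ^ c))"
    unfolding DM inv R(1) by (simp add: algebra_simps power2_eq_square)
  finally have DE: "real (card ?D) * ?E = ?R ^ 3 * (wicks_density r * q ^ (a + b + c - 1) * (?R\<^sup>2 * q\<^sup>2)
      * ((1 / q) ^ a + (1 / q) ^ b + (1 / q) ^ c))" .
  have "?R ^ 3 * \<bar>real (card (wicks_triples r a b c)) - wicks_density r * q ^ (a + b + c - 1)\<bar>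
      = \<bar>?R ^ 3 * real (card (wicks_triples r a b c)) - real (card ?D) * ?M\<bar>"
    unfolding DM using R(2) by (simp add: abs_mult flip: right_diff_distrib)
  also have "\<dots> \<le> ?R ^ 3 * (wicks_density r * q ^ (a + b + c - 1) * (?R\<^sup>2 * q\<^sup>2)
      * ((1 / q) ^ a + (1 / q) ^ b + (1 / q) ^ c))" using main DE by simp
  finally show ?thesis using R(2) by (simp only: mult_le_cancel_left_pos zero_less_power)
qed

section \<open>Positions of a Wicks form in a cyclic word\<close>

text \<open>A Wicks form inside a cyclic word of length \<open>2 n\<close> has six cut points, which come in antipodal
  pairs; hence it is given by three cut points modulo \<open>n\<close>.\<close>

definition cuts :: "nat \<Rightarrow> (nat \<times> nat \<times> nat) set" where
  "cuts n = {(p, q, s). p < q \<and> q < s \<and> s < n}"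

text \<open>The third arc is \<open>{s..<n + p}\<close>; it wraps around, so modulo \<open>n\<close>
  the positions below \<open>p\<close> belong to it as well.\<close>

definition arc_len :: "nat \<Rightarrow> nat \<times> nat \<times> nat \<Rightarrow> nat \<Rightarrow> nat" where
  "arc_len n = (\<lambda>(p, q, s) k. if k = 0 then q - p else if k = 1 then s - q else n - s + p)"

text \<open>Twice the centre of an arc, modulo \<open>2 n\<close>.\<close>

definition arc_sum :: "nat \<Rightarrow> nat \<times> nat \<times> nat \<Rightarrow> nat \<Rightarrow> nat" where
  "arc_sum n = (\<lambda>(p, q, s) k. if k = 0 then p + q else if k = 1 then q + s else (p + s + n) mod (2 * n))"

definition arc_index :: "nat \<times> nat \<times> nat \<Rightarrow> nat \<Rightarrow> nat" where
  "arc_index = (\<lambda>(p, q, s) i. if p \<le> i \<and> i < q then 0 else if q \<le> i \<and> i < s then 1 else 2)"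

definition sum_at :: "nat \<Rightarrow> nat \<times> nat \<times> nat \<Rightarrow> nat \<Rightarrow> nat" where
  "sum_at n P i = arc_sum n P (arc_index P i)"

text \<open>An arc \<open>{a..<b}\<close> is matched in reverse order with \<open>{a + n..<b + n}\<close>, so two matched positions
  add up to \<open>a + b + n - 1\<close>; the summand \<open>3 * n\<close> avoids truncated subtraction.\<close>

definition partner :: "nat \<Rightarrow> nat \<times> nat \<times> nat \<Rightarrow> nat \<Rightarrow> nat" where
  "partner n P i = (sum_at n P (i mod n) + 3 * n - 1 - i) mod (2 * n)"

definition wicks_at :: "nat \<Rightarrow> nat \<Rightarrow> nat \<times> nat \<times> nat \<Rightarrow> letter list set" where
  "wicks_at r n P = {w. \<exists>A B C. (A, B, C) \<in> wicks_triples r (arc_len n P 0) (arc_len n P 1) (arc_len n P 2)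
     \<and> rotate (fst P) w = wicks A B C}"

text \<open>The two partner maps differ at \<open>i\<close> iff these sums differ at
  \<open>i mod n\<close>, so half of the cyclic word is enough.\<close>

definition disagree :: "nat \<Rightarrow> nat \<times> nat \<times> nat \<Rightarrow> nat \<times> nat \<times> nat \<Rightarrow> nat" where
  "disagree n P P' = card {i. i < n \<and> sum_at n P i \<noteq> sum_at n P' i}"

section \<open>Arithmetic of cut points and the partner involution\<close>

lemma finite_cuts [simp]: "finite (cuts n)"
  by (rule finite_subset[of _ "{..<n} \<times> {..<n} \<times> {..<n}"]) (auto simp: cuts_def)

lemma arc_len_pos: "P \<in> cuts n \<Longrightarrow> 0 < arc_len n P k"
  by (auto simp: cuts_def arc_len_def)

lemma arc_len_sum: "P \<in> cuts n \<Longrightarrow> arc_len n P 0 + arc_len n P 1 + arc_len n P 2 = n"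
  by (auto simp: cuts_def arc_len_def)

lemma mod_doubleI:
  fixes x v n :: nat
  assumes "v < 2 * n" "x = v \<or> x = v + 2 * n \<or> x = v + 2 * (2 * n)"
  shows "x mod (2 * n) = v"
  using assms(2)
proof (elim disjE)
  assume "x = v + 2 * (2 * n)"
  then show ?thesis using assms(1) mod_mult_self1[of v 2 "2 * n"] by simp
qed (use assms(1) in auto)

lemma arc_sum_2:
  assumes "(p, q, s) \<in> cuts n"
  shows "arc_sum n (p, q, s) 2 = (if p + s < n then p + s + n else p + s - n)"
  using assms by (auto simp: arc_sum_def cuts_def intro!: mod_doubleI)

text \<open>The same map without \<open>mod\<close>. The third arc and its antipode take four of the
  eight cases: the antipode crosses \<open>2 * n\<close>, and the arc is split at
  \<open>p + s\<close>, where its reflected image crosses it.\<close>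

lemma partner_eq:
  assumes P: "(p, q, s) \<in> cuts n" and "i < 2 * n"
  shows "partner n (p, q, s) i =
    (if i < p then p + s - 1 - i
     else if i < q then n + p + q - 1 - i
     else if i < s then n + q + s - 1 - i
     else if i < p + s \<and> i < n + p then p + s - 1 - i
     else if i < n + p then 2 * n + p + s - 1 - i
     else if i < n + q then n + p + q - 1 - i
     else if i < n + s then n + q + s - 1 - i
     else 2 * n + p + s - 1 - i)"
proof -
  note pqs = P[unfolded cuts_def, simplified]
  have index: "arc_index (p, q, s) (i mod n) = (if i < p then 2 else if i < q then 0 else if i < s then 1
     else if i < n + p then 2 else if i < n + q then 0 else if i < n + s then 1 else 2)"
  proof (cases "i < n")
    case True
    then show ?thesis using pqs by (simp add: arc_index_def)
  next
    case False
    then have "i mod n = i - n" using assms(2) by (simp add: le_mod_geq)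
    then show ?thesis using pqs False by (auto simp: arc_index_def)
  qed
  have sums: "arc_sum n (p, q, s) 0 = p + q" "arc_sum n (p, q, s) 1 = q + s"
    by (simp_all add: arc_sum_def)
  have sum: "sum_at n (p, q, s) (i mod n) = (if i < p \<or> s \<le> i \<and> i < n + p \<or> n + s \<le> i
      then (if p + s < n then p + s + n else p + s - n)
      else if i < q \<or> n + p \<le> i \<and> i < n + q then p + q else q + s)"
    unfolding sum_at_def index using pqs by (simp add: sums[unfolded One_nat_def] arc_sum_2[OF P])
  consider "i < p" | "p \<le> i" "i < q" | "q \<le> i" "i < s" | "s \<le> i" "i < p + s" "i < n + p"
    | "p + s \<le> i" "s \<le> i" "i < n + p" | "n + p \<le> i" "i < n + q" | "n + q \<le> i" "i < n + s" | "n + s \<le> i"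
    by linarith
  then show ?thesis
  proof cases
    case 1
    have t: "sum_at n (p, q, s) (i mod n) = (if p + s < n then p + s + n else p + s - n)"
      using 1 pqs unfolding sum by simp
    have "p + s < n \<Longrightarrow> p + s + n + 3 * n - 1 - i = p + s - 1 - i + 2 * (2 * n)"
      "\<not> p + s < n \<Longrightarrow> p + s - n + 3 * n - 1 - i = p + s - 1 - i + 2 * n" "p + s - 1 - i < 2 * n"
      using 1 pqs assms(2) by linarith+
    then have "partner n (p, q, s) i = p + s - 1 - i"
      unfolding partner_def t by (intro mod_doubleI) auto
    then show ?thesis using 1 pqs by simp
  next
    case 2
    have t: "sum_at n (p, q, s) (i mod n) = p + q"
      using 2 pqs unfolding sum by simp
    have "p + q + 3 * n - 1 - i = n + p + q - 1 - i + 2 * n" "n + p + q - 1 - i < 2 * n"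
      using 2 pqs assms(2) by linarith+
    then have "partner n (p, q, s) i = n + p + q - 1 - i"
      unfolding partner_def t by (intro mod_doubleI) auto
    then show ?thesis using 2 pqs by simp
  next
    case 3
    have t: "sum_at n (p, q, s) (i mod n) = q + s"
      using 3 pqs unfolding sum by simp
    have "q + s + 3 * n - 1 - i = n + q + s - 1 - i + 2 * n" "n + q + s - 1 - i < 2 * n"
      using 3 pqs assms(2) by linarith+
    then have "partner n (p, q, s) i = n + q + s - 1 - i"
      unfolding partner_def t by (intro mod_doubleI) auto
    then show ?thesis using 3 pqs by simp
  next
    case 4
    have t: "sum_at n (p, q, s) (i mod n) = (if p + s < n then p + s + n else p + s - n)"
      using 4 pqs unfolding sum by simp
    have "p + s < n \<Longrightarrow> p + s + n + 3 * n - 1 - i = p + s - 1 - i + 2 * (2 * n)"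
      "\<not> p + s < n \<Longrightarrow> p + s - n + 3 * n - 1 - i = p + s - 1 - i + 2 * n" "p + s - 1 - i < 2 * n"
      using 4 pqs assms(2) by linarith+
    then have "partner n (p, q, s) i = p + s - 1 - i"
      unfolding partner_def t by (intro mod_doubleI) auto
    then show ?thesis using 4 pqs by simp
  next
    case 5
    have t: "sum_at n (p, q, s) (i mod n) = (if p + s < n then p + s + n else p + s - n)"
      using 5 pqs unfolding sum by simp
    have "p + s < n \<Longrightarrow> p + s + n + 3 * n - 1 - i = 2 * n + p + s - 1 - i + 2 * n"
      "\<not> p + s < n \<Longrightarrow> p + s - n + 3 * n - 1 - i = 2 * n + p + s - 1 - i" "2 * n + p + s - 1 - i < 2 * n"
      using 5 pqs assms(2) by linarith+
    then have "partner n (p, q, s) i = 2 * n + p + s - 1 - i"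
      unfolding partner_def t by (intro mod_doubleI) auto
    then show ?thesis using 5 pqs by simp
  next
    case 6
    have t: "sum_at n (p, q, s) (i mod n) = p + q"
      using 6 pqs unfolding sum by simp
    have "p + q + 3 * n - 1 - i = n + p + q - 1 - i + 2 * n" "n + p + q - 1 - i < 2 * n"
      using 6 pqs assms(2) by linarith+
    then have "partner n (p, q, s) i = n + p + q - 1 - i"
      unfolding partner_def t by (intro mod_doubleI) auto
    then show ?thesis using 6 pqs by simp
  next
    case 7
    have t: "sum_at n (p, q, s) (i mod n) = q + s"
      using 7 pqs unfolding sum by simp
    have "q + s + 3 * n - 1 - i = n + q + s - 1 - i + 2 * n" "n + q + s - 1 - i < 2 * n"
      using 7 pqs assms(2) by linarith+
    then have "partner n (p, q, s) i = n + q + s - 1 - i"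
      unfolding partner_def t by (intro mod_doubleI) auto
    then show ?thesis using 7 pqs by simp
  next
    case 8
    have t: "sum_at n (p, q, s) (i mod n) = (if p + s < n then p + s + n else p + s - n)"
      using 8 pqs unfolding sum by simp
    have "p + s < n \<Longrightarrow> p + s + n + 3 * n - 1 - i = 2 * n + p + s - 1 - i + 2 * n"
      "\<not> p + s < n \<Longrightarrow> p + s - n + 3 * n - 1 - i = 2 * n + p + s - 1 - i" "2 * n + p + s - 1 - i < 2 * n"
      using 8 pqs assms(2) by linarith+
    then have "partner n (p, q, s) i = 2 * n + p + s - 1 - i"
      unfolding partner_def t by (intro mod_doubleI) auto
    then show ?thesis using 8 pqs by simp
  qed
qed

lemma partner_less: "P \<in> cuts n \<Longrightarrow> partner n P i < 2 * n"
  by (auto simp: partner_def cuts_def)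

lemma partner_partner:
  assumes "P \<in> cuts n" "i < 2 * n"
  shows "partner n P (partner n P i) = i"
proof -
  obtain p q s where P: "P = (p, q, s)" by (cases P)
  show ?thesis
  proof -
    note pqs = assms(1)[unfolded P cuts_def, simplified]
    note eq = partner_eq[OF assms(1)[unfolded P]]
    have i: "i < 2 * n" by fact
    consider "i < p" | "p \<le> i" "i < q" | "q \<le> i" "i < s" | "s \<le> i" "i < p + s" "i < n + p"
      | "p + s \<le> i" "s \<le> i" "i < n + p" | "n + p \<le> i" "i < n + q" | "n + q \<le> i" "i < n + s" | "n + s \<le> i"
      by linarith
    then show ?thesis
    proof cases
      case 1
      then have j: "partner n (p, q, s) i = p + s - 1 - i" using pqs i by (simp add: eq)
      have "p + s - 1 - i < 2 * n" "s \<le> p + s - 1 - i" "p + s - 1 - i < p + s" "p + s - 1 - i < n + p" using 1 pqs i by linarith+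
      then show ?thesis unfolding P j using pqs i 1 by (simp add: eq)
    next
      case 2
      then have j: "partner n (p, q, s) i = n + p + q - 1 - i" using pqs i by (simp add: eq)
      have "n + p + q - 1 - i < 2 * n" "n + p \<le> n + p + q - 1 - i" "n + p + q - 1 - i < n + q" using 2 pqs i by linarith+
      then show ?thesis unfolding P j using pqs i 2 by (simp add: eq)
    next
      case 3
      then have j: "partner n (p, q, s) i = n + q + s - 1 - i" using pqs i by (simp add: eq)
      have "n + q + s - 1 - i < 2 * n" "n + q \<le> n + q + s - 1 - i" "n + q + s - 1 - i < n + s" using 3 pqs i by linarith+
      then show ?thesis unfolding P j using pqs i 3 by (simp add: eq)
    next
      case 4
      then have j: "partner n (p, q, s) i = p + s - 1 - i" using pqs i by (simp add: eq)
      have "p + s - 1 - i < 2 * n" "p + s - 1 - i < p" using 4 pqs i by linarith+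
      then show ?thesis unfolding P j using pqs i 4 by (simp add: eq)
    next
      case 5
      then have j: "partner n (p, q, s) i = 2 * n + p + s - 1 - i" using pqs i by (simp add: eq)
      have "2 * n + p + s - 1 - i < 2 * n" "n + s \<le> 2 * n + p + s - 1 - i" using 5 pqs i by linarith+
      then show ?thesis unfolding P j using pqs i 5 by (simp add: eq)
    next
      case 6
      then have j: "partner n (p, q, s) i = n + p + q - 1 - i" using pqs i by (simp add: eq)
      have "n + p + q - 1 - i < 2 * n" "p \<le> n + p + q - 1 - i" "n + p + q - 1 - i < q" using 6 pqs i by linarith+
      then show ?thesis unfolding P j using pqs i 6 by (simp add: eq)
    next
      case 7
      then have j: "partner n (p, q, s) i = n + q + s - 1 - i" using pqs i by (simp add: eq)
      have "n + q + s - 1 - i < 2 * n" "q \<le> n + q + s - 1 - i" "n + q + s - 1 - i < s" using 7 pqs i by linarith+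
      then show ?thesis unfolding P j using pqs i 7 by (simp add: eq)
    next
      case 8
      then have j: "partner n (p, q, s) i = 2 * n + p + s - 1 - i" using pqs i by (simp add: eq)
      have "2 * n + p + s - 1 - i < 2 * n" "p + s \<le> 2 * n + p + s - 1 - i" "s \<le> 2 * n + p + s - 1 - i" "2 * n + p + s - 1 - i < n + p" using 8 pqs i by linarith+
      then show ?thesis unfolding P j using pqs i 8 by (simp add: eq)
    qed
  qed
qed

section \<open>Matched letters of a Wicks form\<close>

lemma nth_winv: "k < length w \<Longrightarrow> winv w ! k = inv_letter (w ! (length w - 1 - k))"
  by (simp add: winv_def rev_nth)

text \<open>Each index is the start of the inverse block, which is \<open>n\<close>,
  \<open>n + a\<close> or \<open>n + a + b\<close>, plus the reversed offset of \<open>j\<close> in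
  its arc.\<close>

lemma wicks_partner:
  assumes "length A = a" "length B = b" "length C = c" "j < a + b + c"
  defines "n \<equiv> a + b + c"
  shows "wicks A B C ! (if j < a then n + a - 1 - j else if j < a + b then n + 2 * a + b - 1 - j
      else 2 * n + a + b - 1 - j) = inv_letter (wicks A B C ! j)"
proof -
  consider "j < a" | "a \<le> j" "j < a + b" | "a + b \<le> j" by linarith
  then show ?thesis
  proof cases
    case 1
    have "wicks A B C ! (length (A @ B @ C) + (a - 1 - j)) = (winv A @ winv B @ winv C) ! (a - 1 - j)"
      unfolding wicks_def using nth_append_length_plus[of "A @ B @ C"] by simp
    also have "\<dots> = inv_letter (A ! j)" using 1 assms(1) by (simp add: nth_append nth_winv)
    also have "A ! j = wicks A B C ! j" using 1 assms(1) by (simp add: wicks_def nth_append)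
    finally show ?thesis using 1 assms(1-3) by (simp add: n_def add_ac)
  next
    case 2
    have "wicks A B C ! (length (A @ B @ C @ winv A) + (a + b - 1 - j)) = (winv B @ winv C) ! (a + b - 1 - j)"
      unfolding wicks_def using nth_append_length_plus[of "A @ B @ C @ winv A"] by simp
    also have "\<dots> = inv_letter (B ! (j - a))"
    proof -
      have "a + b - 1 - j < length (winv B)" using 2 assms(2) by simp
      then show ?thesis using 2 assms(2) by (simp only: nth_append nth_winv if_True) (simp add: nth_winv)
    qed
    also have "B ! (j - a) = wicks A B C ! j"
    proof -
      have "j - a < b" using 2 by linarith
      then show ?thesis using 2 assms(1,2) by (simp add: wicks_def nth_append)
    qed
    finally have "wicks A B C ! (length (A @ B @ C @ winv A) + (a + b - 1 - j)) = inv_letter (wicks A B C ! j)" .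
    moreover have "n + 2 * a + b - 1 - j = length (A @ B @ C @ winv A) + (a + b - 1 - j)"
      using 2 assms(1-3) unfolding n_def by simp
    ultimately show ?thesis using 2 by simp
  next
    case 3
    have "wicks A B C ! (length (A @ B @ C @ winv A @ winv B) + (n - 1 - j)) = winv C ! (n - 1 - j)"
      unfolding wicks_def using nth_append_length_plus[of "A @ B @ C @ winv A @ winv B"] by simp
    also have "\<dots> = inv_letter (C ! (j - a - b))" using 3 assms(3,4) by (simp add: nth_winv n_def)
    also have "C ! (j - a - b) = wicks A B C ! (length (A @ B) + (j - a - b))"
    proof -
      have "j - a - b < length C" using 3 assms(3,4) by linarith
      then show ?thesis
        unfolding wicks_def using nth_append_length_plus[of "A @ B"] by (simp add: nth_append_left)
    qed
    finally have "wicks A B C ! (length (A @ B @ C @ winv A @ winv B) + (n - 1 - j))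
      = inv_letter (wicks A B C ! (length (A @ B) + (j - a - b)))" .
    moreover have "2 * n + a + b - 1 - j = length (A @ B @ C @ winv A @ winv B) + (n - 1 - j)"
      "length (A @ B) + (j - a - b) = j"
      using 3 assms(1-4) unfolding n_def by simp_all
    ultimately show ?thesis using 3 by simp
  qed
qed

lemma length_wicks_at:
  assumes "P \<in> cuts n" "w \<in> wicks_at r n P" shows "length w = 2 * n"
proof -
  obtain A B C where "(A, B, C) \<in> wicks_triples r (arc_len n P 0) (arc_len n P 1) (arc_len n P 2)"
    and rot: "rotate (fst P) w = wicks A B C" using assms(2) by (auto simp: wicks_at_def)
  then have "length A + length B + length C = n"
    using arc_len_sum[OF assms(1)] by (simp add: wicks_triples_def)
  then show ?thesis using arg_cong[OF rot, of length] by simp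
qed

text \<open>Rotation by \<open>p\<close> transports \<open>wicks_partner\<close> to the window
  \<open>{p..<n + p}\<close>, which covers the three uninverted arcs. The partner map sends the
  other positions into this window and is an involution.\<close>

lemma wicks_at_partner:
  assumes P: "P \<in> cuts n" and w: "w \<in> wicks_at r n P" and i: "i < 2 * n"
  shows "w ! partner n P i = inv_letter (w ! i)"
proof -
  obtain p q s where Peq: "P = (p, q, s)" by (cases P)
  note pqs = P[unfolded Peq cuts_def, simplified]
  have lw: "length w = 2 * n" using length_wicks_at[OF P w] .
  obtain A B C where ABC: "(A, B, C) \<in> wicks_triples r (q - p) (s - q) (n - s + p)"
    and rot: "rotate p w = wicks A B C"
    using w by (auto simp: wicks_at_def Peq arc_len_def)
  have len: "length A = q - p" "length B = s - q" "length C = n - s + p"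
    using ABC by (auto simp: wicks_triples_def)
  have nth: "wicks A B C ! j = w ! ((p + j) mod (2 * n))" if "j < 2 * n" for j
    using that unfolding rot[symmetric] by (simp add: nth_rotate lw)
  have half: "w ! partner n P i = inv_letter (w ! i)" if i: "p \<le> i" "i < n + p" for i
  proof -
    let ?j = "i - p"
    let ?m = "if ?j < q - p then n + (q - p) - 1 - ?j
      else if ?j < (q - p) + (s - q) then n + 2 * (q - p) + (s - q) - 1 - ?j
      else 2 * n + (q - p) + (s - q) - 1 - ?j"
    have n: "q - p + (s - q) + (n - s + p) = n" using pqs by simp
    have 1: "wicks A B C ! ?m = inv_letter (wicks A B C ! ?j)"
      using wicks_partner[OF len, of ?j, unfolded n] i by (simp add: less_diff_conv2)
    have m: "?m < 2 * n" using pqs i by auto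
    note eq = partner_eq[OF P[unfolded Peq]]
    consider "i < q" | "q \<le> i" "i < s" | "s \<le> i" "i < p + s" | "p + s \<le> i" "s \<le> i" by linarith
    then have "(p + ?m) mod (2 * n) = partner n P i"
    proof cases
      case 1
      have c: "i - p < q - p" using 1 i pqs by linarith+
      have "partner n P i = n + p + q - 1 - i"
        using 1 i pqs by (simp add: eq Peq)
      moreover have "p + ?m = n + p + q - 1 - i"
      proof -
        have "?m = n + (q - p) - 1 - (i - p)" using c by simp
        moreover have "p + (n + (q - p) - 1 - (i - p)) = n + p + q - 1 - i" using 1 i pqs by linarith
        ultimately show ?thesis by (simp only:)
      qed
      moreover have "n + p + q - 1 - i < 2 * n" using 1 i pqs by linarith
      ultimately show ?thesis by (simp only: mod_less)
    next
      case 2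
      have c: "\<not> i - p < q - p" "i - p < q - p + (s - q)" using 2 i pqs by linarith+
      have "partner n P i = n + q + s - 1 - i"
        using 2 i pqs by (simp add: eq Peq)
      moreover have "p + ?m = n + q + s - 1 - i"
      proof -
        have "?m = n + 2 * (q - p) + (s - q) - 1 - (i - p)" using c by simp
        moreover have "p + (n + 2 * (q - p) + (s - q) - 1 - (i - p)) = n + q + s - 1 - i" using 2 i pqs by linarith
        ultimately show ?thesis by (simp only:)
      qed
      moreover have "n + q + s - 1 - i < 2 * n" using 2 i pqs by linarith
      ultimately show ?thesis by (simp only: mod_less)
    next
      case 3
      have c: "\<not> i - p < q - p" "\<not> i - p < q - p + (s - q)" using 3 i pqs by linarith+
      have "partner n P i = p + s - 1 - i"
        using 3 i pqs by (simp add: eq Peq)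
      moreover have "p + ?m = (p + s - 1 - i) + 2 * n"
      proof -
        have "?m = 2 * n + (q - p) + (s - q) - 1 - (i - p)" using c by simp
        moreover have "p + (2 * n + (q - p) + (s - q) - 1 - (i - p)) = (p + s - 1 - i) + 2 * n" using 3 i pqs by linarith
        ultimately show ?thesis by (simp only:)
      qed
      moreover have "p + s - 1 - i < 2 * n" using 3 i pqs by linarith
      ultimately show ?thesis by (simp only: mod_add_self2 mod_less)
    next
      case 4
      have c: "\<not> i - p < q - p" "\<not> i - p < q - p + (s - q)" using 4 i pqs by linarith+
      have "partner n P i = 2 * n + p + s - 1 - i"
        using 4 i pqs by (simp add: eq Peq)
      moreover have "p + ?m = 2 * n + p + s - 1 - i"
      proof -
        have "?m = 2 * n + (q - p) + (s - q) - 1 - (i - p)" using c by simp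
        moreover have "p + (2 * n + (q - p) + (s - q) - 1 - (i - p)) = 2 * n + p + s - 1 - i" using 4 i pqs by linarith
        ultimately show ?thesis by (simp only:)
      qed
      moreover have "2 * n + p + s - 1 - i < 2 * n" using 4 i pqs by linarith
      ultimately show ?thesis by (simp only: mod_less)
    qed
    moreover have "(p + ?j) mod (2 * n) = i" using i pqs by simp
    ultimately show ?thesis using 1 nth[OF m] nth[of ?j] i by (simp add: less_diff_conv2)
  qed
  show ?thesis
  proof (cases "p \<le> i \<and> i < n + p")
    case False
    have "p \<le> partner n P i" "partner n P i < n + p"
      using False i pqs unfolding Peq by (auto simp: partner_eq[OF P[unfolded Peq]])
    then have "w ! partner n P (partner n P i) = inv_letter (w ! partner n P i)" by (rule half)
    then show ?thesis by (simp add: partner_partner[OF P i])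
  qed (use half in blast)
qed

section \<open>Words with two Wicks structures\<close>

text \<open>\<open>U\<close> holds the positions not tied to an earlier one by \<open>f\<close>,
  \<open>g\<close> or a product of the two. Where \<open>f\<close> and \<open>g\<close> differ,
  \<open>U\<close> and its images under \<open>f\<close> and \<open>g\<close> are three disjoint
  sets, so at most a third of these positions is in \<open>U\<close>; where they agree, at most
  half. The difference between a third and a half is the saving.\<close>

lemma card_double_involution:
  fixes f g :: "nat \<Rightarrow> nat"
  assumes f: "\<And>i. i < m \<Longrightarrow> f i < m" "\<And>i. i < m \<Longrightarrow> f (f i) = i"
    and g: "\<And>i. i < m \<Longrightarrow> g i < m" "\<And>i. i < m \<Longrightarrow> g (g i) = i"
  defines "U \<equiv> {i. i < m \<and> i < f i \<and> i < g i \<and> i \<le> f (g i) \<and> i \<le> g (f i)}"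
  shows "6 * card U + card {i. i < m \<and> f i \<noteq> g i} \<le> 3 * m"
proof -
  define D where "D = {i. i < m \<and> f i \<noteq> g i}"
  define V where "V = U \<inter> D"
  define W where "W = U - D"
  have fin: "finite D" "finite V" "finite W" "finite U" by (auto simp: D_def V_def W_def U_def)
  have U: "i < m" "i < f i" "i < g i" "i \<le> f (g i)" "i \<le> g (f i)" if "i \<in> U" for i
    using that by (auto simp: U_def)
  have inj: "inj_on f U" "inj_on g U" using U f g by (metis inj_onI)+
  have fD: "f i \<in> D" "g i \<in> D" if "i \<in> D" for i
    using that f g unfolding D_def mem_Collect_eq by metis+
  have nf: "f i \<noteq> j" "g i \<noteq> j" if "i \<in> U" "j \<in> U" for i j
    using U[OF that(1)] U[OF that(2)] f(2) g(2) by (metis less_asym)+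
  \<comment> \<open>This disjointness is what the two products in \<open>U\<close> provide: if
    \<open>f i = g j\<close>, then \<open>g (f i) = j\<close> and \<open>f (g j) = i\<close>, which
    forces \<open>i = j\<close>.\<close>
  have nfg: "f i \<noteq> g j" if "i \<in> V" "j \<in> V" for i j
  proof
    assume e: "f i = g j"
    have ij: "i \<in> U" "j \<in> U" "i \<in> D" using that by (auto simp: V_def)
    have "i \<le> j" using U(5)[OF ij(1)] g(2) U(1)[OF ij(2)] e by simp
    moreover have "j \<le> i" using U(4)[OF ij(2)] f(2) U(1)[OF ij(1)] by (simp flip: e)
    ultimately show False using e ij(3) by (simp add: D_def)
  qed
  have "card (V \<union> f ` V \<union> g ` V) = card V + card (f ` V) + card (g ` V)"
  proof -
    have "V \<inter> f ` V = {}" "(V \<union> f ` V) \<inter> g ` V = {}"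
      using nf nfg nfg[symmetric] by (auto simp: V_def)
    then show ?thesis using fin by (simp add: card_Un_disjoint)
  qed
  also have "\<dots> = 3 * card V"
    using inj by (simp add: card_image inj_on_subset V_def)
  finally have "3 * card V = card (V \<union> f ` V \<union> g ` V)" by simp
  also have "\<dots> \<le> card D" using fin fD by (intro card_mono) (auto simp: V_def)
  finally have 1: "3 * card V \<le> card D" .
  have W: "i < m" "f i = g i" if "i \<in> W" for i using that U by (auto simp: W_def D_def)
  have "card (W \<union> f ` W) = card W + card (f ` W)"
    using fin nf by (intro card_Un_disjoint) (auto simp: W_def)
  also have "\<dots> = 2 * card W" using inj by (simp add: card_image inj_on_subset W_def)
  finally have "2 * card W = card (W \<union> f ` W)" by simp
  also have "\<dots> \<le> card ({..<m} - D)"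
  proof (intro card_mono subsetI)
    fix x assume "x \<in> W \<union> f ` W"
    then show "x \<in> {..<m} - D" using W f g by (auto simp: D_def) (metis W(2))+
  qed simp
  also have "\<dots> = m - card D" by (subst card_Diff_subset) (auto simp: D_def)
  finally have 2: "2 * card W \<le> m - card D" .
  have 3: "card D \<le> m" using card_mono[of "{..<m}" D] by (auto simp: D_def)
  have "card U = card V + card W"
    using fin by (subst card_Un_disjoint[symmetric]) (auto simp: V_def W_def intro!: arg_cong[of _ _ card])
  then show ?thesis using 1 2 3 unfolding D_def by linarith
qed

section \<open>Words compatible with two systems\<close>

lemma sum_at_less: "P \<in> cuts n \<Longrightarrow> sum_at n P i < 2 * n"
  by (auto simp: sum_at_def arc_sum_def cuts_def)

lemma add_mod_cancel_less:
  fixes a b c m :: nat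
  assumes "a < m" "b < m" "(a + c) mod m = (b + c) mod m"
  shows "a = b"
proof -
  have *: "a \<le> b" if "b < m" "a < m" "(a + c) mod m = (b + c) mod m" for a b
  proof (rule ccontr)
    assume "\<not> a \<le> b"
    then have "m dvd a - b" using that mod_eq_dvd_iff_nat[of "b + c" "a + c" m] by simp
    then show False using that \<open>\<not> a \<le> b\<close> by (auto dest: dvd_imp_le)
  qed
  show ?thesis using *[of a b] *[of b a] assms by simp
qed

lemma partner_eqD:
  assumes "P \<in> cuts n" "P' \<in> cuts n" "i < 2 * n" "partner n P i = partner n P' i"
  shows "sum_at n P (i mod n) = sum_at n P' (i mod n)"
proof -
  define a b where "a = sum_at n P (i mod n)" and "b = sum_at n P' (i mod n)"
  have ab: "a < 2 * n" "b < 2 * n" using assms sum_at_less by (auto simp: a_def b_def)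
  have "(a + 3 * n - 1 - i) mod (2 * n) = (b + 3 * n - 1 - i) mod (2 * n)"
    using assms(4) by (simp add: partner_def a_def b_def)
  moreover have "a + 3 * n - 1 - i = a + (3 * n - 1 - i)" "b + 3 * n - 1 - i = b + (3 * n - 1 - i)"
    using assms(3) by auto
  ultimately have "a = b" using add_mod_cancel_less[OF ab] by simp
  then show ?thesis by (simp add: a_def b_def)
qed

lemma card_partner_disagree:
  assumes "P \<in> cuts n" "P' \<in> cuts n"
  shows "2 * disagree n P P' \<le> card {i. i < 2 * n \<and> partner n P i \<noteq> partner n P' i}"
proof -
  let ?D = "{i. i < n \<and> sum_at n P i \<noteq> sum_at n P' i}"
  have "card (?D \<union> (\<lambda>i. i + n) ` ?D) = card ?D + card ((\<lambda>i. i + n) ` ?D)"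
    by (intro card_Un_disjoint) auto
  also have "\<dots> = 2 * disagree n P P'" by (simp add: card_image disagree_def)
  finally have "2 * disagree n P P' = card (?D \<union> (\<lambda>i. i + n) ` ?D)" by simp
  also have "\<dots> \<le> card {i. i < 2 * n \<and> partner n P i \<noteq> partner n P' i}"
  proof (intro card_mono subsetI)
    fix x assume "x \<in> ?D \<union> (\<lambda>i. i + n) ` ?D"
    then obtain i where i: "i < n" "sum_at n P i \<noteq> sum_at n P' i" "x = i \<or> x = i + n" by auto
    then show "x \<in> {i. i < 2 * n \<and> partner n P i \<noteq> partner n P' i}"
      using partner_eqD[OF assms, of x] by auto
  qed simp
  finally show ?thesis .
qed

lemma wicks_at_word:
  assumes "P \<in> cuts n" "w \<in> wicks_at r n P"
  shows "reduced w \<and> length w = 2 * n \<and> set w \<subseteq> letters r \<and> cyc_reduced w"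
proof -
  obtain A B C where "(A, B, C) \<in> wicks_triples r (arc_len n P 0) (arc_len n P 1) (arc_len n P 2)"
    and rot: "rotate (fst P) w = wicks A B C" using assms(2) by (auto simp: wicks_at_def)
  then have ABC: "cyc_reduced (wicks A B C)" "set A \<subseteq> letters r" "set B \<subseteq> letters r" "set C \<subseteq> letters r"
    by (auto simp: wicks_triples_def)
  have "set (wicks A B C) \<subseteq> letters r" using ABC set_winv_letters by (auto simp: wicks_def)
  then have "set w \<subseteq> letters r" using rot by (metis set_rotate)
  moreover have "cyc_reduced w" using ABC(1) rot by (metis cyc_reduced_rotate)
  ultimately show ?thesis using length_wicks_at[OF assms] by (simp add: cyc_reduced_def)
qed

text \<open>Applying a partner map inverts the letter and applying two restores it, so a letter is
  known once any of the four related positions comes earlier. A disagreement modulo \<open>n\<close>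
  counts at two positions, hence \<open>6 * card U + 2 * d\<close> is at most \<open>6 * n\<close>
  for \<open>d\<close> disagreements.\<close>

lemma card_wicks_at_Int:
  assumes P: "P \<in> cuts n" "P' \<in> cuts n" and r: "0 < r"
  shows "card (wicks_at r n P \<inter> wicks_at r n P') \<le> 2 * r * (2 * r - 1) ^ (n - disagree n P P' div 3)"
proof -
  let ?f = "partner n P" and ?g = "partner n P'"
  define U where "U = {i. i < 2 * n \<and> i < ?f i \<and> i < ?g i \<and> i \<le> ?f (?g i) \<and> i \<le> ?g (?f i)}"
  have "6 * card U + card {i. i < 2 * n \<and> ?f i \<noteq> ?g i} \<le> 3 * (2 * n)"
    unfolding U_def using partner_less partner_partner P by (intro card_double_involution) auto
  then have U: "card U \<le> n - disagree n P P' div 3" using card_partner_disagree[OF P] by linarith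
  have n: "0 < n" using P(1) by (auto simp: cuts_def)
  have "card (wicks_at r n P \<inter> wicks_at r n P') \<le> 2 * r * (2 * r - 1) ^ card U"
  proof (rule card_reduced_determined[of _ "2 * n"])
    show "reduced w \<and> length w = 2 * n \<and> set w \<subseteq> letters r"
      if "w \<in> wicks_at r n P \<inter> wicks_at r n P'" for w
      using wicks_at_word[OF P(1)] that by blast
  next
    fix v w i
    assume vw: "v \<in> wicks_at r n P \<inter> wicks_at r n P'" "w \<in> wicks_at r n P \<inter> wicks_at r n P'"
      and i: "i < 2 * n" "i \<notin> U" "take i v = take i w"
    have eq: "v ! j = w ! j" if "j < i" for j using that i(3) by (metis nth_take)
    have f: "u ! ?f j = inv_letter (u ! j)" "u ! ?g j = inv_letter (u ! j)"
      if "u \<in> {v, w}" "j < 2 * n" for u j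
      using wicks_at_partner[OF P(1)] wicks_at_partner[OF P(2)] vw that by auto
    have less: "?f i < 2 * n" "?g i < 2 * n" using partner_less P by auto
    \<comment> \<open>A fixed point would be a letter equal to its own inverse; this turns the
      failed strict comparisons in \<open>U\<close> into earlier positions.\<close>
    have "?f i \<noteq> i" "?g i \<noteq> i" using f[of v i] i(1) by (metis insertI1 inv_letter_neq(1))+
    then consider "?f i < i" | "?g i < i" | "?f (?g i) < i" | "?g (?f i) < i"
      using i unfolding U_def by force
    then show "v ! i = w ! i"
    proof cases
      case 1 then show ?thesis using eq f[of v i] f[of w i] i(1) by (metis insertCI inv_letter_inject)
    next
      case 2 then show ?thesis using eq f[of v i] f[of w i] i(1) by (metis insertCI inv_letter_inject)
    next
      case 3 then show ?thesis using eq[OF 3] f[of v i] f[of w i] f[of v "?g i"] f[of w "?g i"] i(1) less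
        by simp
    next
      case 4 then show ?thesis using eq[OF 4] f[of v i] f[of w i] f[of v "?f i"] f[of w "?f i"] i(1) less
        by simp
    qed
  qed (use r n in \<open>auto simp: U_def\<close>)
  also have "\<dots> \<le> 2 * r * (2 * r - 1) ^ (n - disagree n P P' div 3)"
    using U r by (intro mult_left_mono power_increasing) auto
  finally show ?thesis .
qed

section \<open>Counting pairs of cut point systems\<close>

lemma less_3_iff: "k < (3::nat) \<longleftrightarrow> k = 0 \<or> k = 1 \<or> k = 2"
  by auto

lemma sum_at_arc_sum: "\<exists>k<3. sum_at n P i = arc_sum n P k"
  by (cases P) (auto simp: sum_at_def arc_index_def less_3_iff)

lemma arc_sums:
  assumes "(p, q, s) \<in> cuts n"
  shows "arc_sum n (p, q, s) 0 = p + q" "arc_sum n (p, q, s) 1 = q + s"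
    "arc_sum n (p, q, s) 2 = (if p + s < n then p + s + n else p + s - n)"
  using arc_sum_2[OF assms] by (simp_all add: arc_sum_def)

text \<open>So the value \<open>sum_at n P i\<close> identifies the arc containing \<open>i\<close>:
  the third sum lies below both others if it was reduced modulo \<open>2 * n\<close>, and above both
  otherwise.\<close>

lemma arc_sum_eq_iff:
  assumes "P \<in> cuts n" "j < 3" "k < 3"
  shows "arc_sum n P j = arc_sum n P k \<longleftrightarrow> j = k"
proof -
  obtain p q s where P: "P = (p, q, s)" by (cases P)
  note pqs = assms(1)[unfolded P cuts_def, simplified]
  note sums = arc_sums[OF assms(1)[unfolded P]]
  have "p + q \<noteq> arc_sum n P 2" "q + s \<noteq> arc_sum n P 2"
    unfolding P sums using pqs by (cases "p + s < n"; simp; linarith)+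
  then show ?thesis
    using assms(2,3) pqs sums(1,2) unfolding P less_3_iff by (elim disjE) auto
qed

lemma card_arc:
  assumes "P \<in> cuts n" "k < 3"
  shows "card {i. i < n \<and> sum_at n P i = arc_sum n P k} = arc_len n P k"
proof -
  obtain p q s where P: "P = (p, q, s)" by (cases P)
  note pqs = assms(1)[unfolded P cuts_def, simplified]
  have "arc_index P i < 3" for i by (simp add: P arc_index_def)
  then have "{i. i < n \<and> sum_at n P i = arc_sum n P k} = {i. i < n \<and> arc_index P i = k}"
    using arc_sum_eq_iff[OF assms(1) _ assms(2)] by (simp add: sum_at_def)
  also have "\<dots> = (if k = 0 then {p..<q} else if k = 1 then {q..<s} else {..<p} \<union> {s..<n})"
    using pqs assms(2) by (auto simp: P arc_index_def split: if_splits)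
  also have "card \<dots> = arc_len n P k"
  proof -
    have "card ({..<p} \<union> {s..<n}) = card {..<p} + card {s..<n}"
      using pqs by (intro card_Un_disjoint) auto
    then show ?thesis by (simp add: P arc_len_def)
  qed
  finally show ?thesis .
qed

lemma disagree_commute: "disagree n P P' = disagree n P' P"
  unfolding disagree_def by (rule arg_cong[of _ _ card]) auto

text \<open>An arc longer than the number of disagreements contains a position of agreement, and then
  has the same centre as an arc of the other system.\<close>

lemma disagree_match:
  assumes "P \<in> cuts n" "P' \<in> cuts n" "k < 3" "disagree n P P' < arc_len n P' k"
  shows "\<exists>j<3. arc_sum n P j = arc_sum n P' k \<and> arc_len n P' k \<le> arc_len n P j + disagree n P P'
    \<and> arc_len n P j \<le> arc_len n P' k + disagree n P P'"
proof -
  let ?t = "arc_sum n P' k"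
  let ?A = "{i. i < n \<and> sum_at n P i = ?t}"
  let ?A' = "{i. i < n \<and> sum_at n P' i = ?t}"
  let ?D = "{i. i < n \<and> sum_at n P i \<noteq> sum_at n P' i}"
  have A': "card ?A' = arc_len n P' k" by (rule card_arc[OF assms(2,3)])
  have "\<not> ?A' \<subseteq> ?D"
    using assms(4) A' card_mono[of ?D ?A'] by (auto simp: disagree_def)
  then obtain i where i: "i < n" "sum_at n P i = ?t" by auto
  then obtain j where j: "j < 3" "arc_sum n P j = ?t" using sum_at_arc_sum by metis
  have A: "card ?A = arc_len n P j" using card_arc[OF assms(1) j(1)] j(2) by simp
  have "card ?A' \<le> card (?A \<union> ?D)" by (intro card_mono) auto
  also have "\<dots> \<le> card ?A + card ?D" by (rule card_Un_le)
  finally have 1: "card ?A' \<le> card ?A + disagree n P P'" by (simp add: disagree_def)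
  have "card ?A \<le> card (?A' \<union> ?D)" by (intro card_mono) auto
  also have "\<dots> \<le> card ?A' + card ?D" by (rule card_Un_le)
  finally have 2: "card ?A \<le> card ?A' + disagree n P P'" by (simp add: disagree_def)
  show ?thesis using j 1 2 A A' by auto
qed

text \<open>Sorted, three distinct sums contained among three sums must coincide with them. Each
  third sum is either least or greatest. If both have the same rank, the systems agree; in the mixed
  cases the equations force \<open>s = p' + n\<close> or \<open>s' = p + n\<close>, which is out of
  range.\<close>

lemma arc_sums_determine:
  assumes P: "(p, q, s) \<in> cuts n" and P': "(p', q', s') \<in> cuts n"
    and sub: "\<And>k. k < 3 \<Longrightarrow> \<exists>j<3. arc_sum n (p', q', s') j = arc_sum n (p, q, s) k"
  shows "(p, q, s) = (p', q', s')"
proof -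
  note pqs = P[unfolded cuts_def, simplified] and pqs' = P'[unfolded cuts_def, simplified]
  define t t' where "t = arc_sum n (p, q, s) 2" and "t' = arc_sum n (p', q', s') 2"
  have t: "p + s < n \<and> t = p + s + n \<or> n \<le> p + s \<and> t + n = p + s"
    "p' + s' < n \<and> t' = p' + s' + n \<or> n \<le> p' + s' \<and> t' + n = p' + s'"
    using arc_sums(3)[OF P] arc_sums(3)[OF P'] by (auto simp: t_def t'_def)
  have "arc_sum n (p, q, s) k \<in> {p' + q', q' + s', t'}" if "k < 3" for k
  proof -
    obtain j where j: "j < 3" "arc_sum n (p', q', s') j = arc_sum n (p, q, s) k"
      using sub[OF \<open>k < 3\<close>] by blast
    show ?thesis
      using j(1)[unfolded less_3_iff]
      by (elim disjE; simp only: flip: j(2); simp add: arc_sums(1,2)[OF P'] t'_def arc_sums(2)[OF P', unfolded One_nat_def])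
  qed
  from this[of 0] this[of 1] this[of 2]
  have "p + q \<in> {p' + q', q' + s', t'}" "q + s \<in> {p' + q', q' + s', t'}" "t \<in> {p' + q', q' + s', t'}"
    unfolding arc_sums(1,2)[OF P] t_def by simp_all
  then have mem: "p + q = p' + q' \<or> p + q = q' + s' \<or> p + q = t'"
    "q + s = p' + q' \<or> q + s = q' + s' \<or> q + s = t'" "t = p' + q' \<or> t = q' + s' \<or> t = t'"
    by simp_all
  have sorted: "a = a' \<and> b = b' \<and> c = c'"
    if "a < b" "b < c" "a' < b'" "b' < c'" "a = a' \<or> a = b' \<or> a = c'" "b = a' \<or> b = b' \<or> b = c'"
      "c = a' \<or> c = b' \<or> c = c'" for a b c a' b' c' :: nat
    using that by auto
  have ord: "t < p + q \<or> q + s < t" "p + q < q + s" "t' < p' + q' \<or> q' + s' < t'" "p' + q' < q' + s'"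
    using t pqs pqs' by linarith+
  consider "t < p + q" "t' < p' + q'" | "t < p + q" "q' + s' < t'"
    | "q + s < t" "t' < p' + q'" | "q + s < t" "q' + s' < t'" using ord by blast
  then have "p = p' \<and> q = q' \<and> s = s'"
  proof cases
    case 1
    then have "t = t' \<and> p + q = p' + q' \<and> q + s = q' + s'"
      using sorted[of t "p + q" "q + s" t' "p' + q'" "q' + s'"] ord(2,4) mem by blast
    then show ?thesis using 1 t pqs pqs' by linarith
  next
    case 2
    then have "t = p' + q' \<and> p + q = q' + s' \<and> q + s = t'"
      using sorted[of t "p + q" "q + s" "p' + q'" "q' + s'" t'] ord(2,4) mem by blast
    then show ?thesis using 2 t pqs pqs' by linarith
  next
    case 3
    then have "p + q = t' \<and> q + s = p' + q' \<and> t = q' + s'"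
      using sorted[of "p + q" "q + s" t t' "p' + q'" "q' + s'"] ord(2,4) mem by blast
    then show ?thesis using 3 t pqs pqs' by linarith
  next
    case 4
    then have "p + q = p' + q' \<and> q + s = q' + s' \<and> t = t'"
      using sorted[of "p + q" "q + s" t "p' + q'" "q' + s'" t'] ord(2,4) mem by blast
    then show ?thesis using 4 t pqs pqs' by linarith
  qed
  then show ?thesis by simp
qed

text \<open>Otherwise all three arcs would keep their centres and the systems would coincide. The
  short arc saves a factor \<open>n\<close> in the number of close pairs.\<close>

lemma disagree_ge_arc_len:
  assumes "P \<in> cuts n" "P' \<in> cuts n" "P \<noteq> P'"
  shows "\<exists>k<3. arc_len n P k \<le> disagree n P P'"
proof (rule ccontr)
  assume "\<not> ?thesis"
  then have "\<And>k. k < 3 \<Longrightarrow> disagree n P' P < arc_len n P k"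
    by (auto simp: disagree_commute[of n P'] not_le)
  then have "\<And>k. k < 3 \<Longrightarrow> \<exists>j<3. arc_sum n P' j = arc_sum n P k"
    using disagree_match[OF assms(2,1)] by blast
  then show False using assms arc_sums_determine by (metis prod_cases3)
qed

text \<open>A fixed arc length makes one cut point a function of the other two.\<close>

lemma card_arc_len_eq: "card {P \<in> cuts n. arc_len n P k = l} \<le> n\<^sup>2"
proof -
  define f :: "nat \<times> nat \<times> nat \<Rightarrow> nat \<times> nat"
    where "f = (\<lambda>(p, q, s). if k = 0 then (q, s) else (p, q))"
  have "inj_on f {P \<in> cuts n. arc_len n P k = l}"
    by (auto simp: inj_on_def f_def cuts_def arc_len_def split: if_splits)
  moreover have "f ` {P \<in> cuts n. arc_len n P k = l} \<subseteq> {..<n} \<times> {..<n}"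
    by (auto simp: f_def cuts_def split: if_splits)
  ultimately have "card {P \<in> cuts n. arc_len n P k = l} \<le> card ({..<n} \<times> {..<n})"
    by (intro card_inj_on_le) auto
  then show ?thesis by (simp add: power2_eq_square card_cartesian_product)
qed

lemma card_short_arc: "card {P \<in> cuts n. \<exists>k<3. arc_len n P k \<le> x} \<le> 3 * (x * n\<^sup>2)"
proof -
  have "{P \<in> cuts n. \<exists>k<3. arc_len n P k \<le> x}
      \<subseteq> (\<Union>k\<in>{..<3}. \<Union>l\<in>{1..x}. {P \<in> cuts n. arc_len n P k = l})"
    using arc_len_pos by (auto simp: Suc_le_eq)
  then have "card {P \<in> cuts n. \<exists>k<3. arc_len n P k \<le> x}
      \<le> card (\<Union>k\<in>{..<3}. \<Union>l\<in>{1..x}. {P \<in> cuts n. arc_len n P k = l})"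
    by (intro card_mono) auto
  also have "\<dots> \<le> (\<Sum>k\<in>{..<3::nat}. card (\<Union>l\<in>{1..x}. {P \<in> cuts n. arc_len n P k = l}))"
    by (intro card_UN_le) auto
  also have "\<dots> \<le> (\<Sum>k\<in>{..<3::nat}. \<Sum>l\<in>{1..x}. card {P \<in> cuts n. arc_len n P k = l})"
    by (intro sum_mono card_UN_le) auto
  also have "\<dots> \<le> (\<Sum>k\<in>{..<3::nat}. \<Sum>l\<in>{1..x}. n\<^sup>2)"
    by (intro sum_mono card_arc_len_eq)
  finally show ?thesis by simp
qed

text \<open>A system at distance at most \<open>x\<close> from \<open>P\<close> is encoded by its arc lengths, together with
  the centres of the arcs longer than \<open>x\<close>; there are few possibilities by the matching lemma.\<close>

definition arc_code :: "nat \<Rightarrow> nat \<Rightarrow> nat \<times> nat \<times> nat \<Rightarrow> nat \<Rightarrow> (nat \<times> nat) + nat" where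
  "arc_code n x P k = (if x < arc_len n P k then Inl (arc_sum n P k, arc_len n P k) else Inr (arc_len n P k))"

text \<open>The lengths fix the system up to a shift. As they add up to \<open>n\<close>, which
  exceeds \<open>3 * x\<close>, some arc is longer than \<open>x\<close>, and its recorded centre
  fixes the shift.\<close>

lemma arc_code_inj:
  assumes P: "P \<in> cuts n" and P': "P' \<in> cuts n" and n: "3 * x < n"
    and eq: "\<And>k. k < 3 \<Longrightarrow> arc_code n x P k = arc_code n x P' k"
  shows "P = P'"
proof -
  obtain p q s where Peq: "P = (p, q, s)" by (cases P)
  obtain p' q' s' where Peq': "P' = (p', q', s')" by (cases P')
  note pqs = P[unfolded Peq cuts_def, simplified] and pqs' = P'[unfolded Peq' cuts_def, simplified]
  note sums = arc_sums[OF P[unfolded Peq]] arc_sums[OF P'[unfolded Peq']]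
  have len: "arc_len n P k = arc_len n P' k" if "k < 3" for k
    using eq[OF that] by (simp add: arc_code_def split: if_splits)
  have "\<exists>k<3. x < arc_len n P k"
  proof (rule ccontr)
    assume "\<not> ?thesis"
    then have "arc_len n P k \<le> x" if "k < 3" for k using that not_less by blast
    from this[of 0] this[of 1] this[of 2] show False using arc_len_sum[OF P] n by simp
  qed
  then obtain k where k: "k < 3" "x < arc_len n P k" by blast
  then have sum: "arc_sum n P k = arc_sum n P' k"
    using eq[of k] by (simp add: arc_code_def split: if_splits)
  have d: "q - p = q' - p'" "s - q = s' - q'"
    using len[of 0] len[of 1] by (simp_all add: Peq Peq' arc_len_def)
  consider "p + q = p' + q'" | "q + s = q' + s'"
    | "(if p + s < n then p + s + n else p + s - n) = (if p' + s' < n then p' + s' + n else p' + s' - n)"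
    using k(1)[unfolded less_3_iff] sum unfolding Peq Peq' by (elim disjE) (simp_all only: sums)
  then have "p = p' \<and> q = q' \<and> s = s'"
  proof cases
    case 3
    then have "p + s = p' + s'" using pqs pqs' by (simp split: if_splits)
    then show ?thesis using d pqs pqs' by linarith
  qed (use d pqs pqs' in linarith)+
  then show ?thesis by (simp add: Peq Peq')
qed

lemma card_disagree_le:
  assumes P: "P \<in> cuts n"
  shows "card {P' \<in> cuts n. disagree n P P' \<le> x} \<le> (7 * x + 4) ^ 3 + (3 * x) ^ 3"
proof (cases "3 * x < n")
  case False
  have "card {P' \<in> cuts n. disagree n P P' \<le> x} \<le> card ({..<n} \<times> {..<n} \<times> {..<n})"
    by (intro card_mono) (auto simp: cuts_def)
  also have "\<dots> = n ^ 3" by (simp add: card_cartesian_product power3_eq_cube)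
  also have "\<dots> \<le> (3 * x) ^ 3" using False by (intro power_mono) auto
  finally show ?thesis by simp
next
  case True
  define X where "X = Inl ` (\<Union>j\<in>{..<3}. {arc_sum n P j} \<times> {arc_len n P j - x..arc_len n P j + x})
    \<union> Inr ` {..x}"
  have code: "arc_code n x P' k \<in> X" if P': "P' \<in> cuts n" "k < 3" and d: "disagree n P P' \<le> x" for P' k
  proof (cases "x < arc_len n P' k")
    case True
    then obtain j where "j < 3" "arc_sum n P j = arc_sum n P' k"
      "arc_len n P' k \<le> arc_len n P j + disagree n P P'"
      "arc_len n P j \<le> arc_len n P' k + disagree n P P'"
      using disagree_match[OF P P'] d by auto
    then have "(arc_sum n P' k, arc_len n P' k)
        \<in> (\<Union>j\<in>{..<3}. {arc_sum n P j} \<times> {arc_len n P j - x..arc_len n P j + x})"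
      using d by (intro UN_I[of j]) auto
    then show ?thesis using True by (simp add: arc_code_def X_def)
  qed (simp add: arc_code_def X_def)
  have "card (\<Union>j\<in>{..<3}. {arc_sum n P j} \<times> {arc_len n P j - x..arc_len n P j + x})
      \<le> (\<Sum>j\<in>{..<3::nat}. card ({arc_sum n P j} \<times> {arc_len n P j - x..arc_len n P j + x}))"
    by (intro card_UN_le) auto
  also have "\<dots> \<le> (\<Sum>j\<in>{..<3::nat}. 2 * x + 1)"
    by (intro sum_mono) (simp add: card_cartesian_product)
  finally have 1: "card (\<Union>j\<in>{..<3}. {arc_sum n P j} \<times> {arc_len n P j - x..arc_len n P j + x})
      \<le> 3 * (2 * x + 1)" by simp
  have "card X \<le> card (\<Union>j\<in>{..<3}. {arc_sum n P j} \<times> {arc_len n P j - x..arc_len n P j + x}) + card {..x}"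
    unfolding X_def by (rule order.trans[OF card_Un_le]) (intro add_mono card_image_le; simp)
  then have X: "card X \<le> 7 * x + 4" using 1 by simp
  have finX: "finite X" by (simp add: X_def)
  let ?c = "\<lambda>P'. (arc_code n x P' 0, arc_code n x P' 1, arc_code n x P' 2)"
  have "inj_on ?c {P' \<in> cuts n. disagree n P P' \<le> x}"
  proof (rule inj_onI)
    fix Q R assume "Q \<in> {P' \<in> cuts n. disagree n P P' \<le> x}" "R \<in> {P' \<in> cuts n. disagree n P P' \<le> x}"
      and "?c Q = ?c R"
    then show "Q = R" using arc_code_inj[OF _ _ True, of Q R] by (simp add: less_3_iff) metis
  qed
  moreover have "?c ` {P' \<in> cuts n. disagree n P P' \<le> x} \<subseteq> X \<times> X \<times> X"
    using code by auto
  ultimately have "card {P' \<in> cuts n. disagree n P P' \<le> x} \<le> card (X \<times> X \<times> X)"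
    using finX by (intro card_inj_on_le) auto
  also have "\<dots> = card X ^ 3" by (simp add: card_cartesian_product power3_eq_cube)
  also have "\<dots> \<le> (7 * x + 4) ^ 3" using X by (intro power_mono) auto
  finally show ?thesis by simp
qed

section \<open>Summation over pairs of distinct systems\<close>

definition cut_pairs :: "nat \<Rightarrow> ((nat \<times> nat \<times> nat) \<times> (nat \<times> nat \<times> nat)) set" where
  "cut_pairs n = {(P, P'). P \<in> cuts n \<and> P' \<in> cuts n \<and> P \<noteq> P'}"

lemma finite_cut_pairs [simp]: "finite (cut_pairs n)"
  by (rule finite_subset[of _ "cuts n \<times> cuts n"]) (auto simp: cut_pairs_def)

text \<open>The first factor counts systems \<open>P\<close> with an arc of length at most
  \<open>x\<close>, the second the systems within distance \<open>x\<close> of a given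
  \<open>P\<close>.\<close>

lemma card_cut_pairs:
  "card {(P, P') \<in> cut_pairs n. disagree n P P' = x} \<le> 3 * (x * n\<^sup>2) * ((7 * x + 4) ^ 3 + (3 * x) ^ 3)"
proof -
  let ?A = "{P \<in> cuts n. \<exists>k<3. arc_len n P k \<le> x}"
  let ?B = "\<lambda>P. {P' \<in> cuts n. disagree n P P' \<le> x}"
  have "{(P, P') \<in> cut_pairs n. disagree n P P' = x} \<subseteq> Sigma ?A ?B"
    using disagree_ge_arc_len by (fastforce simp: cut_pairs_def)
  then have "card {(P, P') \<in> cut_pairs n. disagree n P P' = x} \<le> card (Sigma ?A ?B)"
    by (intro card_mono) auto
  also have "\<dots> = (\<Sum>P\<in>?A. card (?B P))" by (intro card_SigmaI) auto
  also have "\<dots> \<le> (\<Sum>P\<in>?A. (7 * x + 4) ^ 3 + (3 * x) ^ 3)"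
    using card_disagree_le by (intro sum_mono) auto
  also have "\<dots> = card ?A * ((7 * x + 4) ^ 3 + (3 * x) ^ 3)" by simp
  also have "\<dots> \<le> 3 * (x * n\<^sup>2) * ((7 * x + 4) ^ 3 + (3 * x) ^ 3)"
    by (intro mult_right_mono card_short_arc) auto
  finally show ?thesis .
qed

text \<open>The fourth formal derivative of the geometric series, which still converges in the open
  unit disc.\<close>

lemma summable_quartic_geometric:
  "summable (\<lambda>x. (real x + 1) * ((real x + 2) * ((real x + 3) * (real x + 4))) * (5 / 7) ^ x)"
proof -
  have step: "(\<And>y::real. norm y < 1 \<Longrightarrow> summable (\<lambda>n. c n * y ^ n))
      \<Longrightarrow> (\<And>y. norm y < 1 \<Longrightarrow> summable (\<lambda>n. diffs c n * y ^ n))" for c :: "nat \<Rightarrow> real"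
    using termdiff_converges by blast
  have "(\<And>y::real. norm y < 1 \<Longrightarrow> summable (\<lambda>n. diffs (diffs (diffs (diffs (\<lambda>_. 1)))) n * y ^ n))"
    by (intro step) (simp_all add: summable_geometric)
  from this[of "5 / 7"] show ?thesis by (simp add: diffs_def algebra_simps)
qed

text \<open>The base \<open>5 / 7\<close> is chosen so that its cube exceeds \<open>1 / 3\<close>
  and its square, the loss from rounding in \<open>div\<close>, exceeds
  \<open>1 / 2\<close>.\<close>

lemma third_power_div_le: "(1 / 3 :: real) ^ (x div 3) \<le> 2 * (5 / 7) ^ x"
proof -
  have "(1 / 3 :: real) ^ (x div 3) \<le> ((5 / 7) ^ 3) ^ (x div 3)"
    by (intro power_mono) (auto simp: power3_eq_cube)
  also have "\<dots> = (5 / 7) ^ (3 * (x div 3))" by (simp add: power_mult)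
  also have "\<dots> \<le> 2 * (5 / 7) ^ x"
  proof -
    have "(5 / 7 :: real) ^ x = (5 / 7) ^ (3 * (x div 3)) * (5 / 7) ^ (x mod 3)"
      by (simp flip: power_add)
    moreover have "1 / 2 \<le> (5 / 7 :: real) ^ (x mod 3)"
    proof -
      have "(5 / 7 :: real) ^ 2 \<le> (5 / 7) ^ (x mod 3)"
        by (rule power_decreasing) auto
      then show ?thesis by (simp add: power2_eq_square)
    qed
    ultimately show ?thesis by (simp add: mult_le_cancel_left1 mult.assoc)
  qed
  finally show ?thesis .
qed

text \<open>Grouping by the disagreement \<open>x\<close> leaves a series in \<open>x\<close> alone.
  The base \<open>1 / 3\<close> bounds \<open>1 / (2 r - 1)\<close> for every \<open>r > 1\<close>,
  so that \<open>K\<close> can serve all ranks.\<close>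

lemma sum_cut_pairs:
  "\<exists>K. 0 \<le> K \<and> (\<forall>n. (\<Sum>(P, P')\<in>cut_pairs n. (1 / 3) ^ (disagree n P P' div 3)) \<le> K * (real n)\<^sup>2)"
proof -
  define h where "h = (\<lambda>x. 3 * real x * ((7 * real x + 4) ^ 3 + (3 * real x) ^ 3) * (1 / 3) ^ (x div 3))"
  have h0: "0 \<le> h x" for x by (simp add: h_def)
  have "h x \<le> 2220 * ((real x + 1) * ((real x + 2) * ((real x + 3) * (real x + 4))) * (5 / 7) ^ x)" for x
  proof -
    let ?y = "real x + 1"
    have "h x \<le> (3 * ?y * ((7 * ?y) ^ 3 + (3 * ?y) ^ 3)) * (2 * (5 / 7) ^ x)"
      unfolding h_def using third_power_div_le[of x]
      by (intro mult_mono add_mono power_mono) auto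
    \<comment> \<open>\<open>3 * (7 ^ 3 + 3 ^ 3) = 1110\<close>.\<close>
    also have "3 * ?y * ((7 * ?y) ^ 3 + (3 * ?y) ^ 3) = 1110 * (?y * (?y * (?y * ?y)))"
    proof -
      have "3 * y * ((7 * y) ^ 3 + (3 * y) ^ 3) = 1110 * (y * (y * (y * y)))" for y :: real
        by (simp add: power_mult_distrib power3_eq_cube)
      then show ?thesis .
    qed
    also have "1110 * (?y * (?y * (?y * ?y))) * (2 * (5 / 7) ^ x)
        \<le> 1110 * (?y * ((real x + 2) * ((real x + 3) * (real x + 4)))) * (2 * (5 / 7) ^ x)"
      by (intro mult_mono mult_right_mono mult_left_mono) auto
    also have "1110 * z * (2 * w) = 2220 * (z * w)" for z w :: real by simp
    finally show ?thesis .
  qed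
  then have summ: "summable h"
    using h0 by (intro summable_comparison_test'[OF summable_mult[OF summable_quartic_geometric]]) auto
  have "(\<Sum>(P, P')\<in>cut_pairs n. (1 / 3) ^ (disagree n P P' div 3)) \<le> suminf h * (real n)\<^sup>2" for n
  proof -
    let ?D = "\<lambda>(P, P'). disagree n P P'"
    have "(\<Sum>(P, P')\<in>cut_pairs n. (1 / 3 :: real) ^ (disagree n P P' div 3))
        = (\<Sum>d\<in>cut_pairs n. (1 / 3) ^ (?D d div 3))"
      by (intro sum.cong) auto
    also have "\<dots> = (\<Sum>x\<in>?D ` cut_pairs n. \<Sum>d\<in>{d \<in> cut_pairs n. ?D d = x}. (1 / 3) ^ (?D d div 3))"
      by (rule sum.image_gen) simp
    also have "\<dots> = (\<Sum>x\<in>?D ` cut_pairs n. real (card {d \<in> cut_pairs n. ?D d = x}) * (1 / 3) ^ (x div 3))"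
      by (intro sum.cong refl) simp
    also have "\<dots> \<le> (\<Sum>x\<in>?D ` cut_pairs n. h x * (real n)\<^sup>2)"
    proof (intro sum_mono)
      fix x
      have "{d \<in> cut_pairs n. ?D d = x} = {(P, P') \<in> cut_pairs n. disagree n P P' = x}" by auto
      then have "card {d \<in> cut_pairs n. ?D d = x}
          \<le> 3 * (x * n\<^sup>2) * ((7 * x + 4) ^ 3 + (3 * x) ^ 3)"
        using card_cut_pairs by simp
      then have "real (card {d \<in> cut_pairs n. ?D d = x})
          \<le> real (3 * (x * n\<^sup>2) * ((7 * x + 4) ^ 3 + (3 * x) ^ 3))" by (simp only: of_nat_le_iff)
      then have "real (card {d \<in> cut_pairs n. ?D d = x}) * (1 / 3) ^ (x div 3)
          \<le> real (3 * (x * n\<^sup>2) * ((7 * x + 4) ^ 3 + (3 * x) ^ 3)) * (1 / 3) ^ (x div 3)"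
        by (intro mult_right_mono) auto
      also have "\<dots> = h x * (real n)\<^sup>2" by (simp add: h_def mult_ac)
      finally show "real (card {d \<in> cut_pairs n. ?D d = x}) * (1 / 3) ^ (x div 3) \<le> h x * (real n)\<^sup>2" .
    qed
    also have "\<dots> = sum h (?D ` cut_pairs n) * (real n)\<^sup>2" by (simp add: sum_distrib_right)
    also have "\<dots> \<le> suminf h * (real n)\<^sup>2"
      using h0 summ by (intro mult_right_mono sum_le_suminf) auto
    finally show ?thesis .
  qed
  moreover have "0 \<le> suminf h" using summ h0 by (rule suminf_nonneg)
  ultimately show ?thesis by blast
qed

lemma sum_arc_len_power:
  fixes t :: real
  assumes "0 \<le> t" "t \<le> 1 / 3"
  shows "(\<Sum>P\<in>cuts n. t ^ arc_len n P k) \<le> 2 * (real n)\<^sup>2"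
proof -
  have "(\<Sum>P\<in>cuts n. t ^ arc_len n P k) \<le> (\<Sum>P\<in>cuts n. (1 / 3) ^ arc_len n P k)"
    using assms by (intro sum_mono power_mono) auto
  also have "\<dots> = (\<Sum>l\<in>(\<lambda>P. arc_len n P k) ` cuts n. \<Sum>P\<in>{P \<in> cuts n. arc_len n P k = l}. (1 / 3) ^ arc_len n P k)"
    by (rule sum.image_gen) simp
  also have "\<dots> = (\<Sum>l\<in>(\<lambda>P. arc_len n P k) ` cuts n. real (card {P \<in> cuts n. arc_len n P k = l}) * (1 / 3) ^ l)"
    by (intro sum.cong refl) simp
  also have "\<dots> \<le> (\<Sum>l\<in>(\<lambda>P. arc_len n P k) ` cuts n. (real n)\<^sup>2 * (1 / 3) ^ l)"
  proof (intro sum_mono mult_right_mono)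
    fix l show "real (card {P \<in> cuts n. arc_len n P k = l}) \<le> (real n)\<^sup>2"
      using card_arc_len_eq[of n k l] by (simp flip: of_nat_power)
  qed simp
  also have "\<dots> = (real n)\<^sup>2 * (\<Sum>l\<in>(\<lambda>P. arc_len n P k) ` cuts n. (1 / 3) ^ l)"
    by (simp add: sum_distrib_left)
  also have "\<dots> \<le> (real n)\<^sup>2 * (\<Sum>l. (1 / 3) ^ l)"
    by (intro mult_left_mono sum_le_suminf summable_geometric) auto
  also have "(\<Sum>l. (1 / 3 :: real) ^ l) = 3 / 2" by (subst suminf_geometric) auto
  finally show ?thesis using zero_le_power2[of "real n"] by linarith
qed

lemma card_cuts: "6 * real (card (cuts n)) = real n * (real n - 1) * (real n - 2)"
proof (induction n)
  case (Suc n)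
  have two: "2 * real (card {(p, q). p < q \<and> q < n}) = real n * (real n - 1)" for n
  proof (induction n)
    case (Suc n)
    have "{(p, q). p < q \<and> q < Suc n} = {(p, q). p < q \<and> q < n} \<union> (\<lambda>p. (p, n)) ` {..<n}"
      by (auto simp: less_Suc_eq)
    moreover have "finite {(p, q). p < q \<and> q < n}"
      by (rule finite_subset[of _ "{..<n} \<times> {..<n}"]) auto
    ultimately have "card {(p, q). p < q \<and> q < Suc n} = card {(p, q). p < q \<and> q < n} + card ((\<lambda>p. (p, n)) ` {..<n})"
      by (simp only:) (rule card_Un_disjoint, auto)
    then have "card {(p, q). p < q \<and> q < Suc n} = card {(p, q). p < q \<and> q < n} + n"
      by (simp add: card_image inj_on_def)
    then show ?case using Suc by (simp add: algebra_simps)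
  qed simp
  let ?f = "\<lambda>(p, q). (p, q, n)"
  have fin: "finite {(p, q). p < q \<and> q < n}"
    by (rule finite_subset[of _ "{..<n} \<times> {..<n}"]) auto
  have "cuts (Suc n) = cuts n \<union> ?f ` {(p, q). p < q \<and> q < n}"
    by (auto simp: cuts_def less_Suc_eq image_iff)
  then have "card (cuts (Suc n)) = card (cuts n) + card (?f ` {(p, q). p < q \<and> q < n})"
    using fin by (simp only:) (rule card_Un_disjoint, simp_all, auto simp: cuts_def)
  also have "card (?f ` {(p, q). p < q \<and> q < n}) = card {(p, q). p < q \<and> q < n}"
    by (rule card_image) (auto simp: inj_on_def)
  finally have "6 * real (card (cuts (Suc n)))
      = 6 * real (card (cuts n)) + 3 * (2 * real (card {(p, q). p < q \<and> q < n}))" by simp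
  then show ?case unfolding Suc two by (simp add: algebra_simps)
next
  case 0
  have "cuts 0 = {}" by (auto simp: cuts_def)
  then show ?case by simp
qed

text \<open>The sum runs over ordered pairs, twice the correction of the usual inequality; only its
  order of magnitude matters.\<close>

lemma bonferroni:
  assumes "finite I" "\<And>i. i \<in> I \<Longrightarrow> finite (S i)"
  shows "(\<Sum>i\<in>I. real (card (S i)))
    \<le> real (card (\<Union>i\<in>I. S i)) + (\<Sum>(i, j)\<in>{(i, j). i \<in> I \<and> j \<in> I \<and> i \<noteq> j}. real (card (S i \<inter> S j)))"
  using assms
proof (induction I)
  case (insert x I)
  let ?T = "\<lambda>I. {(i, j). i \<in> I \<and> j \<in> I \<and> i \<noteq> j}"
  have fin: "finite (?T (insert x I))"
    by (rule finite_subset[of _ "insert x I \<times> insert x I"]) (use insert(1) in auto)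
  have finS: "finite (S x)" "finite (\<Union>i\<in>I. S i)" using insert(1) insert.prems by auto
  have "card (S x) + card (\<Union>i\<in>I. S i) = card (S x \<union> (\<Union>i\<in>I. S i)) + card (S x \<inter> (\<Union>i\<in>I. S i))"
    by (rule card_Un_Int[OF finS])
  moreover have "card (S x \<inter> (\<Union>i\<in>I. S i)) \<le> (\<Sum>i\<in>I. card (S x \<inter> S i))"
    using card_UN_le[OF insert(1), of "\<lambda>i. S x \<inter> S i"] by (simp only: Int_UN_distrib)
  ultimately have "card (S x) + card (\<Union>i\<in>I. S i)
      \<le> card (\<Union>i\<in>insert x I. S i) + (\<Sum>i\<in>I. card (S x \<inter> S i))" by simp
  then have "real (card (S x) + card (\<Union>i\<in>I. S i))
      \<le> real (card (\<Union>i\<in>insert x I. S i) + (\<Sum>i\<in>I. card (S x \<inter> S i)))"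
    by (simp only: of_nat_le_iff)
  then have "real (card (S x)) + real (card (\<Union>i\<in>I. S i))
      \<le> real (card (\<Union>i\<in>insert x I. S i)) + (\<Sum>i\<in>I. real (card (S x \<inter> S i)))"
    by (simp only: of_nat_add of_nat_sum)
  moreover have "(\<Sum>i\<in>I. real (card (S x \<inter> S i))) + (\<Sum>(i, j)\<in>?T I. real (card (S i \<inter> S j)))
      \<le> (\<Sum>(i, j)\<in>?T (insert x I). real (card (S i \<inter> S j)))"
  proof -
    have "(\<Sum>i\<in>I. real (card (S x \<inter> S i))) = (\<Sum>(i, j)\<in>Pair x ` I. real (card (S i \<inter> S j)))"
      by (subst sum.reindex) (auto simp: inj_on_def)
    moreover have "(\<Sum>(i, j)\<in>Pair x ` I. real (card (S i \<inter> S j))) + (\<Sum>(i, j)\<in>?T I. real (card (S i \<inter> S j)))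
        = (\<Sum>(i, j)\<in>Pair x ` I \<union> ?T I. real (card (S i \<inter> S j)))"
      using insert(1,2) by (intro sum.union_disjoint[symmetric] finite_subset[OF _ fin]) auto
    moreover have "\<dots> \<le> (\<Sum>(i, j)\<in>?T (insert x I). real (card (S i \<inter> S j)))"
      by (intro sum_mono2 fin) (use insert(2) in auto)
    ultimately show ?thesis by simp
  qed
  moreover have "(\<Sum>i\<in>I. real (card (S i))) \<le> real (card (\<Union>i\<in>I. S i)) + (\<Sum>(i, j)\<in>?T I. real (card (S i \<inter> S j)))"
    using insert.IH insert.prems by simp
  ultimately show ?case using insert(1,2) by simp
qed simp

section \<open>Commutator words\<close>

lemma rotate_inverse:
  assumes "length w = m" "p \<le> m" shows "rotate (m - p) (rotate p w) = w"
  using assms by (simp add: rotate_rotate)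

lemma rotate_inj:
  fixes v w :: "'a list"
  shows "rotate p v = rotate p w \<Longrightarrow> v = w"
proof -
  assume eq: "rotate p v = rotate p w"
  then have len: "length v = length w" by (metis length_rotate)
  have inv: "rotate (length u - p mod length u) (rotate p u) = u" if "u \<noteq> []" for u :: "'a list"
    using rotate_inverse[of u "length u" "p mod length u"] that by (simp flip: rotate_conv_mod)
  show ?thesis
  proof (cases "w = []")
    case False
    then have "v \<noteq> []" using len by force
    then show ?thesis using trans[OF sym[OF inv[of v, unfolded len eq]] inv[OF False]] by blast
  qed (use len in simp)
qed

lemma comm_words_word:
  "w \<in> comm_words r k \<Longrightarrow> reduced w \<and> cyc_reduced w \<and> set w \<subseteq> letters r \<and> length w = k"
  by (simp add: comm_words_def cyc_reduced_def set_subset_letters_iff)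

lemma finite_comm_words [simp]: "finite (comm_words r k)"
  by (rule finite_subset[OF _ finite_words[of k r]]) (use comm_words_word in auto)

lemma comm_words_carrier: "w \<in> comm_words r k \<Longrightarrow> w \<in> carrier (free_group r)"
  by (simp add: comm_words_def cyc_reduced_def carrier_free_group)

lemma comm_words_rotate:
  assumes "w \<in> comm_words r k" shows "rotate m w \<in> comm_words r k"
proof -
  let ?G = "free_group r"
  have w: "w \<in> derived_set ?G (carrier ?G)" "cyc_reduced w" "fst ` set w \<subseteq> {..<r}" "length w = k"
    using assms unfolding comm_words_def by blast+
  have c: "cyc_reduced (rotate m w)" using w(2) by simp
  have car: "rotate m w \<in> carrier ?G"
    using c w(3) unfolding carrier_free_group cyc_reduced_def by simp
  have "conj_class ?G (rotate m w) = conj_class ?G w"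
    using conj_class_eq_iff_rotate[OF comm_words_carrier[OF assms] car w(2) c] by blast
  then have "rotate m w \<in> derived_set ?G (carrier ?G)"
    using subsetD[OF conj_class_subset_derived_set[OF group_free_group w(1)], of "rotate m w"]
      conj_class_self[OF car] by simp
  then show ?thesis using c w by (simp add: comm_words_def)
qed

lemma wicks_at_subset_comm_words:
  assumes "P \<in> cuts n" shows "wicks_at r n P \<subseteq> comm_words r (2 * n)"
proof
  fix w assume w: "w \<in> wicks_at r n P"
  then obtain A B C where "rotate (fst P) w = wicks A B C" by (auto simp: wicks_at_def)
  then show "w \<in> comm_words r (2 * n)"
    using wicks_at_word[OF assms w] by (intro wicks_comm_words) (auto simp flip: set_subset_letters_iff)
qed

lemma card_wicks_at:
  assumes P: "P \<in> cuts n"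
  shows "card (wicks_at r n P) = card (wicks_triples r (arc_len n P 0) (arc_len n P 1) (arc_len n P 2))"
proof -
  let ?T = "wicks_triples r (arc_len n P 0) (arc_len n P 1) (arc_len n P 2)"
  let ?f = "\<lambda>(A, B, C). rotate (2 * n - fst P) (wicks A B C)"
  have p: "fst P \<le> 2 * n" using P by (auto simp: cuts_def)
  have len: "length (wicks A B C) = 2 * n" if "(A, B, C) \<in> ?T" for A B C
    using that arc_len_sum[OF P] by (simp add: wicks_triples_def)
  have "inj_on ?f ?T"
  proof (rule inj_onI)
    fix t u assume tu: "t \<in> ?T" "u \<in> ?T" "?f t = ?f u"
    obtain A B C where t: "t = (A, B, C)" by (cases t)
    obtain A' B' C' where u: "u = (A', B', C')" by (cases u)
    have "wicks A B C = wicks A' B' C'" using tu(3) unfolding t u by (auto dest: rotate_inj)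
    then show "t = u" using tu(1,2) unfolding t u wicks_def wicks_triples_def by simp
  qed
  moreover have "?f ` ?T = wicks_at r n P"
  proof (intro equalityI subsetI)
    fix w assume "w \<in> ?f ` ?T"
    then obtain A B C where ABC: "(A, B, C) \<in> ?T" "w = rotate (2 * n - fst P) (wicks A B C)" by auto
    have "rotate (fst P) w = wicks A B C"
      using rotate_inverse[OF len[OF ABC(1)], of "2 * n - fst P"] p by (simp add: ABC(2))
    then show "w \<in> wicks_at r n P" using ABC(1) by (auto simp: wicks_at_def)
  next
    fix w assume w: "w \<in> wicks_at r n P"
    then obtain A B C where ABC: "(A, B, C) \<in> ?T" "rotate (fst P) w = wicks A B C"
      by (auto simp: wicks_at_def)
    have "w = rotate (2 * n - fst P) (wicks A B C)"
      using rotate_inverse[OF length_wicks_at[OF P w] p] ABC(2) by simp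
    then show "w \<in> ?f ` ?T" using ABC(1) by (intro image_eqI[of _ _ "(A, B, C)"]) auto
  qed
  ultimately show ?thesis by (metis card_image)
qed

text \<open>\<open>wicks_rotate\<close> moves the start from one cut point to the next until it
  passes \<open>2 * n\<close>. The overshoot \<open>p\<close> is then smaller than the arc just
  crossed, so the next two cut points \<open>p + length B\<close> and
  \<open>p + length B + length C\<close> stay below \<open>n\<close>.\<close>

lemma wicks_position:
  assumes "length w = 2 * n" "set w \<subseteq> letters r" "cyc_reduced w"
    and "rotate s w = wicks A B C" "s < 2 * n" "A \<noteq> []" "B \<noteq> []" "C \<noteq> []"
  shows "\<exists>P\<in>cuts n. w \<in> wicks_at r n P"
  using assms(4-)
proof (induction "2 * n - s" arbitrary: s A B C rule: less_induct)
  case less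
  let ?a = "length A" and ?b = "length B" and ?c = "length C"
  have len: "?a + ?b + ?c = n" using arg_cong[OF less.prems(1), of length] assms(1) by simp
  have rot: "rotate (?a + s) w = wicks B C (winv A)"
    using wicks_rotate[of A B C] less.prems(1) by (simp flip: rotate_rotate)
  have "set (wicks A B C) = set w" using less.prems(1) by (metis set_rotate)
  then have sub: "set A \<subseteq> letters r" "set B \<subseteq> letters r" "set C \<subseteq> letters r"
    using assms(2) by (auto simp: wicks_def)
  show ?case
  proof (cases "2 * n \<le> s + ?a")
    case True
    define p where "p = s + ?a - 2 * n"
    have p: "p < ?a" "?a + s = 2 * n + p" using True less.prems(2) by (simp_all add: p_def)
    have "rotate p w = rotate (2 * n + p) w"
      using assms(1) by (metis mod_add_self1 rotate_conv_mod)
    then have rot': "rotate p w = wicks B C (winv A)" using rot p(2) by simp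
    let ?P = "(p, p + ?b, p + ?b + ?c)"
    have P: "?P \<in> cuts n" using less.prems(4,5) p(1) len by (auto simp: cuts_def)
    have "cyc_reduced (wicks B C (winv A))" using rot' assms(3) by (metis cyc_reduced_rotate)
    then have "(B, C, winv A) \<in> wicks_triples r (arc_len n ?P 0) (arc_len n ?P 1) (arc_len n ?P 2)"
      using sub len p(1) by (auto simp: wicks_triples_def arc_len_def)
    then have "w \<in> wicks_at r n ?P" using rot' unfolding wicks_at_def by auto
    then show ?thesis using P by blast
  next
    case False
    have "2 * n - (?a + s) < 2 * n - s"
      using less.prems(2,3) by (simp add: diff_less_mono2)
    then show ?thesis
      using False less.hyps[of "?a + s" B C "winv A"] rot less.prems(3-5) by simp
  qed
qed

section \<open>Words with an empty arc\<close>

definition degenerate_words :: "nat \<Rightarrow> nat \<Rightarrow> letter list set" where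
  "degenerate_words r n = {w \<in> comm_words r (2 * n). \<exists>s A B. rotate s w = wicks A B []}"

lemma comm_words_subset:
  assumes "0 < n"
  shows "comm_words r (2 * n) \<subseteq> (\<Union>P\<in>cuts n. wicks_at r n P) \<union> degenerate_words r n"
proof
  fix w assume w: "w \<in> comm_words r (2 * n)"
  note word = comm_words_word[OF w]
  obtain s A B C where s: "rotate s w = wicks A B C" using comm_words_wicks[OF w] by blast
  have s': "rotate (s mod (2 * n)) w = wicks A B C" "s mod (2 * n) < 2 * n"
    using s word assms by (metis rotate_conv_mod, simp)
  show "w \<in> (\<Union>P\<in>cuts n. wicks_at r n P) \<union> degenerate_words r n"
  proof (cases "A = [] \<or> B = [] \<or> C = []")
    case True
    then have "\<exists>A' B'. wicks A B C = wicks A' B' []" using wicks_empty by metis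
    then show ?thesis using w s unfolding degenerate_words_def by auto
  next
    case False
    then show ?thesis using wicks_position[OF _ _ _ s'] word by auto
  qed
qed

text \<open>There are \<open>2 * n\<close> rotations and \<open>n + 1\<close> lengths of
  \<open>A\<close>; given the length, the first half \<open>A @ B\<close> determines the
  word.\<close>

lemma card_degenerate_words:
  assumes "0 < r" "0 < n"
  shows "card (degenerate_words r n) \<le> 2 * n * (n + 1) * (2 * r * (2 * r - 1) ^ n)"
proof -
  define V where "V = (\<lambda>a. {v. reduced v \<and> length v = 2 * n \<and> set v \<subseteq> letters r
    \<and> (\<exists>A B. v = wicks A B [] \<and> length A = a)})"
  have finV: "finite (V a)" for a
    by (rule finite_subset[OF _ finite_words[of "2 * n" r]]) (auto simp: V_def)
  have cardV: "card (V a) \<le> 2 * r * (2 * r - 1) ^ n" for a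
  proof -
    have "card (V a) \<le> 2 * r * (2 * r - 1) ^ card {..<n}"
    proof (rule card_reduced_determined[of _ "2 * n"])
      fix v w i assume vw: "v \<in> V a" "w \<in> V a" and i: "i < 2 * n" "i \<notin> {..<n}" "take i v = take i w"
      obtain A B where AB: "v = wicks A B []" "length A = a" "length v = 2 * n" using vw(1) by (auto simp: V_def)
      obtain A' B' where AB': "w = wicks A' B' []" "length A' = a" "length w = 2 * n" using vw(2) by (auto simp: V_def)
      have l: "length (A @ B) = n" "length (A' @ B') = n" using AB AB' by auto
      have "take n v = take n w" using i(2,3) by (metis lessThan_iff min.absorb1 not_less take_take)
      moreover have "v = (A @ B) @ winv A @ winv B" "w = (A' @ B') @ winv A' @ winv B'"
        using AB AB' by (auto simp: wicks_def)
      ultimately have "A @ B = A' @ B'" using l by (metis append_eq_conv_conj)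
      then have "A = A'" "B = B'" using AB AB' by auto
      then show "v ! i = w ! i" using AB AB' by simp
    qed (use assms in \<open>auto simp: V_def\<close>)
    then show ?thesis by simp
  qed
  have "degenerate_words r n \<subseteq> (\<Union>s\<in>{..<2 * n}. \<Union>a\<in>{..n}. rotate s ` V a)"
  proof
    fix w assume "w \<in> degenerate_words r n"
    then obtain s A B where w: "w \<in> comm_words r (2 * n)" "rotate s w = wicks A B []"
      by (auto simp: degenerate_words_def)
    note word = comm_words_word[OF w(1)]
    have "wicks A B [] \<in> V (length A)"
      using comm_words_word[OF comm_words_rotate[OF w(1), of s]] by (auto simp: V_def w(2))
    moreover have "length A \<le> n" using arg_cong[OF w(2), of length] word by simp
    \<comment> \<open>The outer \<open>mod\<close> keeps the index below \<open>2 * n\<close> when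
      \<open>s\<close> is a multiple of \<open>2 * n\<close>.\<close>
    moreover have "w = rotate ((2 * n - s mod (2 * n)) mod (2 * n)) (wicks A B [])"
    proof -
      have "rotate (2 * n - s mod (2 * n)) (rotate (s mod (2 * n)) w) = w"
        using rotate_inverse[of w "2 * n" "s mod (2 * n)"] word assms(2) by simp
      moreover have "rotate (s mod (2 * n)) w = wicks A B []" using w(2) word by (metis rotate_conv_mod)
      moreover have "length (wicks A B []) = 2 * n" using arg_cong[OF w(2), of length] word by simp
      ultimately show ?thesis by (metis rotate_conv_mod)
    qed
    ultimately show "w \<in> (\<Union>s\<in>{..<2 * n}. \<Union>a\<in>{..n}. rotate s ` V a)"
      using assms(2) by (intro UN_I[of "(2 * n - s mod (2 * n)) mod (2 * n)"] UN_I[of "length A"]) auto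
  qed
  then have "card (degenerate_words r n) \<le> card (\<Union>s\<in>{..<2 * n}. \<Union>a\<in>{..n}. rotate s ` V a)"
    using finV by (intro card_mono) auto
  also have "\<dots> \<le> (\<Sum>s\<in>{..<2 * n}. card (\<Union>a\<in>{..n}. rotate s ` V a))" by (intro card_UN_le) auto
  also have "\<dots> \<le> (\<Sum>s\<in>{..<2 * n}. \<Sum>a\<in>{..n}. card (rotate s ` V a))"
    by (intro sum_mono card_UN_le) auto
  also have "\<dots> \<le> (\<Sum>s\<in>{..<2 * n}. \<Sum>a\<in>{..n}. 2 * r * (2 * r - 1) ^ n)"
    by (intro sum_mono order.trans[OF card_image_le[OF finV] cardV])
  also have "\<dots> = 2 * n * (n + 1) * (2 * r * (2 * r - 1) ^ n)" by (simp add: algebra_simps)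
  finally show ?thesis .
qed

section \<open>From words to conjugacy classes\<close>

definition periodic_words :: "nat \<Rightarrow> nat \<Rightarrow> letter list set" where
  "periodic_words r n = {w \<in> comm_words r (2 * n). \<exists>d\<in>{1..n}. rotate d w = w}"

text \<open>For each shift \<open>d\<close> from 1 to \<open>n\<close>, a letter in the second half
  repeats the one \<open>d\<close> places earlier.\<close>

lemma card_periodic_words:
  assumes "0 < r" "0 < n"
  shows "card (periodic_words r n) \<le> n * (2 * r * (2 * r - 1) ^ n)"
proof -
  define V where "V = (\<lambda>d. {w \<in> comm_words r (2 * n). rotate d w = w})"
  have cardV: "card (V d) \<le> 2 * r * (2 * r - 1) ^ n" if d: "d \<in> {1..n}" for d
  proof -
    have shift: "w ! (i - d) = w ! i" if "w \<in> V d" "n \<le> i" "i < 2 * n" for w i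
    proof -
      have "length w = 2 * n" "rotate d w = w" using that(1) comm_words_word by (auto simp: V_def)
      then show ?thesis using nth_rotate[of "i - d" w d] that(2,3) d by simp
    qed
    have "card (V d) \<le> 2 * r * (2 * r - 1) ^ card {..<n}"
    proof (rule card_reduced_determined[of _ "2 * n"])
      fix v w i assume vw: "v \<in> V d" "w \<in> V d" and i: "i < 2 * n" "i \<notin> {..<n}" "take i v = take i w"
      have "v ! (i - d) = w ! (i - d)" using i d by (metis atLeastAtMost_iff diff_less le_trans
            less_le_trans not_le lessThan_iff nth_take zero_less_one linorder_not_less)
      then show "v ! i = w ! i" using shift vw i by simp
    qed (use assms comm_words_word in \<open>auto simp: V_def\<close>)
    then show ?thesis by simp
  qed
  have "periodic_words r n = (\<Union>d\<in>{1..n}. V d)" by (auto simp: periodic_words_def V_def)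
  then have "card (periodic_words r n) \<le> (\<Sum>d\<in>{1..n}. card (V d))"
    by (simp only:) (intro card_UN_le; simp)
  also have "\<dots> \<le> (\<Sum>d\<in>{1..n}. 2 * r * (2 * r - 1) ^ n)" by (intro sum_mono cardV)
  finally show ?thesis by simp
qed

section \<open>Conjugacy classes as orbits under rotation\<close>

abbreviation num_classes :: "nat \<Rightarrow> nat \<Rightarrow> nat" where
  "num_classes r k \<equiv> card (commutator_classes (free_group r) (free_sym_gens r) k)"

lemma conj_class_comm_words_iff:
  assumes "w \<in> comm_words r k" "v \<in> comm_words r k"
  shows "conj_class (free_group r) v = conj_class (free_group r) w \<longleftrightarrow> (\<exists>m. v = rotate m w)"
  using assms comm_words_carrier comm_words_word by (intro conj_class_eq_iff_rotate) blast+

lemma fibre_eq: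
  assumes "w \<in> comm_words r k" "0 < k"
  shows "{v \<in> comm_words r k. conj_class (free_group r) v = conj_class (free_group r) w}
    = (\<lambda>m. rotate m w) ` {..<k}"
proof (intro equalityI subsetI)
  fix v assume "v \<in> {v \<in> comm_words r k. conj_class (free_group r) v = conj_class (free_group r) w}"
  then obtain m where "v = rotate m w" using conj_class_comm_words_iff[OF assms(1)] by auto
  then have "v = rotate (m mod k) w" using comm_words_word[OF assms(1)] by (metis rotate_conv_mod)
  then show "v \<in> (\<lambda>m. rotate m w) ` {..<k}" using assms(2) by simp
next
  fix v assume "v \<in> (\<lambda>m. rotate m w) ` {..<k}"
  then obtain m where v: "v = rotate m w" by blast
  then have "v \<in> comm_words r k" using comm_words_rotate[OF assms(1)] by simp
  then show "v \<in> {v \<in> comm_words r k. conj_class (free_group r) v = conj_class (free_group r) w}"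
    using conj_class_comm_words_iff[OF assms(1), of v] v by blast
qed

lemma card_comm_words_le:
  assumes "0 < k" shows "card (comm_words r k) \<le> k * num_classes r k"
proof -
  let ?c = "conj_class (free_group r)"
  have "card (comm_words r k) = (\<Sum>x\<in>?c ` comm_words r k. card {v \<in> comm_words r k. ?c v = x})"
    using sum.image_gen[of "comm_words r k" "\<lambda>_. 1::nat" ?c] by simp
  also have "\<dots> \<le> (\<Sum>x\<in>?c ` comm_words r k. k)"
  proof (rule sum_mono)
    fix x assume "x \<in> ?c ` comm_words r k"
    then obtain w where "w \<in> comm_words r k" "x = ?c w" by blast
    then show "card {v \<in> comm_words r k. ?c v = x} \<le> k"
      using fibre_eq[of w r k] assms card_image_le[of "{..<k}" "\<lambda>m. rotate m w"] by simp
  qed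
  finally show ?thesis by (simp add: commutator_classes_eq mult.commute)
qed

text \<open>Shifts up to \<open>n\<close> suffice, since a shift \<open>d\<close> above
  \<open>n\<close> that fixes the word yields the fixing shift \<open>2 * n - d\<close>.\<close>

lemma aperiodic_rotations:
  assumes "length w = 2 * n" "\<And>d. d \<in> {1..n} \<Longrightarrow> rotate d w \<noteq> w"
  shows "inj_on (\<lambda>m. rotate m w) {..<2 * n}"
proof (rule linorder_inj_onI)
  fix i j assume ij: "i < j" "i \<in> {..<2 * n}" "j \<in> {..<2 * n}"
  show "rotate i w \<noteq> rotate j w"
  proof
    assume "rotate i w = rotate j w"
    then have "rotate i w = rotate i (rotate (j - i) w)" using ij by (simp add: rotate_rotate)
    then have eq: "rotate (j - i) w = w" using rotate_inj by metis
    show False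
    proof (cases "j - i \<le> n")
      case True then show False using eq assms(2)[of "j - i"] ij by simp
    next
      case False
      have d: "j - i < 2 * n" using ij by auto
      then have "rotate (2 * n - (j - i)) w = w"
        using rotate_inverse[OF assms(1), of "j - i"] eq by simp
      moreover have "2 * n - (j - i) \<in> {1..n}" using d False unfolding atLeastAtMost_iff by linarith
      ultimately show False using assms(2) by blast
    qed
  qed
qed auto

text \<open>A class with an aperiodic representative accounts for exactly \<open>2 * n\<close>
  words; the other classes are at most as many as the periodic words.\<close>

lemma num_classes_le:
  assumes "0 < n"
  shows "2 * n * num_classes r (2 * n)
    \<le> card (comm_words r (2 * n)) + 2 * n * card (periodic_words r n)"
proof -
  let ?c = "conj_class (free_group r)"
  let ?M = "comm_words r (2 * n)" and ?Q = "periodic_words r n"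
  have Q: "?Q \<subseteq> ?M" "finite ?Q"
    by (auto simp: periodic_words_def)
  have "?c ` ?M = ?c ` (?M - ?Q) \<union> ?c ` ?Q" using Q(1) by auto
  then have "card (?c ` ?M) \<le> card (?c ` (?M - ?Q)) + card (?c ` ?Q)" by (simp add: card_Un_le)
  then have 1: "card (?c ` ?M) \<le> card (?c ` (?M - ?Q)) + card ?Q"
    using card_image_le[OF Q(2), of ?c] by simp
  have "2 * n * card (?c ` (?M - ?Q)) = (\<Sum>x\<in>?c ` (?M - ?Q). 2 * n)" by simp
  also have "\<dots> = (\<Sum>x\<in>?c ` (?M - ?Q). card {v \<in> ?M. ?c v = x})"
  proof (rule sum.cong)
    fix x assume "x \<in> ?c ` (?M - ?Q)"
    then obtain w where w: "w \<in> ?M" "w \<notin> ?Q" "x = ?c w" by blast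
    have "inj_on (\<lambda>m. rotate m w) {..<2 * n}"
      using w comm_words_word[OF w(1)] by (intro aperiodic_rotations) (auto simp: periodic_words_def)
    then show "2 * n = card {v \<in> ?M. ?c v = x}"
      using fibre_eq[OF w(1)] assms by (simp add: w(3) card_image)
  qed simp
  also have "\<dots> \<le> (\<Sum>x\<in>?c ` ?M. card {v \<in> ?M. ?c v = x})" by (intro sum_mono2) auto
  also have "\<dots> = card ?M" using sum.image_gen[of ?M "\<lambda>_. 1::nat" ?c] by simp
  finally have 2: "2 * n * card (?c ` (?M - ?Q)) \<le> card ?M" .
  have "2 * n * card (?c ` ?M) \<le> 2 * n * (card (?c ` (?M - ?Q)) + card ?Q)"
    using 1 by (rule mult_left_mono) simp
  then show ?thesis using 2 by (simp add: commutator_classes_eq distrib_left)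
qed

section \<open>Computable functions\<close>

lemma computable_const: "computable (\<lambda>_. c)"
proof (induction c)
  case 0
  show ?case unfolding computable_def by (intro exI[of _ "\<lambda>_. 0"]) (simp add: recursive_fn.zero)
next
  case (Suc c)
  then obtain f where f: "recursive_fn 1 f" "\<And>n. c = f [n]" by (auto simp: computable_def)
  have "recursive_fn 1 (\<lambda>xs. Suc (hd (map (\<lambda>g. g xs) [f])))"
    using recursive_fn.comp[of "[f]" "\<lambda>xs. Suc (hd xs)" 1] f(1) recursive_fn.succ by simp
  then show ?case unfolding computable_def using f(2) by (auto intro!: exI)
qed

lemma computable_id: "computable (\<lambda>n. n)"
  unfolding computable_def using recursive_fn.proj[of 0 1] by (intro exI) auto

text \<open>The witness keeps the literal shape produced by \<open>comp\<close> and
  \<open>prim_rec\<close>; its values are computed only afterwards.\<close>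

lemma recursive_fn_add: "\<exists>f. recursive_fn 2 f \<and> (\<forall>m n. f [m, n] = m + n)"
proof -
  \<comment> \<open>The step function receives the counter, the previous value and the parameter, so
    \<open>xs ! 1\<close> is the previous value.\<close>
  have succ: "recursive_fn 3 (\<lambda>xs. Suc (hd (map (\<lambda>g. g xs) [\<lambda>xs. xs ! 1])))"
    using recursive_fn.comp[of "[\<lambda>xs. xs ! 1]" "\<lambda>xs. Suc (hd xs)" 3] recursive_fn.succ
      recursive_fn.proj[of 1 3] by simp
  have "recursive_fn 2 (\<lambda>xs. rec_nat (tl xs ! 0)
      (\<lambda>m v. Suc (hd (map (\<lambda>g. g (m # v # tl xs)) [\<lambda>xs. xs ! 1]))) (hd xs))"
    using recursive_fn.prim_rec[OF recursive_fn.proj[of 0 1], of "\<lambda>xs. Suc (hd (map (\<lambda>g. g xs) [\<lambda>xs. xs ! 1]))"] succ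
    by (simp add: numeral_2_eq_2 numeral_3_eq_3)
  moreover have "rec_nat n (\<lambda>m v. Suc v) m = m + n" for m n by (induction m) auto
  ultimately show ?thesis by (intro exI conjI) (assumption, simp)
qed

lemma recursive_fn_mult: "\<exists>f. recursive_fn 2 f \<and> (\<forall>m n. f [m, n] = m * n)"
proof -
  obtain a where a: "recursive_fn 2 a" "\<And>m n. a [m, n] = m + n" using recursive_fn_add by blast
  have add: "recursive_fn 3 (\<lambda>xs. a (map (\<lambda>g. g xs) [\<lambda>xs. xs ! 1, \<lambda>xs. xs ! 2]))"
    using recursive_fn.comp[of "[\<lambda>xs. xs ! 1, \<lambda>xs. xs ! 2]" a 3] a(1)
      recursive_fn.proj[of 1 3] recursive_fn.proj[of 2 3] by (simp add: numeral_2_eq_2)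
  have "recursive_fn 2 (\<lambda>xs. rec_nat 0
      (\<lambda>m v. a (map (\<lambda>g. g (m # v # tl xs)) [\<lambda>xs. xs ! 1, \<lambda>xs. xs ! 2])) (hd xs))"
    using recursive_fn.prim_rec[OF recursive_fn.zero[of 1],
        of "\<lambda>xs. a (map (\<lambda>g. g xs) [\<lambda>xs. xs ! 1, \<lambda>xs. xs ! 2])"] add
    by (simp add: numeral_2_eq_2 numeral_3_eq_3)
  moreover have "rec_nat 0 (\<lambda>m v. v + n) m = m * n" for m n by (induction m) auto
  ultimately show ?thesis by (intro exI conjI) (assumption, simp add: a(2))
qed

lemma computable_mult:
  assumes "computable f" "computable g" shows "computable (\<lambda>n. f n * g n)"
proof -
  obtain f' g' where fg: "recursive_fn 1 f'" "\<And>n. f n = f' [n]" "recursive_fn 1 g'" "\<And>n. g n = g' [n]"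
    using assms by (auto simp: computable_def)
  obtain m where m: "recursive_fn 2 m" "\<And>x y. m [x, y] = x * y" using recursive_fn_mult by blast
  have "recursive_fn 1 (\<lambda>xs. m (map (\<lambda>h. h xs) [f', g']))"
    using recursive_fn.comp[of "[f', g']" m 1] m(1) fg(1,3) by (simp add: numeral_2_eq_2)
  then show ?thesis
    unfolding computable_def by (intro exI conjI) (assumption, simp add: fg(2,4) m(2))
qed

section \<open>The asymptotic count\<close>

lemma wicks_density_ge_1:
  assumes "1 < r" shows "1 \<le> wicks_density r"
proof -
  \<comment> \<open>This is the factorization of \<open>(2 r - 2)^2 - 2 r\<close>.\<close>
  have "0 \<le> 2 * (2 * real r - 1) * (real r - 2)" using assms by (intro mult_nonneg_nonneg) auto
  then show ?thesis using assms
    by (simp add: wicks_density_def le_divide_eq power2_eq_square algebra_simps)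
qed

text \<open>The relative error of one system decays exponentially in each arc length, so its sum
  over about \<open>n^3 / 6\<close> systems has only order \<open>n^2\<close>: at most
  \<open>2 * n^2\<close> for each of the three arcs.\<close>

lemma sum_card_wicks_at:
  assumes r: "1 < r"
  defines "q \<equiv> 2 * real r - 1"
  shows "\<bar>(\<Sum>P\<in>cuts n. real (card (wicks_at r n P))) - real (card (cuts n)) * (wicks_density r * q ^ (n - 1))\<bar>
    \<le> wicks_density r * q ^ (n - 1) * ((2 * real r)\<^sup>2 * q\<^sup>2) * (6 * (real n)\<^sup>2)"
proof -
  let ?M = "wicks_density r * q ^ (n - 1)"
  let ?F = "?M * ((2 * real r)\<^sup>2 * q\<^sup>2)"
  let ?s = "\<lambda>k. \<Sum>P\<in>cuts n. (1 / q) ^ arc_len n P k"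
  have q: "3 \<le> q" using r by (simp add: q_def)
  have F: "0 \<le> ?F" using q by (simp add: wicks_density_def)
  have approx: "\<bar>real (card (wicks_at r n P)) - ?M\<bar>
      \<le> ?F * ((1 / q) ^ arc_len n P 0 + (1 / q) ^ arc_len n P 1 + (1 / q) ^ arc_len n P 2)"
    if P: "P \<in> cuts n" for P
    using card_wicks_triples_approx[OF arc_len_pos[OF P, of 0] arc_len_pos[OF P, of 1] arc_len_pos[OF P, of 2], of r] r
    unfolding arc_len_sum[OF P] card_wicks_at[OF P] q_def by simp
  have "(\<Sum>P\<in>cuts n. real (card (wicks_at r n P))) - real (card (cuts n)) * ?M
      = (\<Sum>P\<in>cuts n. real (card (wicks_at r n P)) - ?M)" by (simp add: sum_subtractf)
  also have "\<bar>\<dots>\<bar> \<le> (\<Sum>P\<in>cuts n. \<bar>real (card (wicks_at r n P)) - ?M\<bar>)" by (rule sum_abs)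
  also have "\<dots> \<le> (\<Sum>P\<in>cuts n. ?F * ((1 / q) ^ arc_len n P 0 + (1 / q) ^ arc_len n P 1 + (1 / q) ^ arc_len n P 2))"
    by (intro sum_mono approx)
  also have "\<dots> = ?F * (?s 0 + ?s 1 + ?s 2)" by (simp only: sum.distrib flip: sum_distrib_left)
  also have "\<dots> \<le> ?F * (6 * (real n)\<^sup>2)"
  proof (rule mult_left_mono[OF _ F])
    have "?s k \<le> 2 * (real n)\<^sup>2" for k using q by (intro sum_arc_len_power) (auto simp: field_simps)
    from this[of 0] this[of 1] this[of 2] show "?s 0 + ?s 1 + ?s 2 \<le> 6 * (real n)\<^sup>2" by linarith
  qed
  finally show ?thesis .
qed

section \<open>Overlaps and the number of commutator words\<close>

lemma disagree_le: "disagree n P P' \<le> n"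
  using card_mono[of "{..<n}" "{i. i < n \<and> sum_at n P i \<noteq> sum_at n P' i}"]
  by (auto simp: disagree_def)

lemma sum_card_wicks_at_Int:
  "\<exists>K. 0 \<le> K \<and> (\<forall>n r. 1 < r \<longrightarrow>
    (\<Sum>(P, P')\<in>cut_pairs n. real (card (wicks_at r n P \<inter> wicks_at r n P')))
      \<le> K * (2 * real r * (2 * real r - 1) ^ n * (real n)\<^sup>2))"
proof -
  obtain K where K: "0 \<le> K"
    "\<And>n. (\<Sum>(P, P')\<in>cut_pairs n. (1 / 3) ^ (disagree n P P' div 3)) \<le> K * (real n)\<^sup>2"
    using sum_cut_pairs by blast
  have "(\<Sum>(P, P')\<in>cut_pairs n. real (card (wicks_at r n P \<inter> wicks_at r n P')))
      \<le> K * (2 * real r * (2 * real r - 1) ^ n * (real n)\<^sup>2)" if r: "1 < r" for n r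
  proof -
    let ?q = "2 * real r - 1"
    have q: "3 \<le> ?q" using r by simp
    have "real (card (wicks_at r n P \<inter> wicks_at r n P')) \<le> 2 * real r * ?q ^ n * (1 / 3) ^ (disagree n P P' div 3)"
      if "(P, P') \<in> cut_pairs n" for P P'
    proof -
      let ?d = "disagree n P P' div 3"
      have d: "?d \<le> n" using disagree_le[of n P P'] by linarith
      have "real (card (wicks_at r n P \<inter> wicks_at r n P')) \<le> real (2 * r * (2 * r - 1) ^ (n - ?d))"
        using that r unfolding of_nat_le_iff by (intro card_wicks_at_Int) (auto simp: cut_pairs_def)
      also have "\<dots> = 2 * real r * ?q ^ (n - ?d)" using r by (simp add: of_nat_diff)
      also have "?q ^ (n - ?d) = ?q ^ n * (1 / ?q) ^ ?d"
        using q d by (simp add: power_diff power_divide)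
      also have "2 * real r * (?q ^ n * (1 / ?q) ^ ?d) \<le> 2 * real r * (?q ^ n * (1 / 3) ^ ?d)"
        using q by (intro mult_left_mono power_mono) (auto simp: field_simps)
      finally show ?thesis by (simp add: mult_ac)
    qed
    then have "(\<Sum>(P, P')\<in>cut_pairs n. real (card (wicks_at r n P \<inter> wicks_at r n P')))
        \<le> (\<Sum>(P, P')\<in>cut_pairs n. 2 * real r * ?q ^ n * (1 / 3) ^ (disagree n P P' div 3))"
      by (intro sum_mono) auto
    also have "\<dots> = 2 * real r * ?q ^ n * (\<Sum>(P, P')\<in>cut_pairs n. (1 / 3) ^ (disagree n P P' div 3))"
      by (simp add: sum_distrib_left case_prod_unfold)
    also have "\<dots> \<le> 2 * real r * ?q ^ n * (K * (real n)\<^sup>2)"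
      using K(2) q by (intro mult_left_mono) auto
    finally show ?thesis by (simp add: mult_ac)
  qed
  then show ?thesis using K(1) by blast
qed

lemma card_comm_words_upper:
  assumes "1 < r" "0 < n"
  shows "real (card (comm_words r (2 * n))) \<le> (\<Sum>P\<in>cuts n. real (card (wicks_at r n P)))
    + 8 * real r * (2 * real r - 1) ^ n * (real n)\<^sup>2"
proof -
  have finw: "finite (wicks_at r n P)" if "P \<in> cuts n" for P
    using finite_subset[OF wicks_at_subset_comm_words[OF that]] by simp
  have find: "finite (degenerate_words r n)" by (simp add: degenerate_words_def)
  have "card (comm_words r (2 * n)) \<le> card ((\<Union>P\<in>cuts n. wicks_at r n P) \<union> degenerate_words r n)"
    using finw find by (intro card_mono comm_words_subset assms) auto
  also have "\<dots> \<le> card (\<Union>P\<in>cuts n. wicks_at r n P) + card (degenerate_words r n)" by (rule card_Un_le)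
  also have "\<dots> \<le> (\<Sum>P\<in>cuts n. card (wicks_at r n P)) + 2 * n * (n + 1) * (2 * r * (2 * r - 1) ^ n)"
    using assms by (intro add_mono card_UN_le card_degenerate_words) auto
  also have "\<dots> \<le> (\<Sum>P\<in>cuts n. card (wicks_at r n P)) + 8 * r * (2 * r - 1) ^ n * n\<^sup>2"
  proof -
    have "2 * n * (n + 1) \<le> 4 * n\<^sup>2" using assms(2) by (simp add: power2_eq_square)
    then have "2 * n * (n + 1) * (2 * r * (2 * r - 1) ^ n) \<le> 4 * n\<^sup>2 * (2 * r * (2 * r - 1) ^ n)"
      by (rule mult_right_mono) simp
    then show ?thesis by (simp add: mult_ac)
  qed
  finally have "real (card (comm_words r (2 * n)))
      \<le> real ((\<Sum>P\<in>cuts n. card (wicks_at r n P)) + 8 * r * (2 * r - 1) ^ n * n\<^sup>2)"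
    by (simp only: of_nat_le_iff)
  also have "\<dots> = (\<Sum>P\<in>cuts n. real (card (wicks_at r n P))) + 8 * real r * (2 * real r - 1) ^ n * (real n)\<^sup>2"
    using assms(1) by (simp add: of_nat_diff)
  finally show ?thesis .
qed

lemma card_comm_words_lower:
  "(\<Sum>P\<in>cuts n. real (card (wicks_at r n P))) \<le> real (card (comm_words r (2 * n)))
    + (\<Sum>(P, P')\<in>cut_pairs n. real (card (wicks_at r n P \<inter> wicks_at r n P')))"
proof -
  have finw: "finite (wicks_at r n P)" if "P \<in> cuts n" for P
    using finite_subset[OF wicks_at_subset_comm_words[OF that]] by simp
  have "card (\<Union>P\<in>cuts n. wicks_at r n P) \<le> card (comm_words r (2 * n))"
    by (intro card_mono UN_least wicks_at_subset_comm_words) auto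
  then show ?thesis
    using bonferroni[of "cuts n" "wicks_at r n"] finw unfolding cut_pairs_def by simp
qed

text \<open>\<open>L\<close> is chosen before \<open>r\<close> and \<open>n\<close>; all dependence
  on the rank is in \<open>r ^ 4\<close>, which comes from the error factor
  \<open>(2 r)^2 q^2\<close> with \<open>q\<close> at most \<open>2 r\<close>.\<close>

lemma num_classes_asymptotics:
  "\<exists>L::nat. \<forall>r n. 1 < r \<longrightarrow> 0 < n \<longrightarrow>
    \<bar>48 * real (num_classes r (2 * n)) - wicks_density r * (2 * real r - 1) ^ (n - 1) * (2 * real n)\<^sup>2\<bar>
      \<le> wicks_density r * (2 * real r - 1) ^ (n - 1) * (real (L * r ^ 4) * (2 * real n))"
proof -
  obtain K where K: "0 \<le> K" "\<And>n r. 1 < r \<Longrightarrow>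
    (\<Sum>(P, P')\<in>cut_pairs n. real (card (wicks_at r n P \<inter> wicks_at r n P')))
      \<le> K * (2 * real r * (2 * real r - 1) ^ n * (real n)\<^sup>2)"
    using sum_card_wicks_at_Int by blast
  \<comment> \<open>\<open>2 * 1446 = 24 * 120 + 12\<close> and \<open>2 * 48 = 24 * 4\<close>: half
    the total error in units of \<open>?Z\<close>, since the final bound contains
    \<open>2 * ?n\<close>.\<close>
  obtain L :: nat where L: "1446 + 48 * K \<le> real L" using real_arch_simple by blast
  have "\<bar>48 * real (num_classes r (2 * n)) - wicks_density r * (2 * real r - 1) ^ (n - 1) * (2 * real n)\<^sup>2\<bar>
      \<le> wicks_density r * (2 * real r - 1) ^ (n - 1) * (real (L * r ^ 4) * (2 * real n))"
    if r: "1 < r" and n: "0 < n" for r n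
  proof -
    define q where "q = 2 * real r - 1"
    define Q where "Q = q ^ (n - 1)"
    define M where "M = wicks_density r * Q"
    define N where "N = real (num_classes r (2 * n))"
    define S where "S = (\<Sum>P\<in>cuts n. real (card (wicks_at r n P)))"
    define W where "W = real (card (comm_words r (2 * n)))"
    let ?n = "real n" and ?r = "real r"
    have q: "3 \<le> q" "q \<le> 2 * ?r" using r by (simp_all add: q_def)
    have Q: "0 < Q" "q ^ n = q * Q" using q n by (simp_all add: Q_def flip: power_Suc)
    have M: "Q \<le> M" "0 < M" using wicks_density_ge_1[OF r] Q(1) by (simp_all add: M_def)
    have S: "\<bar>S - real (card (cuts n)) * M\<bar> \<le> M * ((2 * ?r)\<^sup>2 * q\<^sup>2) * (6 * ?n\<^sup>2)"
      using sum_card_wicks_at[OF r, of n] by (simp add: S_def M_def Q_def q_def)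
    have up: "W \<le> S + 8 * ?r * (q * Q) * ?n\<^sup>2"
      using card_comm_words_upper[OF r n] by (simp add: W_def S_def q_def[symmetric] Q(2))
    have low: "S \<le> W + K * (2 * ?r * (q * Q) * ?n\<^sup>2)"
      using card_comm_words_lower[of r n] K(2)[OF r, of n] by (simp add: W_def S_def q_def[symmetric] Q(2))
    have N_low: "W \<le> 2 * ?n * N"
    proof -
      have "W \<le> real (2 * n * num_classes r (2 * n))"
        using card_comm_words_le[of "2 * n" r] n unfolding W_def of_nat_le_iff by simp
      then show ?thesis by (simp add: N_def)
    qed
    have N_up: "2 * ?n * N \<le> W + 4 * ?r * (q * Q) * ?n\<^sup>2"
    proof -
      have "2 * n * num_classes r (2 * n)
          \<le> card (comm_words r (2 * n)) + 2 * n * (n * (2 * r * (2 * r - 1) ^ n))"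
        using num_classes_le[OF n, of r] card_periodic_words[of r n] r n
        by (meson add_le_cancel_left mult_le_mono2 order.trans less_trans zero_less_one)
      then have "real (2 * n * num_classes r (2 * n))
          \<le> real (card (comm_words r (2 * n)) + 2 * n * (n * (2 * r * (2 * r - 1) ^ n)))"
        by (simp only: of_nat_le_iff)
      also have "\<dots> = W + 4 * ?r * (q ^ n) * ?n\<^sup>2"
        using r by (simp add: W_def q_def of_nat_diff power2_eq_square)
      finally show ?thesis by (simp add: N_def Q(2))
    qed
    \<comment> \<open>Errors of size \<open>q ^ n\<close> become multiples of \<open>M\<close>
      because the density is at least 1.\<close>
    have QM: "?r * (q * Q) * ?n\<^sup>2 \<le> 2 * ?r\<^sup>2 * M * ?n\<^sup>2"
    proof -
      have "?r * (q * Q) \<le> ?r * (2 * ?r * M)" using q M Q by (intro mult_mono) auto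
      then show ?thesis by (intro mult_right_mono) (simp_all add: power2_eq_square)
    qed
    have r1: "1 \<le> ?r" using r by simp
    have r24: "?r\<^sup>2 \<le> ?r ^ 4" "1 \<le> ?r ^ 4" using r1 by (auto intro: power_increasing one_le_power)
    have "(2 * ?r)\<^sup>2 * q\<^sup>2 \<le> (2 * ?r)\<^sup>2 * (2 * ?r)\<^sup>2" using q by (intro mult_left_mono power_mono) auto
    also have "\<dots> = 16 * ?r ^ 4" by (simp add: power2_eq_square power4_eq_xxxx)
    finally have "M * ((2 * ?r)\<^sup>2 * q\<^sup>2) * (6 * ?n\<^sup>2) \<le> M * (16 * ?r ^ 4) * (6 * ?n\<^sup>2)"
      using M by (intro mult_right_mono mult_left_mono) auto
    also have "\<dots> = 96 * (?r ^ 4 * M * ?n\<^sup>2)" by simp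
    finally have S': "\<bar>S - real (card (cuts n)) * M\<bar> \<le> 96 * (?r ^ 4 * M * ?n\<^sup>2)"
      using S by (rule order.trans[rotated])
    let ?Z = "?r ^ 4 * M * ?n\<^sup>2"
    have QM': "?r * (q * Q) * ?n\<^sup>2 \<le> 2 * ?Z"
    proof -
      have "2 * ?r\<^sup>2 * M * ?n\<^sup>2 \<le> 2 * ?Z" using r24 M by (simp add: mult_right_mono)
      then show ?thesis using QM by simp
    qed
    have KQ: "K * (2 * ?r * (q * Q) * ?n\<^sup>2) \<le> 4 * (K * ?Z)"
      using mult_left_mono[OF QM' K(1)] by (simp add: mult_ac)
    \<comment> \<open>96 comes from the sum over systems and 24 from the degenerate and periodic
      words, \<open>8 + 4\<close> times \<open>X\<close>; the overlaps enter only the lower bound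
      and give the term with \<open>K\<close>.\<close>
    have main: "\<bar>2 * ?n * N - real (card (cuts n)) * M\<bar> \<le> 120 * ?Z + 4 * (K * ?Z)"
    proof -
      define X where "X = ?r * (q * Q) * ?n\<^sup>2"
      have "W \<le> S + 8 * X" "2 * ?n * N \<le> W + 4 * X" "X \<le> 2 * ?Z"
        using up N_up QM' by (simp_all add: X_def mult_ac)
      moreover have "0 \<le> ?Z" using M(2) by simp
      moreover have "0 \<le> K * ?Z" using K(1) M(2) by simp
      ultimately show ?thesis
        using S' low KQ N_low unfolding abs_le_iff by linarith
    qed
    have cuts: "real (card (cuts n)) * M * 24 = ?n * (M * (4 * ?n\<^sup>2 - 12 * ?n + 8))"
    proof -
      have "24 * real (card (cuts n)) = ?n * (4 * ?n\<^sup>2 - 12 * ?n + 8)"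
        using card_cuts[of n] by (simp add: algebra_simps power2_eq_square)
      then have "(24 * real (card (cuts n))) * M = (?n * (4 * ?n\<^sup>2 - 12 * ?n + 8)) * M" by simp
      then show ?thesis by (simp only: mult_ac)
    qed
    \<comment> \<open>Multiplied by \<open>?n\<close>, the class count appears as
      \<open>2 * ?n * N\<close>, the quantity compared with the number of words;
      \<open>12 * ?n - 8\<close> collects the lower terms of
      \<open>24 * card (cuts n)\<close>.\<close>
    have "?n * \<bar>48 * N - M * (2 * ?n)\<^sup>2\<bar> = \<bar>?n * (48 * N - M * (2 * ?n)\<^sup>2)\<bar>"
      by (simp add: abs_mult)
    also have "\<dots> = \<bar>24 * (2 * ?n * N) - ?n * (M * (4 * ?n\<^sup>2))\<bar>"
      by (simp add: right_diff_distrib)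
    also have "\<dots> = \<bar>24 * (2 * ?n * N - real (card (cuts n)) * M) - ?n * M * (12 * ?n - 8)\<bar>"
      using cuts by (simp add: algebra_simps)
    also have "\<dots> \<le> 24 * (120 * ?Z + 4 * (K * ?Z)) + 12 * ?Z"
    proof -
      have "\<bar>?n * M * (12 * ?n - 8)\<bar> \<le> 12 * (1 * M * ?n\<^sup>2)"
        using n M by (simp add: abs_mult power2_eq_square)
      also have "\<dots> \<le> 12 * ?Z" using r24 M by (intro mult_left_mono mult_right_mono) auto
      finally have bound: "\<bar>?n * M * (12 * ?n - 8)\<bar> \<le> 12 * ?Z" .
      have "\<bar>24 * a - b\<bar> \<le> 24 * a' + b'" if "\<bar>a\<bar> \<le> a'" "\<bar>b\<bar> \<le> b'" for a b a' b' :: real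
        using that by linarith
      then show ?thesis using main bound by blast
    qed
    also have "\<dots> = (1446 + 48 * K) * (2 * ?Z)" by (simp add: algebra_simps)
    also have "\<dots> \<le> real L * (2 * ?Z)" using L M by (intro mult_right_mono) auto
    also have "\<dots> = ?n * (M * (real (L * r ^ 4) * (2 * ?n)))" by (simp add: power2_eq_square)
    finally have "\<bar>48 * N - M * (2 * ?n)\<^sup>2\<bar> \<le> M * (real (L * r ^ 4) * (2 * ?n))" using n by simp
    then show ?thesis by (simp add: M_def N_def Q_def q_def)
  qed
  then show ?thesis by blast
qed

theorem theorem1p2:
  shows "\<exists>C :: nat \<Rightarrow> nat. computable C \<and>
    (\<forall>r::nat. r > 1 \<longrightarrow>
      (\<exists>E :: nat \<Rightarrow> real.
        (\<forall>k::nat. even k \<longrightarrow>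
          finite (commutator_classes (free_group r) (free_sym_gens r) k) \<and>
          real (card (commutator_classes (free_group r) (free_sym_gens r) k)) =
            (2 * real r - 2)\<^sup>2 * (2 * real r - 1) powi (int (k div 2) - 1) / (96 * real r)
              * ((real k)\<^sup>2 + E k)) \<and>
        (\<forall>k::nat. even k \<and> k > 0 \<longrightarrow> \<bar>E k\<bar> \<le> real (C r) * real k)))"
proof -
  obtain L :: nat where L: "\<And>r n. 1 < r \<Longrightarrow> 0 < n \<Longrightarrow>
    \<bar>48 * real (num_classes r (2 * n)) - wicks_density r * (2 * real r - 1) ^ (n - 1) * (2 * real n)\<^sup>2\<bar>
      \<le> wicks_density r * (2 * real r - 1) ^ (n - 1) * (real (L * r ^ 4) * (2 * real n))"
    using num_classes_asymptotics by blast
  \<comment> \<open>\<open>L\<close> is only known to exist, but a constant function is computable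
    whatever its value.\<close>
  have comp: "computable (\<lambda>r. L * r ^ 4)"
    by (simp only: power4_eq_xxxx) (intro computable_mult computable_const computable_id)
  define c where "c = (\<lambda>r k. (2 * real r - 2)\<^sup>2 * (2 * real r - 1) powi (int (k div 2) - 1) / (96 * real r))"
  have c_pos: "0 < c r k" if "1 < r" for r k
    using that by (auto simp: c_def intro!: divide_pos_pos mult_pos_pos zero_less_power_int)
  have c_eq: "48 * c r (2 * n) = wicks_density r * (2 * real r - 1) ^ (n - 1)" if "1 < r" "0 < n" for r n
  proof -
    have "(2 * real r - 1) powi (int n - 1) = (2 * real r - 1) ^ (n - 1)"
    proof -
      have "int n - 1 = int (n - 1)" using that(2) by simp
      then show ?thesis by (simp only: power_int_of_nat)
    qed
    then show ?thesis by (simp add: c_def wicks_density_def)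
  qed
  have "\<exists>E. (\<forall>k. even k \<longrightarrow> finite (commutator_classes (free_group r) (free_sym_gens r) k)
        \<and> real (num_classes r k) = c r k * ((real k)\<^sup>2 + E k))
      \<and> (\<forall>k. even k \<and> k > 0 \<longrightarrow> \<bar>E k\<bar> \<le> real (L * r ^ 4) * real k)" if r: "1 < r" for r
  \<comment> \<open>\<open>E\<close> is solved from the required identity, possible because
    \<open>c r k\<close> is positive even for \<open>k = 0\<close>, where the exponent is
    \<open>-1\<close>; only the bound for positive \<open>k\<close> has content.\<close>
  proof (intro exI[of _ "\<lambda>k. real (num_classes r k) / c r k - (real k)\<^sup>2"] conjI allI impI)
    fix k show "finite (commutator_classes (free_group r) (free_sym_gens r) k)"
      by (simp add: commutator_classes_eq)
    show "real (num_classes r k) = c r k * ((real k)\<^sup>2 + (real (num_classes r k) / c r k - (real k)\<^sup>2))"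
      using c_pos[OF r, of k] by simp
  next
    fix k :: nat assume "even k \<and> k > 0"
    then obtain n where n: "k = 2 * n" "0 < n" by auto
    let ?c = "48 * c r k"
    have c: "0 < ?c" "?c = wicks_density r * (2 * real r - 1) ^ (n - 1)"
      using c_pos[OF r, of k] c_eq[OF r n(2)] n by simp_all
    have "?c * \<bar>real (num_classes r k) / c r k - (real k)\<^sup>2\<bar> = \<bar>48 * real (num_classes r k) - ?c * (real k)\<^sup>2\<bar>"
      using c(1) by (simp add: abs_mult_pos' field_simps)
    also have "\<dots> \<le> ?c * (real (L * r ^ 4) * real k)"
      using L[OF r n(2)] unfolding c(2) by (simp add: n(1))
    finally show "\<bar>real (num_classes r k) / c r k - (real k)\<^sup>2\<bar> \<le> real (L * r ^ 4) * real k"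
      using c(1) by (simp only: mult_le_cancel_left_pos)
  qed
  then show ?thesis using comp unfolding c_def by (intro exI[of _ "\<lambda>r. L * r ^ 4"]) blast
qed

end
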